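(* Let $k\ge1$ be an integer, $b_0=[\frac{k+1}2]$ (integer part), $n\ge 0$, and let $\lambda$ be a level-$k$ restricted partition of $n$. Then $$\varphi_\lambda(\Gamma_\lambda)=G^{(3)}_\lambda\,\mathcal S_\lambda,$$ where $G^{(3)}_\lambda=G^{(2)}_\lambda\overline G^{(3)}_\lambda$ with $$G^{(2)}_\lambda=\prod_{a=1}^k\prod_j(x_j^{(a)})^{(a-b_0)_+}\prod_{1\le a<b\le k}\prod_{i,j}(x_i^{(a)}-x_j^{(b)})^{2a}\prod_{a=1}^k\prod_{i<j}(x_i^{(a)}-x_j^{(a)})^{2a},$$ $$\overline G^{(3)}_\lambda=\prod_{1\le a<b\le k;\ a+b>k}\ \prod_{i,j}(x_i^{(a)}+x_j^{(b)})^{a+b-k}\prod_{a>\frac k2}\prod_{i<j}(x_i^{(a)}+x_j^{(a)})^{2a-k}.$$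
   Context: $(s)_+=\max(s,0)$. Let $F_n^{(k,3)}$ be the space of symmetric polynomials $f\in\mathbb C[x_1,\dots,x_n]^{\mathfrak S_n}$ such that $f=0$ whenever $x_1=\cdots=x_a=-x_{a+1}=\cdots=-x_{k+1}$ for some $0\le a\le k+1$, and $f=0$ whenever $x_1=\cdots=x_{b_0+1}=0$ (a condition involving more than $n$ variables is void). A partition $\lambda$ of $n$ is level-$k$ restricted if all its parts are $\le k$; $m_a(\lambda)$ denotes the number of parts equal to $a$. Put $\mathcal S_\lambda=\bigotimes_{a=1}^k\mathbb C[x^{(a)}_1,\dots,x^{(a)}_{m_a(\lambda)}]^{\mathfrak S_{m_a(\lambda)}}$. The map $\varphi_\lambda:\mathbb C[x_1,\dots,x_n]^{\mathfrak S_n}\to\mathcal S_\lambda$ is the substitution which partitions the variables into groups indexed by $(a,i)$, $1\le a\le k$, $1\le i\le m_a(\lambda)$, the group $(a,i)$ having $a$ elements, and sets every variable of the group $(a,i)$ equal to $x^{(a)}_i$ (by symmetry the choice is irrelevant). In the products, the index of a variable with superscript $(a)$ runs over $1,\dots,m_a(\lambda)$. Lexicographic order: $\nu\succ\lambda$ iff for some $p$, $\nu_j=\lambda_j$ for $j<p$ and $\nu_p>\lambda_p$. Put $\Gamma_\lambda=\bigcap_{\nu\succ\lambda}\big(\operatorname{Ker}\varphi_\nu\cap F_n^{(k,3)}\big)$, where $\nu$ runs over level-$k$ restricted partitions of $n$ (an empty intersection means $F_n^{(k,3)}$). *)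

theory Defs
  imports
    Complex_Main
    "HOL-Library.Poly_Mapping"
    "HOL-Combinatorics.Permutations"
begin

section \<open>Complex polynomials in variables indexed by a type\<close>

text \<open>A polynomial is a finitely supported family of coefficients indexed by monomials,
  a monomial being a finitely supported exponent function. Multiplication is the convolution
  product of \<^theory>\<open>HOL-Library.Poly_Mapping\<close>.\<close>

type_synonym 'v cpoly = "('v \<Rightarrow>\<^sub>0 nat) \<Rightarrow>\<^sub>0 complex"

definition Const :: "complex \<Rightarrow> 'v cpoly" where
  "Const c = Poly_Mapping.single 0 c"

definition Var :: "'v \<Rightarrow> 'v cpoly" where
  "Var v = Poly_Mapping.single (Poly_Mapping.single v 1) 1"

definition vars :: "'v cpoly \<Rightarrow> 'v set" where
  "vars p = (\<Union>m\<in>Poly_Mapping.keys p. Poly_Mapping.keys m)"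

definition poly_at :: "'v cpoly \<Rightarrow> ('v \<Rightarrow> complex) \<Rightarrow> complex" where
  "poly_at p z = (\<Sum>m\<in>Poly_Mapping.keys p.
     Poly_Mapping.lookup p m * (\<Prod>v\<in>Poly_Mapping.keys m. z v ^ Poly_Mapping.lookup m v))"

definition subst :: "('v \<Rightarrow> 'w cpoly) \<Rightarrow> 'v cpoly \<Rightarrow> 'w cpoly" where
  "subst s p = (\<Sum>m\<in>Poly_Mapping.keys p.
     Const (Poly_Mapping.lookup p m) * (\<Prod>v\<in>Poly_Mapping.keys m. s v ^ Poly_Mapping.lookup m v))"

definition sym_polys :: "'v set \<Rightarrow> 'v cpoly set" where
  "sym_polys V = {p. vars p \<subseteq> V \<and> (\<forall>\<sigma>. \<sigma> permutes V \<longrightarrow> subst (\<lambda>v. Var (\<sigma> v)) p = p)}"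

section \<open>The spaces $F_n^{(k,3)}$\<close>

definition b0 :: "nat \<Rightarrow> nat" where
  "b0 k = (k + 1) div 2"

text \<open>The variables are \<^term>\<open>Var 1\<close>, ..., \<^term>\<open>Var n\<close>.\<close>

definition F3 :: "nat \<Rightarrow> nat \<Rightarrow> nat cpoly set" where
  "F3 k n = {f \<in> sym_polys {1..n}.
     (k + 1 \<le> n \<longrightarrow>
       (\<forall>a\<le>k + 1. \<forall>z w. (\<forall>i\<in>{1..a}. z i = w) \<and> (\<forall>i\<in>{a + 1..k + 1}. z i = - w)
          \<longrightarrow> poly_at f z = 0)) \<and>
     (b0 k + 1 \<le> n \<longrightarrow>
       (\<forall>z. (\<forall>i\<in>{1..b0 k + 1}. z i = 0) \<longrightarrow> poly_at f z = 0))}"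

section \<open>Partitions\<close>

definition restricted_partition :: "nat \<Rightarrow> nat \<Rightarrow> nat list \<Rightarrow> bool" where
  "restricted_partition k n lam \<longleftrightarrow>
     sorted_wrt (\<ge>) lam \<and> (\<forall>a\<in>set lam. 1 \<le> a \<and> a \<le> k) \<and> sum_list lam = n"

abbreviation part_mult :: "nat list \<Rightarrow> nat \<Rightarrow> nat" where
  "part_mult lam a \<equiv> count_list lam a"

text \<open>Parts are numbered from \<open>0\<close> and continued by zeros.\<close>

definition part :: "nat list \<Rightarrow> nat \<Rightarrow> nat" where
  "part lam j = (if j < length lam then lam ! j else 0)"

definition lex_greater :: "nat list \<Rightarrow> nat list \<Rightarrow> bool"  (infix "\<succ>\<^sub>l" 50) where
  "nu \<succ>\<^sub>l lam \<longleftrightarrow> (\<exists>p. (\<forall>j<p. part nu j = part lam j) \<and> part nu p > part lam p)"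

section \<open>The target algebra and the substitution map\<close>

text \<open>The variable $x^{(a)}_i$ is \<^term>\<open>Var (a, i)\<close>. The tensor product of the rings of
  symmetric polynomials in the separate alphabets is realised inside the polynomial ring in
  all these variables, a pure tensor being the product of its factors; the scalars are absorbed
  by the factors.\<close>

abbreviation X :: "nat \<Rightarrow> nat \<Rightarrow> (nat \<times> nat) cpoly" where
  "X a i \<equiv> Var (a, i)"

definition S_alg :: "nat \<Rightarrow> nat list \<Rightarrow> (nat \<times> nat) cpoly set" where
  "S_alg k lam = {p. \<exists>(N::nat) f.
     (\<forall>t<N. \<forall>a\<in>{1..k}. f t a \<in> sym_polys ({a} \<times> {1..part_mult lam a})) \<and>
     p = (\<Sum>t<N. \<Prod>a=1..k. f t a)}"

text \<open>A choice of grouping: entry $j - 1$ of this list is the label of the group that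
  contains $x_j$.\<close>

definition groups :: "nat list \<Rightarrow> (nat \<times> nat) list" where
  "groups lam = concat (map (\<lambda>a. concat (map (\<lambda>i. replicate a (a, i)) [1..<part_mult lam a + 1]))
     (remdups lam))"

lemma count_groups:
  "count_list (groups lam) (a, i) = (if i \<in> {1..part_mult lam a} then a else 0)"
proof -
  have repl: "count_list (replicate n x) y = (if x = y then n else 0)" for n and x y :: "nat \<times> nat"
    by (induction n) auto
  have inner: "count_list (concat (map (\<lambda>i. replicate b (b, i)) [Suc 0..<Suc m])) (a, i)
      = (if b = a \<and> i \<in> {1..m} then a else 0)" for b m
    by (induction m) (auto simp: repl le_Suc_eq)
  have outer: "distinct bs \<Longrightarrow>
      count_list (concat (map (\<lambda>b. concat (map (\<lambda>i. replicate b (b, i))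
        [Suc 0..<Suc (part_mult lam b)])) bs)) (a, i)
      = (if a \<in> set bs \<and> i \<in> {1..part_mult lam a} then a else 0)" for bs
    by (induction bs) (auto simp: inner simp del: upt_Suc)
  have "i \<notin> {1..part_mult lam a}" if "a \<notin> set lam"
    using that by (simp add: count_list_0_iff)
  then show ?thesis
    unfolding groups_def using outer[of "remdups lam"] by (auto simp del: upt_Suc)
qed

lemma length_groups: "length (groups lam) = sum_list lam"
proof -
  have inner: "length (concat (map (\<lambda>i. replicate a (a, i)) [Suc 0..<Suc m])) = m * a" for a m :: nat
    by (induction m) auto
  have "length (concat (map (\<lambda>a. concat (map (\<lambda>i. replicate a (a, i))
      [Suc 0..<Suc (part_mult lam a)])) as)) = (\<Sum>a\<leftarrow>as. part_mult lam a * a)" for as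
    by (induction as) (auto simp: inner simp del: upt_Suc length_concat)
  then have "length (groups lam) = (\<Sum>a\<leftarrow>remdups lam. part_mult lam a * a)"
    by (simp add: groups_def del: upt_Suc length_concat)
  also have "\<dots> = (\<Sum>a\<in>set lam. part_mult lam a * a)"
    by (simp add: sum_list_distinct_conv_sum_set)
  also have "\<dots> = sum_list lam"
    using sum_list_map_eq_sum_count[of "\<lambda>a. a" lam] by simp
  finally show ?thesis .
qed

definition phi :: "nat list \<Rightarrow> nat cpoly \<Rightarrow> (nat \<times> nat) cpoly" where
  "phi lam = subst (\<lambda>j. Var (groups lam ! (j - 1)))"

definition Gamma :: "nat \<Rightarrow> nat \<Rightarrow> nat list \<Rightarrow> nat cpoly set" where
  "Gamma k n lam = {f \<in> F3 k n. \<forall>nu. restricted_partition k n nu \<and> nu \<succ>\<^sub>l lam \<longrightarrow> phi nu f = 0}"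

section \<open>The products $G_\lambda$\<close>

text \<open>The exponent $(a - b_0)_+$ is the truncated subtraction on \<^typ>\<open>nat\<close>.\<close>

definition G2 :: "nat \<Rightarrow> nat list \<Rightarrow> (nat \<times> nat) cpoly" where
  "G2 k lam =
     (\<Prod>a=1..k. \<Prod>j=1..part_mult lam a. X a j ^ (a - b0 k)) *
     (\<Prod>(a, b)\<in>{(a, b). 1 \<le> a \<and> a < b \<and> b \<le> k}.
        \<Prod>i=1..part_mult lam a. \<Prod>j=1..part_mult lam b. (X a i - X b j) ^ (2 * a)) *
     (\<Prod>a=1..k. \<Prod>(i, j)\<in>{(i, j). 1 \<le> i \<and> i < j \<and> j \<le> part_mult lam a}.
        (X a i - X a j) ^ (2 * a))"

definition G3_bar :: "nat \<Rightarrow> nat list \<Rightarrow> (nat \<times> nat) cpoly" where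
  "G3_bar k lam =
     (\<Prod>(a, b)\<in>{(a, b). 1 \<le> a \<and> a < b \<and> b \<le> k \<and> a + b > k}.
        \<Prod>i=1..part_mult lam a. \<Prod>j=1..part_mult lam b. (X a i + X b j) ^ (a + b - k)) *
     (\<Prod>a\<in>{a. 1 \<le> a \<and> a \<le> k \<and> real a > real k / 2}.
        \<Prod>(i, j)\<in>{(i, j). 1 \<le> i \<and> i < j \<and> j \<le> part_mult lam a}. (X a i + X a j) ^ (2 * a - k))"

definition G3 :: "nat \<Rightarrow> nat list \<Rightarrow> (nat \<times> nat) cpoly" where
  "G3 k lam = G2 k lam * G3_bar k lam"

text \<open>Finiteness of the index sets of pairs, so that the products over them (and over their
  subsets) are genuine products and not the default value \<open>1\<close>.\<close>

lemma finite_index_pairs: "finite {(a, b). 1 \<le> a \<and> a < b \<and> b \<le> (m::nat)}"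
  by (rule finite_subset[of _ "{1..m} \<times> {1..m}"]) auto

end

theory Submission
  imports Defs "HOL-Library.Product_Lexorder"
begin

text \<open>The image lies in $G_\lambda \mathcal S_\lambda$: each linear factor of $G_\lambda$ is tested
  separately. Let the variables of one group vary freely as $t_i \pm y$ (or $t_i$), where $y$ is the value
  of another group. If $f$ vanishes as soon as $c + 1$ of the $t_i$ do, every monomial contains
  all but $c$ of them; this gives the factors $x + y$ and the powers of $x$. For the
  factors $x - y$ the vanishing at $t_i = 0$ comes from a larger partition, with a part enlarged by one
  and the rest of the smaller group split into ones, and symmetry makes the first derivative vanish as well.

  Conversely, distribute the variables over levels $1, \dots, k$, a group of size $a$ occupying
  the levels $1, \dots, a$, and symmetrize
  $\prod (x_i - x_j)^2 \prod (x_i + x_j) \cdot h$, the first product over pairs in the same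
  level and the second over pairs whose levels add up to $k + 1$, with $h$ symmetric in each level. By
  pigeonhole this lies in $F_n^{(k,3)}$, by a Gale--Ryser count it is killed by
  $\varphi_\nu$ for $\nu \succ \lambda$, and all surviving terms of its image under
  $\varphi_\lambda$ are equal, to a multiple of $G_\lambda \varphi_\lambda(h)$. The images of the $h$
  fill $\mathcal S_\lambda$, because differences of power sums of consecutive levels are the power sums of
  the separate alphabets.\<close>

section \<open>Polynomials as functions\<close>

text \<open>Both halves rest on the same numbers. As multiplicities, opening the smaller of two
  groups of sizes a and b gives 2 min(a,b), placing one group opposite the other gives a + b - k,
  and placing a group at zero gives (a - b0)_+. As incidences in a Young diagram, rows of lengths a
  and b share min(a,b) columns and meet in a + b - k pairs of columns l, k + 1 - l; inside one row
  such pairs contribute x + x = 2x, which explains both the powers of x and a constant power of 2.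

  The delicate factor is x - y: the defining conditions of \<open>F3\<close> do not make f vanish
  when one more variable joins a group of size below k. Membership in Gamma supplies this, provided
  that the variable comes from a group that is not larger, since the damage to its old group is then
  invisible in the lexicographic order.

  That order is handled through the conjugate partition: compare the numbers of parts of size at
  least d, starting from large d. Raising one part and bounding the capacity of a column both act on
  these numbers directly.

  Polynomials are compared through their values, and primality of a linear form is read off from the
  substitution that kills it.\<close>

lemma sum_single_keys: "p = (\<Sum>m\<in>Poly_Mapping.keys p. Poly_Mapping.single m (Poly_Mapping.lookup p m))"
  by (rule poly_mapping_eqI) (auto simp: lookup_sum lookup_single when_def in_keys_iff)

lemma poly_at_superset:
  assumes "finite A" "Poly_Mapping.keys p \<subseteq> A"
  shows "poly_at p z = (\<Sum>m\<in>A.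
     Poly_Mapping.lookup p m * (\<Prod>v\<in>Poly_Mapping.keys m. z v ^ Poly_Mapping.lookup m v))"
  unfolding poly_at_def using assms by (intro sum.mono_neutral_left) (auto simp: in_keys_iff)

lemma poly_at_add: "poly_at (p + q) z = poly_at p z + poly_at q z"
proof -
  let ?A = "Poly_Mapping.keys p \<union> Poly_Mapping.keys q"
  have "Poly_Mapping.keys (p + q) \<subseteq> ?A" by (rule keys_add)
  then show ?thesis
    by (simp add: poly_at_superset[of ?A] lookup_add sum.distrib algebra_simps)
qed

lemma poly_at_0: "poly_at 0 z = 0"
  by (simp add: poly_at_def)

lemma poly_at_single:
  "poly_at (Poly_Mapping.single m c) z = c * (\<Prod>v\<in>Poly_Mapping.keys m. z v ^ Poly_Mapping.lookup m v)"
  by (simp add: poly_at_def)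

lemma poly_at_Const: "poly_at (Const c) z = c"
  by (simp add: Const_def poly_at_single)

lemma poly_at_Var: "poly_at (Var v) z = z v"
  by (simp add: Var_def poly_at_single)

lemma poly_at_1: "poly_at 1 z = 1"
  by (simp add: poly_at_def)

lemma poly_at_sum: "poly_at (\<Sum>i\<in>I. f i) z = (\<Sum>i\<in>I. poly_at (f i) z)"
  by (induction I rule: infinite_finite_induct) (simp_all add: poly_at_0 poly_at_add)

lemma mon_superset:
  fixes z :: "'v \<Rightarrow> complex"
  assumes "finite A" "Poly_Mapping.keys m \<subseteq> A"
  shows "(\<Prod>v\<in>Poly_Mapping.keys m. z v ^ Poly_Mapping.lookup m v) =
    (\<Prod>v\<in>A. z v ^ Poly_Mapping.lookup m v)"
  using assms by (intro prod.mono_neutral_left) (auto simp: in_keys_iff)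

lemma poly_at_single_mult:
  "poly_at (Poly_Mapping.single m c * Poly_Mapping.single m' c') z =
    poly_at (Poly_Mapping.single m c) z * poly_at (Poly_Mapping.single m' c') z"
proof -
  let ?A = "Poly_Mapping.keys m \<union> Poly_Mapping.keys m'"
  have "Poly_Mapping.keys (m + m') \<subseteq> ?A" by (rule keys_add)
  then have "(\<Prod>v\<in>Poly_Mapping.keys (m + m'). z v ^ Poly_Mapping.lookup (m + m') v) =
      (\<Prod>v\<in>?A. z v ^ Poly_Mapping.lookup (m + m') v)"
    by (intro mon_superset) auto
  also have "\<dots> = (\<Prod>v\<in>?A. z v ^ Poly_Mapping.lookup m v) * (\<Prod>v\<in>?A. z v ^ Poly_Mapping.lookup m' v)"
    by (simp add: lookup_add power_add prod.distrib)
  finally show ?thesis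
    by (simp add: mult_single poly_at_single mon_superset[of ?A m] mon_superset[of ?A m'])
qed

lemma poly_at_mult: "poly_at (p * q) z = poly_at p z * poly_at q z"
proof -
  have "poly_at (p * q) z = poly_at ((\<Sum>m\<in>Poly_Mapping.keys p. Poly_Mapping.single m (Poly_Mapping.lookup p m)) *
     (\<Sum>m\<in>Poly_Mapping.keys q. Poly_Mapping.single m (Poly_Mapping.lookup q m))) z"
    using sum_single_keys[of p] sum_single_keys[of q] by simp
  also have "\<dots> = poly_at (\<Sum>m\<in>Poly_Mapping.keys p. Poly_Mapping.single m (Poly_Mapping.lookup p m)) z *
     poly_at (\<Sum>m\<in>Poly_Mapping.keys q. Poly_Mapping.single m (Poly_Mapping.lookup q m)) z"
    by (simp add: sum_product poly_at_sum poly_at_single_mult)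
  finally show ?thesis
    using sum_single_keys[of p] sum_single_keys[of q] by simp
qed

lemma poly_at_power: "poly_at (p ^ k) z = poly_at p z ^ k"
  by (induction k) (simp_all add: poly_at_1 poly_at_mult)

lemma poly_at_prod: "poly_at (\<Prod>i\<in>I. f i) z = (\<Prod>i\<in>I. poly_at (f i) z)"
  by (induction I rule: infinite_finite_induct) (simp_all add: poly_at_1 poly_at_mult)

lemma poly_at_uminus: "poly_at (- p) z = - poly_at p z"
  using poly_at_add[of p "- p" z] by (simp add: poly_at_0 eq_neg_iff_add_eq_0 add.commute)

lemma poly_at_diff: "poly_at (p - q) z = poly_at p z - poly_at q z"
  using poly_at_add[of p "- q" z] by (simp add: poly_at_uminus)

lemma poly_at_subst: "poly_at (subst s p) z = poly_at p (\<lambda>v. poly_at (s v) z)"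
  by (simp add: subst_def poly_at_sum poly_at_mult poly_at_Const poly_at_prod poly_at_power)
     (simp add: poly_at_def)

lemmas poly_at_simps = poly_at_add poly_at_0 poly_at_1 poly_at_Const poly_at_Var poly_at_sum
  poly_at_mult poly_at_power poly_at_prod poly_at_uminus poly_at_diff poly_at_subst

text \<open>Induction on the variables: with the others frozen, the sum is a polynomial in
  \<open>z v\<close> that vanishes identically, so every slice of constant exponent of
  \<open>v\<close> vanishes, and on a slice the remaining exponents still separate the
  indices.\<close>

lemma monomials_independent:
  fixes c :: "'i \<Rightarrow> complex" and e :: "'i \<Rightarrow> 'v \<Rightarrow> nat"
  assumes "finite V" "finite S"
    and "\<And>s t. s \<in> S \<Longrightarrow> t \<in> S \<Longrightarrow> (\<forall>v\<in>V. e s v = e t v) \<Longrightarrow> s = t"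
    and "\<And>z. (\<Sum>s\<in>S. c s * (\<Prod>v\<in>V. z v ^ e s v)) = 0"
    and "s \<in> S"
  shows "c s = 0"
  using assms
proof (induction V arbitrary: S s rule: finite_induct)
  case empty
  then have "S = {s}" by auto
  then show ?case using empty(3) by simp
next
  case (insert v V)
  let ?T = "{t \<in> S. e t v = e s v}"
  have "(\<Sum>t\<in>?T. c t * (\<Prod>v\<in>V. z v ^ e t v)) = 0" for z
  proof -
    define N where "N = (\<Sum>t\<in>S. e t v)"
    have le: "e t v \<le> N" if "t \<in> S" for t
      unfolding N_def by (rule member_le_sum) (use insert.prems(1) that in auto)
    define d where "d i = (\<Sum>t\<in>{t \<in> S. e t v = i}. c t * (\<Prod>v\<in>V. z v ^ e t v))" for i
    have "(\<Sum>i\<le>N. d i * x ^ i) = 0" for x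
    proof -
      have "(\<Sum>i\<le>N. d i * x ^ i) =
          (\<Sum>i\<le>N. \<Sum>t\<in>{t \<in> S. e t v = i}. c t * (\<Prod>v\<in>V. z v ^ e t v) * x ^ e t v)"
        by (simp add: d_def sum_distrib_right)
      also have "\<dots> = (\<Sum>t\<in>S. c t * (\<Prod>v\<in>V. z v ^ e t v) * x ^ e t v)"
        using le insert.prems(1) by (intro sum.group) auto
      also have "\<dots> = (\<Sum>t\<in>S. c t * (\<Prod>w\<in>insert v V. (z(v := x)) w ^ e t w))"
      proof (intro sum.cong refl)
        fix t
        have "(\<Prod>w\<in>V. (z(v := x)) w ^ e t w) = (\<Prod>w\<in>V. z w ^ e t w)"
          using insert.hyps by (intro prod.cong) auto
        then show "c t * (\<Prod>v\<in>V. z v ^ e t v) * x ^ e t v =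
            c t * (\<Prod>w\<in>insert v V. (z(v := x)) w ^ e t w)"
          using insert.hyps by (simp add: mult_ac)
      qed
      finally show ?thesis using insert.prems(3) by simp
    qed
    then have "d (e s v) = 0"
      using polyfun_eq_0[of d N] le[OF insert.prems(4)] by blast
    then show ?thesis by (simp add: d_def)
  qed
  note zero = this
  show ?case
  proof (rule insert.IH[of ?T s])
    show "finite ?T" "s \<in> ?T" using insert.prems(1,4) by auto
    show "s' = t" if "s' \<in> ?T" "t \<in> ?T" "\<forall>v\<in>V. e s' v = e t v" for s' t
      using that by (intro insert.prems(2)) auto
  qed (rule zero)
qed

text \<open>Applied with \<open>S\<close> a set of unwanted monomials of \<open>p\<close>: if their
  partial sum vanishes as a function, there are none.\<close>

lemma lookup_eq_0_of_independent:
  fixes p :: "'v cpoly"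
  assumes "S \<subseteq> Poly_Mapping.keys p"
    and "\<And>z. (\<Sum>m\<in>S. Poly_Mapping.lookup p m * (\<Prod>v\<in>Poly_Mapping.keys m. z v ^ Poly_Mapping.lookup m v)) = 0"
  shows "S = {}"
proof -
  have fin: "finite S" using finite_subset[OF assms(1)] by simp
  define V where "V = (\<Union>m\<in>S. Poly_Mapping.keys m)"
  have V: "finite V" using fin by (simp add: V_def)
  have "Poly_Mapping.lookup p m = 0" if "m \<in> S" for m
  proof (rule monomials_independent[of V S Poly_Mapping.lookup "Poly_Mapping.lookup p" m])
    show "finite V" "finite S" "m \<in> S" by (fact V, fact fin, fact that)
  next
    fix s t
    assume st: "s \<in> S" "t \<in> S" "\<forall>v\<in>V. Poly_Mapping.lookup s v = Poly_Mapping.lookup t v"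
    then have "Poly_Mapping.lookup s v = Poly_Mapping.lookup t v" for v
      by (cases "v \<in> V") (auto simp: V_def in_keys_iff)
    then show "s = t" by (simp add: poly_mapping_eqI)
  next
    fix z :: "'v \<Rightarrow> complex"
    have "(\<Prod>v\<in>Poly_Mapping.keys s. z v ^ Poly_Mapping.lookup s v) =
        (\<Prod>v\<in>V. z v ^ Poly_Mapping.lookup s v)" if "s \<in> S" for s
      using that V by (intro mon_superset) (auto simp: V_def)
    then show "(\<Sum>s\<in>S. Poly_Mapping.lookup p s * (\<Prod>v\<in>V. z v ^ Poly_Mapping.lookup s v)) = 0"
      using assms(2)[of z] by simp
  qed
  then show ?thesis using assms(1) by (auto simp: in_keys_iff)
qed

text \<open>The zero function has no monomials, by \<open>lookup_eq_0_of_independent\<close> for the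
  full key set of the difference. Identities of polynomials can therefore be checked on
  values.\<close>

lemma poly_eqI:
  assumes "\<And>z. poly_at p z = poly_at q z"
  shows "p = q"
proof -
  have "poly_at (p - q) z = 0" for z
    using assms by (simp add: poly_at_diff)
  then have "Poly_Mapping.keys (p - q) = {}"
    by (intro lookup_eq_0_of_independent[of _ "p - q"]) (simp_all only: poly_at_def order.refl)
  then show ?thesis by simp
qed

lemma subst_add: "subst s (p + q) = subst s p + subst s q"
  and subst_mult: "subst s (p * q) = subst s p * subst s q"
  and subst_diff: "subst s (p - q) = subst s p - subst s q"
  and subst_uminus: "subst s (- p) = - subst s p"
  and subst_power: "subst s (p ^ k) = subst s p ^ k"
  and subst_sum: "subst s (\<Sum>i\<in>I. f i) = (\<Sum>i\<in>I. subst s (f i))"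
  and subst_prod: "subst s (\<Prod>i\<in>I. f i) = (\<Prod>i\<in>I. subst s (f i))"
  and subst_Var: "subst s (Var v) = s v"
  and subst_Const: "subst s (Const c) = Const c"
  and subst_0: "subst s 0 = 0"
  and subst_1: "subst s 1 = 1"
  by (rule poly_eqI, simp add: poly_at_simps)+

lemmas subst_simps = subst_add subst_mult subst_diff subst_uminus subst_power subst_sum subst_prod
  subst_Var subst_Const subst_0 subst_1

lemma subst_subst: "subst s (subst t p) = subst (\<lambda>v. subst s (t v)) p"
  by (rule poly_eqI) (simp add: poly_at_subst)

lemma subst_id: "subst Var p = p"
  by (rule poly_eqI) (simp add: poly_at_subst poly_at_Var)

text \<open>\<open>subst Var p\<close> rewrites \<open>p\<close> as a sum of products of constants
  and powers of variables.\<close>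

lemma cpoly_induct [case_names Const Var add mult]:
  assumes "\<And>c. P (Const c)" "\<And>v. P (Var v)"
    and "\<And>p q. P p \<Longrightarrow> P q \<Longrightarrow> P (p + q)" "\<And>p q. P p \<Longrightarrow> P q \<Longrightarrow> P (p * q)"
  shows "P p"
proof -
  have zero: "P 0" using assms(1)[of 0] by (simp add: Const_def)
  have one: "P 1" using assms(1)[of 1] by (simp add: Const_def)
  have pw: "P q \<Longrightarrow> P (q ^ k)" for q k
    by (induction k) (simp_all add: one assms)
  have pr: "(\<And>i. i \<in> I \<Longrightarrow> P (f i)) \<Longrightarrow> P (prod f I)" for f and I :: "'a set"
    by (induction I rule: infinite_finite_induct) (simp_all add: one assms)
  have sm: "(\<And>i. i \<in> I \<Longrightarrow> P (f i)) \<Longrightarrow> P (sum f I)" for f and I :: "('a \<Rightarrow>\<^sub>0 nat) set"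
    by (induction I rule: infinite_finite_induct) (simp_all add: zero assms)
  have "P (subst Var p)" unfolding subst_def by (intro sm assms pr pw)
  then show ?thesis by (simp add: subst_id)
qed

lemma poly_at_cong: "(\<And>v. v \<in> vars p \<Longrightarrow> z v = z' v) \<Longrightarrow> poly_at p z = poly_at p z'"
  unfolding poly_at_def by (intro sum.cong arg_cong2[of _ _ _ _ "(*)"] prod.cong arg_cong2[of _ _ _ _ power] refl)
    (auto simp: vars_def)

lemma subst_cong: "(\<And>v. v \<in> vars p \<Longrightarrow> s v = s' v) \<Longrightarrow> subst s p = subst s' p"
  unfolding subst_def by (intro sum.cong arg_cong2[of _ _ _ _ "(*)"] prod.cong arg_cong2[of _ _ _ _ power] refl)
    (auto simp: vars_def)

text \<open>Setting the variables outside \<open>V\<close> to zero removes exactly the monomials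
  that leave \<open>V\<close>. If this never changes the value, those monomials sum to the zero
  function.\<close>

lemma vars_subset_iff:
  "vars p \<subseteq> V \<longleftrightarrow> (\<forall>z z'. (\<forall>v\<in>V. z v = z' v) \<longrightarrow> poly_at p z = poly_at p z')"
proof
  assume "vars p \<subseteq> V"
  then show "\<forall>z z'. (\<forall>v\<in>V. z v = z' v) \<longrightarrow> poly_at p z = poly_at p z'"
    by (auto intro!: poly_at_cong)
next
  assume *: "\<forall>z z'. (\<forall>v\<in>V. z v = z' v) \<longrightarrow> poly_at p z = poly_at p z'"
  define S where "S = {m \<in> Poly_Mapping.keys p. \<not> Poly_Mapping.keys m \<subseteq> V}"
  have "S = {}"
  proof (rule lookup_eq_0_of_independent)
    show "S \<subseteq> Poly_Mapping.keys p" by (auto simp: S_def)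
    fix z :: "'a \<Rightarrow> complex"
    let ?g = "\<lambda>z m. Poly_Mapping.lookup p m * (\<Prod>v\<in>Poly_Mapping.keys m. z v ^ Poly_Mapping.lookup m v)"
    let ?z = "\<lambda>v. if v \<in> V then z v else 0"
    have "poly_at p z = (\<Sum>m\<in>S. ?g z m) + (\<Sum>m\<in>Poly_Mapping.keys p - S. ?g z m)" for z
      unfolding poly_at_def by (subst sum.subset_diff[of S]) (auto simp: S_def add.commute)
    moreover have "(\<Sum>m\<in>Poly_Mapping.keys p - S. ?g ?z m) = (\<Sum>m\<in>Poly_Mapping.keys p - S. ?g z m)"
      by (intro sum.cong arg_cong2[of _ _ _ _ "(*)"] prod.cong refl) (auto simp: S_def)
    moreover have "(\<Sum>m\<in>S. ?g ?z m) = 0"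
    proof (rule sum.neutral, rule ballI)
      fix m assume "m \<in> S"
      then obtain v where "v \<in> Poly_Mapping.keys m" "v \<notin> V" by (auto simp: S_def)
      then have "(\<Prod>v\<in>Poly_Mapping.keys m. ?z v ^ Poly_Mapping.lookup m v) = 0"
        by (intro prod_zero) (auto simp: in_keys_iff intro!: bexI[of _ v])
      then show "?g ?z m = 0" by simp
    qed
    ultimately have "poly_at p z - poly_at p ?z = (\<Sum>m\<in>S. ?g z m)" by simp
    then show "(\<Sum>m\<in>S. ?g z m) = 0" using *[rule_format, of z ?z] by simp
  qed
  then show "vars p \<subseteq> V" by (auto simp: S_def vars_def)
qed

lemma sym_polys_iff:
  "p \<in> sym_polys V \<longleftrightarrow> vars p \<subseteq> V \<and> (\<forall>\<sigma> z. \<sigma> permutes V \<longrightarrow> poly_at p (\<lambda>v. z (\<sigma> v)) = poly_at p z)"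
proof -
  have "subst (\<lambda>v. Var (\<sigma> v)) p = p \<longleftrightarrow> (\<forall>z. poly_at p (\<lambda>v. z (\<sigma> v)) = poly_at p z)" for \<sigma> :: "'a \<Rightarrow> 'a"
  proof
    assume "subst (\<lambda>v. Var (\<sigma> v)) p = p"
    then have "poly_at (subst (\<lambda>v. Var (\<sigma> v)) p) z = poly_at p z" for z by simp
    then show "\<forall>z. poly_at p (\<lambda>v. z (\<sigma> v)) = poly_at p z" by (simp add: poly_at_simps)
  next
    assume "\<forall>z. poly_at p (\<lambda>v. z (\<sigma> v)) = poly_at p z"
    then show "subst (\<lambda>v. Var (\<sigma> v)) p = p" by (intro poly_eqI) (simp add: poly_at_simps)
  qed
  then show ?thesis unfolding sym_polys_def by auto
qed

section \<open>Divisibility by linear forms\<close>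

text \<open>Arguments congruent modulo \<open>d\<close> give congruent values; this is the source of
  the factor theorem.\<close>

lemma dvd_subst_diff:
  assumes "\<And>v. d dvd s v - t v"
  shows "d dvd subst s p - subst t p"
proof (induction p rule: cpoly_induct)
  case (add p q)
  have "subst s (p + q) - subst t (p + q) = (subst s p - subst t p) + (subst s q - subst t q)"
    by (simp add: subst_simps)
  then show ?case using add by (metis dvd_add)
next
  case (mult p q)
  have "subst s (p * q) - subst t (p * q) = subst s p * (subst s q - subst t q) + (subst s p - subst t p) * subst t q"
    by (simp add: subst_simps algebra_simps)
  then show ?case using mult by (metis dvd_add dvd_mult dvd_mult2)
qed (simp_all add: subst_simps assms)

text \<open>The factor theorem. The hypothesis holds when \<open>u\<close> does not occur in
  \<open>r\<close>; modulo \<open>Var u - r\<close> every polynomial equals its image under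
  \<open>u := r\<close>.\<close>

lemma linear_dvd_iff:
  assumes "subst (Var(u := r)) r = r"
  shows "Var u - r dvd p \<longleftrightarrow> subst (Var(u := r)) p = 0"
proof
  assume "Var u - r dvd p"
  then show "subst (Var(u := r)) p = 0" using assms by (auto simp: subst_simps elim!: dvdE)
next
  assume "subst (Var(u := r)) p = 0"
  moreover have "Var u - r dvd subst Var p - subst (Var(u := r)) p"
    by (rule dvd_subst_diff) auto
  ultimately show "Var u - r dvd p" by (simp add: subst_id)
qed

text \<open>Units are not excluded; lemmas that need a non-unit assume it separately. The order on
  the variables makes the polynomial ring an integral domain.\<close>

definition prime_form :: "'v::linorder cpoly \<Rightarrow> bool" where
  "prime_form d \<longleftrightarrow> d \<noteq> 0 \<and> (\<forall>p q. d dvd p * q \<longrightarrow> d dvd p \<or> d dvd q)"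

text \<open>By \<open>linear_dvd_iff\<close> the multiples of the form are the kernel of a
  substitution, a homomorphism into a domain.\<close>

lemma prime_form_linear:
  assumes "subst (Var(u := r)) r = r" "Var u \<noteq> r"
  shows "prime_form (Var u - r)"
  using assms by (auto simp: prime_form_def linear_dvd_iff subst_simps)

lemma prime_form_power_dvd:
  assumes d: "prime_form d" "\<not> d dvd a" and "d ^ e dvd a * b"
  shows "d ^ e dvd b"
  using assms(3)
proof (induction e)
  case (Suc e)
  then obtain c where c: "b = d ^ e * c"
    using dvd_trans[of "d ^ e" "d ^ Suc e" "a * b"] by (auto elim!: dvdE)
  from Suc.prems obtain x where "a * b = d ^ Suc e * x" by (elim dvdE)
  then have "d ^ e * (a * c) = d ^ e * (d * x)" by (simp add: c algebra_simps)
  then have "a * c = d * x" using d by (simp add: prime_form_def)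
  then have "d dvd c" using d unfolding prime_form_def by (metis dvd_triv_left)
  then show ?case by (simp add: c mult_dvd_mono mult.commute)
qed simp

lemma prime_form_not_dvd_prod:
  assumes "prime_form d" "finite I" "\<not> d dvd 1" "\<And>i. i \<in> I \<Longrightarrow> \<not> d dvd l i"
  shows "\<not> d dvd (\<Prod>i\<in>I. l i ^ e i)"
proof -
  have "d dvd a ^ n \<Longrightarrow> d dvd a" for a n
    using assms(1,3) by (induction n) (auto simp: prime_form_def)
  with assms(2,4) assms(1,3) show ?thesis
    by (induction I rule: finite_induct) (simp_all, metis prime_form_def)
qed

text \<open>The fragment of unique factorization needed for \<open>G3\<close>: powers of pairwise
  non-dividing primes that divide \<open>p\<close> one by one divide it jointly.\<close>

lemma prod_prime_forms_dvd:
  assumes "finite I"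
    and "\<And>i. i \<in> I \<Longrightarrow> prime_form (l i) \<and> \<not> l i dvd 1"
    and "\<And>i j. i \<in> I \<Longrightarrow> j \<in> I \<Longrightarrow> i \<noteq> j \<Longrightarrow> \<not> l i dvd l j"
    and "\<And>i. i \<in> I \<Longrightarrow> l i ^ e i dvd p"
  shows "(\<Prod>i\<in>I. l i ^ e i) dvd p"
  using assms
proof (induction I rule: finite_induct)
  case (insert i I)
  then have "(\<Prod>i\<in>I. l i ^ e i) dvd p" by auto
  then obtain r where r: "p = (\<Prod>i\<in>I. l i ^ e i) * r" by (elim dvdE)
  have "\<not> l i dvd (\<Prod>i\<in>I. l i ^ e i)"
    using insert by (intro prime_form_not_dvd_prod) auto
  moreover have "l i ^ e i dvd p" "prime_form (l i)" using insert.prems by auto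
  ultimately have "l i ^ e i dvd r" using prime_form_power_dvd r by blast
  then show ?case using insert.hyps r by (simp add: mult_dvd_mono mult.commute)
qed simp

lemma Var_dvd_of_vanishing:
  assumes "\<And>z. z v = 0 \<Longrightarrow> poly_at q z = 0"
  shows "Var v dvd q"
proof -
  have "subst (Var(v := 0)) q = 0"
    by (rule poly_eqI) (auto simp: poly_at_simps intro!: assms)
  then show ?thesis using linear_dvd_iff[of v 0 q] by (simp add: subst_simps)
qed

text \<open>A monomial of \<open>q\<close> that omits more than \<open>c\<close> variables of
  \<open>J\<close> would survive setting \<open>Suc c\<close> of the omitted ones to zero. So each
  monomial contains at least \<open>card J - c\<close> of them, and each of these turns into a
  multiple of \<open>d\<close>.\<close>

lemma power_dvd_subst_of_vanishing:
  assumes fin: "finite J"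
    and van: "\<And>K z. K \<subseteq> J \<Longrightarrow> card K = Suc c \<Longrightarrow> (\<forall>v\<in>K. z v = 0) \<Longrightarrow> poly_at q z = 0"
    and d: "\<And>v. v \<in> J \<Longrightarrow> d dvd s v"
  shows "d ^ (card J - c) dvd subst s q"
proof -
  have *: "card J - c \<le> (\<Sum>v\<in>J. Poly_Mapping.lookup m v)" if m: "m \<in> Poly_Mapping.keys q" for m
  proof (rule ccontr)
    let ?Z = "J - Poly_Mapping.keys m"
    assume "\<not> ?thesis"
    moreover have "card (J \<inter> Poly_Mapping.keys m) \<le> (\<Sum>v\<in>J. Poly_Mapping.lookup m v)"
    proof -
      have "card (J \<inter> Poly_Mapping.keys m) = (\<Sum>v\<in>J \<inter> Poly_Mapping.keys m. 1)" by simp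
      also have "\<dots> \<le> (\<Sum>v\<in>J \<inter> Poly_Mapping.keys m. Poly_Mapping.lookup m v)"
        by (intro sum_mono) (auto simp: in_keys_iff)
      also have "\<dots> \<le> (\<Sum>v\<in>J. Poly_Mapping.lookup m v)"
        using fin by (intro sum_mono2) auto
      finally show ?thesis .
    qed
    moreover have "card J = card (J \<inter> Poly_Mapping.keys m) + card ?Z"
      using fin card_Int_Diff by blast
    ultimately have "Suc c \<le> card ?Z" by linarith
    then obtain K where K: "K \<subseteq> ?Z" "card K = Suc c" "finite K"
      using obtain_subset_with_card_n by blast
    \<comment> \<open>The monomials avoiding \<open>K\<close> are what is left of \<open>q\<close>
      when the variables in \<open>K\<close> vanish; \<open>m\<close> would be one of them.\<close>
    define S where "S = {m \<in> Poly_Mapping.keys q. Poly_Mapping.keys m \<inter> K = {}}"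
    have "S = {}"
    proof (rule lookup_eq_0_of_independent)
      show "S \<subseteq> Poly_Mapping.keys q" by (auto simp: S_def)
      fix z :: "'a \<Rightarrow> complex"
      let ?z = "\<lambda>v. if v \<in> K then 0 else z v"
      have "0 = poly_at q ?z" using K by (intro van[symmetric, of K]) auto
      also have "\<dots> = (\<Sum>m\<in>S. Poly_Mapping.lookup q m * (\<Prod>v\<in>Poly_Mapping.keys m. ?z v ^ Poly_Mapping.lookup m v))"
        unfolding poly_at_def
        by (intro sum.mono_neutral_right) (auto simp: S_def in_keys_iff)
      also have "\<dots> = (\<Sum>m\<in>S. Poly_Mapping.lookup q m * (\<Prod>v\<in>Poly_Mapping.keys m. z v ^ Poly_Mapping.lookup m v))"
        by (intro sum.cong arg_cong2[of _ _ _ _ "(*)"] prod.cong refl) (auto simp: S_def)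
      finally show "(\<Sum>m\<in>S. Poly_Mapping.lookup q m * (\<Prod>v\<in>Poly_Mapping.keys m. z v ^ Poly_Mapping.lookup m v)) = 0"
        by simp
    qed
    then show False using m K by (auto simp: S_def)
  qed
  show ?thesis
    unfolding subst_def
  proof (intro dvd_sum dvd_mult)
    fix m assume m: "m \<in> Poly_Mapping.keys q"
    have "d ^ (card J - c) dvd d ^ (\<Sum>v\<in>J. Poly_Mapping.lookup m v)"
      using *[OF m] by (rule le_imp_power_dvd)
    also have "\<dots> = (\<Prod>v\<in>J. d ^ Poly_Mapping.lookup m v)" by (simp add: power_sum)
    also have "\<dots> = (\<Prod>v\<in>J \<inter> Poly_Mapping.keys m. d ^ Poly_Mapping.lookup m v)"
      using fin by (intro prod.mono_neutral_right) (auto simp: in_keys_iff)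
    also have "\<dots> dvd (\<Prod>v\<in>J \<inter> Poly_Mapping.keys m. s v ^ Poly_Mapping.lookup m v)"
      by (intro prod_dvd_prod) (auto intro: dvd_power_same d)
    also have "\<dots> dvd (\<Prod>v\<in>Poly_Mapping.keys m. s v ^ Poly_Mapping.lookup m v)"
      by (intro prod_dvd_prod_subset) auto
    finally show "d ^ (card J - c) dvd (\<Prod>v\<in>Poly_Mapping.keys m. s v ^ Poly_Mapping.lookup m v)" .
  qed
qed

text \<open>\<open>d\<close> is the gradient at \<open>z\<close> along \<open>V\<close>. One
  \<open>d\<close> serves all directions \<open>h\<close>, and this linearity later compares a
  diagonal direction with the single coordinates.\<close>

lemma poly_at_directional_derivative:
  fixes p :: "'v cpoly"
  assumes "finite V"
  shows "\<exists>d. \<forall>h. (\<forall>v. v \<notin> V \<longrightarrow> h v = 0) \<longrightarrow>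
    ((\<lambda>t. poly_at p (\<lambda>v. z v + t * h v)) has_field_derivative (\<Sum>v\<in>V. h v * d v)) (at 0)"
proof (induction p rule: cpoly_induct)
  case (Const c)
  show ?case by (intro exI[of _ "\<lambda>_. 0"]) (simp add: poly_at_simps)
next
  case (Var v)
  show ?case
  proof (intro exI[of _ "\<lambda>w. if w = v then 1 else 0"] allI impI)
    fix h :: "'v \<Rightarrow> complex" assume "\<forall>v. v \<notin> V \<longrightarrow> h v = 0"
    then have "(\<Sum>w\<in>V. h w * (if w = v then 1 else 0)) = h v"
      using assms by (cases "v \<in> V") (auto simp: if_distrib cong: if_cong)
    moreover have "((\<lambda>t. z v + t * h v) has_field_derivative h v) (at 0)"
      by (auto intro!: derivative_eq_intros)
    ultimately show "((\<lambda>t. poly_at (Var v) (\<lambda>v. z v + t * h v)) has_field_derivative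
        (\<Sum>w\<in>V. h w * (if w = v then 1 else 0))) (at 0)"
      by (simp add: poly_at_Var)
  qed
next
  case (add p q)
  then obtain d e where
    d: "\<And>h. \<forall>v. v \<notin> V \<longrightarrow> h v = 0 \<Longrightarrow>
      ((\<lambda>t. poly_at p (\<lambda>v. z v + t * h v)) has_field_derivative (\<Sum>v\<in>V. h v * d v)) (at 0)" and
    e: "\<And>h. \<forall>v. v \<notin> V \<longrightarrow> h v = 0 \<Longrightarrow>
      ((\<lambda>t. poly_at q (\<lambda>v. z v + t * h v)) has_field_derivative (\<Sum>v\<in>V. h v * e v)) (at 0)"
    by auto
  show ?case
  proof (intro exI[of _ "\<lambda>v. d v + e v"] allI impI)
    fix h :: "'v \<Rightarrow> complex" assume h: "\<forall>v. v \<notin> V \<longrightarrow> h v = 0"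
    show "((\<lambda>t. poly_at (p + q) (\<lambda>v. z v + t * h v)) has_field_derivative
        (\<Sum>v\<in>V. h v * (d v + e v))) (at 0)"
      using DERIV_add[OF d[OF h] e[OF h]]
      by (simp add: poly_at_add distrib_left sum.distrib)
  qed
next
  case (mult p q)
  then obtain d e where
    d: "\<And>h. \<forall>v. v \<notin> V \<longrightarrow> h v = 0 \<Longrightarrow>
      ((\<lambda>t. poly_at p (\<lambda>v. z v + t * h v)) has_field_derivative (\<Sum>v\<in>V. h v * d v)) (at 0)" and
    e: "\<And>h. \<forall>v. v \<notin> V \<longrightarrow> h v = 0 \<Longrightarrow>
      ((\<lambda>t. poly_at q (\<lambda>v. z v + t * h v)) has_field_derivative (\<Sum>v\<in>V. h v * e v)) (at 0)"
    by auto
  show ?case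
  proof (intro exI[of _ "\<lambda>v. d v * poly_at q z + e v * poly_at p z"] allI impI)
    fix h :: "'v \<Rightarrow> complex" assume h: "\<forall>v. v \<notin> V \<longrightarrow> h v = 0"
    show "((\<lambda>t. poly_at (p * q) (\<lambda>v. z v + t * h v)) has_field_derivative
        (\<Sum>v\<in>V. h v * (d v * poly_at q z + e v * poly_at p z))) (at 0)"
      using DERIV_mult[OF d[OF h] e[OF h]]
      by (simp add: poly_at_mult algebra_simps sum.distrib sum_distrib_left sum_distrib_right)
  qed
qed

section \<open>Groupings of the variables\<close>

text \<open>Bijections between the fibres over each value are glued together.\<close>

lemma bij_of_equal_fibres:
  assumes "finite A" "finite B"
    and "\<And>c. card {a \<in> A. f a = c} = card {b \<in> B. g b = c}"
  shows "\<exists>\<beta>. bij_betw \<beta> A B \<and> (\<forall>a\<in>A. g (\<beta> a) = f a)"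
proof -
  have "\<exists>h. bij_betw h {a \<in> A. f a = c} {b \<in> B. g b = c}" for c
    using assms by (intro finite_same_card_bij) auto
  then obtain h where h: "\<And>c. bij_betw (h c) {a \<in> A. f a = c} {b \<in> B. g b = c}" by metis
  have h_in: "h (f a) a \<in> B \<and> g (h (f a) a) = f a" if "a \<in> A" for a
    using bij_betwE[OF h[of "f a"]] that by auto
  have "bij_betw (\<lambda>a. h (f a) a) A B"
    unfolding bij_betw_def
  proof
    show "inj_on (\<lambda>a. h (f a) a) A"
    proof (rule inj_onI)
      fix a a' assume aa: "a \<in> A" "a' \<in> A" "h (f a) a = h (f a') a'"
      then have "f a = f a'" using h_in by metis
      then show "a = a'" using aa h[of "f a"] by (auto simp: bij_betw_def inj_on_def)
    qed
    show "(\<lambda>a. h (f a) a) ` A = B"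
    proof
      show "B \<subseteq> (\<lambda>a. h (f a) a) ` A"
      proof
        fix b assume "b \<in> B"
        then have "b \<in> h (g b) ` {a \<in> A. f a = g b}" using h[of "g b"] by (auto simp: bij_betw_def)
        then obtain a where "a \<in> A" "b = h (f a) a" by auto
        then show "b \<in> (\<lambda>a. h (f a) a) ` A" by blast
      qed
    qed (use h_in in auto)
  qed
  then show ?thesis using h_in by auto
qed

lemma permutes_of_equal_fibres:
  assumes "finite A" "\<And>c. card {a \<in> A. f a = c} = card {a \<in> A. g a = c}"
  shows "\<exists>\<sigma>. \<sigma> permutes A \<and> (\<forall>a\<in>A. g (\<sigma> a) = f a)"
proof -
  obtain \<beta> where \<beta>: "bij_betw \<beta> A A" "\<forall>a\<in>A. g (\<beta> a) = f a"
    using bij_of_equal_fibres[OF assms(1,1,2)] by auto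
  have "(\<lambda>a. if a \<in> A then \<beta> a else a) permutes A"
    using \<beta>(1) by (intro bij_imp_permutes) (auto cong: bij_betw_cong)
  then show ?thesis using \<beta>(2) by (intro exI[of _ "\<lambda>a. if a \<in> A then \<beta> a else a"]) auto
qed

lemma sym_poly_at_permute:
  assumes "f \<in> sym_polys A" "\<sigma> permutes A" "\<And>i. i \<in> A \<Longrightarrow> x i = y (\<sigma> i)"
  shows "poly_at f x = poly_at f y"
proof -
  have "poly_at f x = poly_at f (\<lambda>i. y (\<sigma> i))"
    using assms by (intro poly_at_cong) (auto simp: sym_polys_iff)
  then show ?thesis using assms by (auto simp: sym_polys_iff)
qed

lemma sym_poly_at_equal_fibres:
  assumes "f \<in> sym_polys A" "finite A" "\<And>u. card {i \<in> A. c i = u} = card {i \<in> A. c' i = u}"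
  shows "poly_at f (\<lambda>i. z (c i)) = poly_at f (\<lambda>i. z (c' i))"
proof -
  obtain \<sigma> where "\<sigma> permutes A" "\<forall>a\<in>A. c' (\<sigma> a) = c a"
    using permutes_of_equal_fibres[OF assms(2,3)] by auto
  then show ?thesis using assms(1) by (intro sym_poly_at_permute) auto
qed

section \<open>Labels of groups, labellings and the conjugate partition\<close>

definition labels :: "nat list \<Rightarrow> (nat \<times> nat) set" where
  "labels lam = {(a, i). 1 \<le> i \<and> i \<le> part_mult lam a}"

definition grp :: "nat list \<Rightarrow> nat \<Rightarrow> nat \<times> nat" where
  "grp lam j = groups lam ! (j - 1)"

text \<open>The \<open>d\<close>-th part of the conjugate partition, later the number of variables
  on level \<open>d\<close>.\<close>

definition count_ge :: "nat list \<Rightarrow> nat \<Rightarrow> nat" where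
  "count_ge lam d = card {u \<in> labels lam. d \<le> fst u}"

lemma labels_Sigma: "labels lam = (SIGMA a:set lam. {1..part_mult lam a})"
proof -
  have "a \<in> set lam" if "1 \<le> i" "i \<le> part_mult lam a" for a i
    using that count_list_0_iff[of lam a] by (cases "a \<in> set lam") auto
  then show ?thesis by (auto simp: labels_def)
qed

lemma finite_labels [simp]: "finite (labels lam)"
  by (simp add: labels_Sigma)

lemma labels_size: "restricted_partition k n lam \<Longrightarrow> u \<in> labels lam \<Longrightarrow> 1 \<le> fst u \<and> fst u \<le> k"
  by (auto simp: labels_Sigma restricted_partition_def)

lemma card_labels_eq: "card {u \<in> labels lam. fst u = a} = part_mult lam a"
proof -
  have "{u \<in> labels lam. fst u = a} = {a} \<times> {1..part_mult lam a}" by (auto simp: labels_def)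
  then show ?thesis by (simp add: card_cartesian_product)
qed

lemma count_ge_length: "count_ge lam d = length (filter (\<lambda>a. d \<le> a) lam)"
proof -
  have "{u \<in> labels lam. d \<le> fst u} = (SIGMA a:set (filter (\<lambda>a. d \<le> a) lam). {1..part_mult lam a})"
    by (auto simp: labels_Sigma)
  then have "count_ge lam d = (\<Sum>a\<in>set (filter (\<lambda>a. d \<le> a) lam). part_mult lam a)"
    unfolding count_ge_def by (simp add: card_SigmaI)
  also have "\<dots> = (\<Sum>a\<in>set (filter (\<lambda>a. d \<le> a) lam). part_mult (filter (\<lambda>a. d \<le> a) lam) a)"
    by (intro sum.cong refl) (auto simp: count_list_eq_length_filter intro!: arg_cong[of _ _ length] filter_cong)
  also have "\<dots> = length (filter (\<lambda>a. d \<le> a) lam)"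
    by (intro sum_count_set) auto
  finally show ?thesis .
qed

lemma card_grp_fibre:
  assumes "sum_list lam = n"
  shows "card {j \<in> {1..n}. grp lam j = u} = (if u \<in> labels lam then fst u else 0)"
proof -
  have len: "length (groups lam) = n" using assms by (simp add: length_groups)
  have "card {j \<in> {1..n}. grp lam j = u} = card {i. i < length (groups lam) \<and> groups lam ! i = u}"
    by (rule bij_betw_same_card[of "\<lambda>j. j - 1"], rule bij_betwI[of _ _ _ Suc])
       (auto simp: grp_def len)
  also have "\<dots> = count_list (groups lam) u"
    by (simp add: count_list_eq_length_filter length_filter_conv_card eq_commute)
  finally show ?thesis by (cases u) (simp add: count_groups labels_def)
qed

lemma grp_in_labels:
  assumes "sum_list lam = n" "j \<in> {1..n}"
  shows "grp lam j \<in> labels lam"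
proof (rule ccontr)
  assume "\<not> ?thesis"
  then have "card {i \<in> {1..n}. grp lam i = grp lam j} = 0" using card_grp_fibre[OF assms(1)] by simp
  moreover have "finite {i \<in> {1..n}. grp lam i = grp lam j}" by simp
  ultimately have "{i \<in> {1..n}. grp lam i = grp lam j} = {}" using card_0_eq by blast
  then show False using assms(2) by blast
qed

lemma poly_at_phi: "poly_at (phi lam f) z = poly_at f (\<lambda>j. z (grp lam j))"
  by (simp add: phi_def grp_def poly_at_simps)

lemma phi_simps:
  "phi lam (p + q) = phi lam p + phi lam q"
  "phi lam (p * q) = phi lam p * phi lam q"
  "phi lam (Const c) = Const c"
  "phi lam (Var j) = Var (grp lam j)"
  "phi lam (\<Sum>i\<in>I. g i) = (\<Sum>i\<in>I. phi lam (g i))"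
  "phi lam (p ^ e) = phi lam p ^ e"
  by (simp_all add: phi_def grp_def subst_simps)

lemma vars_phi:
  assumes "sum_list lam = n" "vars f \<subseteq> {1..n}"
  shows "vars (phi lam f) \<subseteq> labels lam"
  unfolding vars_subset_iff poly_at_phi
  using assms grp_in_labels[OF assms(1)] by (auto intro!: poly_at_cong)

text \<open>A symmetric polynomial depends only on how many variables carry each label, so a
  labelling whose class sizes are those of the groups of \<open>lam\<close> evaluates like
  \<open>phi lam\<close>, with the values moved along the inverse of \<open>\<beta>\<close>.\<close>

lemma grouping_of_labelling:
  assumes sym: "f \<in> sym_polys {1..n}"
    and lam: "sum_list lam = n"
    and \<beta>: "bij_betw \<beta> (c ` {1..n}) (labels lam)"
    and size: "\<And>v. v \<in> c ` {1..n} \<Longrightarrow> fst (\<beta> v) = card {i \<in> {1..n}. c i = v}"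
  shows "poly_at f (\<lambda>i. z (c i)) = poly_at (phi lam f) (\<lambda>u. z (inv_into (c ` {1..n}) \<beta> u))"
proof -
  let ?z = "\<lambda>u. z (inv_into (c ` {1..n}) \<beta> u)"
  have inj: "inj_on \<beta> (c ` {1..n})" using \<beta> by (simp add: bij_betw_def)
  have "poly_at f (\<lambda>i. z (c i)) = poly_at f (\<lambda>i. ?z (\<beta> (c i)))"
    using sym inj by (intro poly_at_cong) (auto simp: sym_polys_def inv_into_f_f subsetD)
  also have "\<dots> = poly_at f (\<lambda>i. ?z (grp lam i))"
  proof (rule sym_poly_at_equal_fibres[OF sym, where c = "\<lambda>i. \<beta> (c i)" and c' = "grp lam" and z = ?z])
    fix u
    show "card {i \<in> {1..n}. \<beta> (c i) = u} = card {i \<in> {1..n}. grp lam i = u}"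
    proof (cases "u \<in> labels lam")
      case True
      then have "u \<in> \<beta> ` (c ` {1..n})" using \<beta> by (simp add: bij_betw_def)
      then obtain v where v: "v \<in> c ` {1..n}" "\<beta> v = u" by blast
      have "{i \<in> {1..n}. \<beta> (c i) = u} = {i \<in> {1..n}. c i = v}"
        using v inj by (auto dest: inj_onD)
      then have "card {i \<in> {1..n}. \<beta> (c i) = u} = fst u" using size[OF v(1)] v(2) by simp
      then show ?thesis using True by (simp only: card_grp_fibre[OF lam] if_True)
    next
      case False
      then have "{i \<in> {1..n}. \<beta> (c i) = u} = {}" using \<beta> by (auto simp: bij_betw_def)
      then show ?thesis using False by (simp only: card_grp_fibre[OF lam] if_False card.empty)
    qed
  qed simp
  finally show ?thesis by (simp add: poly_at_phi)
qed

text \<open>\<open>nu\<close> is the decreasing list of class sizes of \<open>c\<close>; classes are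
  then matched with labels of the same size.\<close>

lemma partition_of_labelling:
  fixes c :: "nat \<Rightarrow> 'l"
  assumes "\<And>i. i \<in> {1..n} \<Longrightarrow> card {j \<in> {1..n}. c j = c i} \<le> k"
  obtains nu \<beta> where "restricted_partition k n nu"
    and "bij_betw \<beta> (c ` {1..n}) (labels nu)"
    and "\<And>v. v \<in> c ` {1..n} \<Longrightarrow> fst (\<beta> v) = card {i \<in> {1..n}. c i = v}"
proof -
  let ?V = "c ` {1..n}"
  define s where "s v = card {i \<in> {1..n}. c i = v}" for v
  define nu where "nu = rev (sorted_list_of_multiset (image_mset s (mset_set ?V)))"
  have mset: "mset nu = image_mset s (mset_set ?V)" by (simp add: nu_def)
  have set: "set nu = s ` ?V" using arg_cong[OF mset, of set_mset] by simp
  have "1 \<le> s v \<and> s v \<le> k" if v: "v \<in> ?V" for v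
  proof -
    from v obtain i where i: "i \<in> {1..n}" "v = c i" by auto
    have "{j \<in> {1..n}. c j = c i} \<noteq> {}" using i by blast
    then have "0 < card {j \<in> {1..n}. c j = c i}" by (subst card_gt_0_iff) auto
    then show ?thesis using assms[OF i(1)] unfolding s_def i(2) by linarith
  qed
  moreover have "sum_list nu = n"
  proof -
    have "sum_list nu = (\<Sum>v\<in>?V. s v)"
      using mset by (simp add: sum_unfold_sum_mset flip: sum_mset_sum_list)
    also have "\<dots> = (\<Sum>v\<in>?V. \<Sum>i\<in>{i \<in> {1..n}. c i = v}. 1)" by (simp add: s_def)
    also have "\<dots> = (\<Sum>i\<in>{1..n}. 1)" by (rule sum.group) auto
    finally show ?thesis by simp
  qed
  moreover have "sorted_wrt (\<ge>) nu" by (simp add: nu_def sorted_wrt_rev)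
  ultimately have "restricted_partition k n nu"
    by (auto simp: restricted_partition_def set)
  moreover have "card {v \<in> ?V. s v = a} = card {u \<in> labels nu. fst u = a}" for a
  proof -
    have "part_mult nu a = count (mset nu) a"
      by (simp add: count_mset count_list_eq_length_filter eq_commute)
    also have "\<dots> = card {v \<in> ?V. s v = a}"
      unfolding mset by (simp add: count_image_mset_eq_card_vimage)
    finally show ?thesis by (simp add: card_labels_eq)
  qed
  then obtain \<beta> where "bij_betw \<beta> ?V (labels nu)" "\<forall>v\<in>?V. fst (\<beta> v) = s v"
    using bij_of_equal_fibres[of ?V "labels nu" s fst] by auto
  ultimately show thesis using that by (auto simp: s_def)
qed

text \<open>Duality with the conjugate partition, positions being counted from 0. At
  \<open>d = 0\<close> it would fail, since parts are continued by zeros.\<close>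

lemma part_ge_iff:
  assumes "sorted_wrt (\<ge>) lam" "1 \<le> d"
  shows "d \<le> part lam j \<longleftrightarrow> j < count_ge lam d"
  using assms(1)
proof (induction lam arbitrary: j)
  case Nil
  then show ?case using assms(2) by (simp add: part_def count_ge_length)
next
  case (Cons a lam)
  show ?case
  proof (cases "d \<le> a")
    case True
    then show ?thesis
      using Cons.prems Cons.IH[of "j - 1"] assms(2)
      by (cases j) (simp_all add: part_def count_ge_length split: if_splits)
  next
    case False
    then have "\<forall>b\<in>set (a # lam). \<not> d \<le> b" using Cons.prems by auto
    moreover from this have "count_ge (a # lam) d = 0" by (simp add: count_ge_length)
    moreover have "part (a # lam) j = 0 \<or> part (a # lam) j \<in> set (a # lam)"
      unfolding part_def using nth_mem[of j "a # lam"] by auto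
    ultimately show ?thesis using assms(2) by auto
  qed
qed

lemma part_antimono:
  assumes "sorted_wrt (\<ge>) lam" "i \<le> j"
  shows "part lam j \<le> part lam i"
  using assms unfolding part_def sorted_wrt_iff_nth_less by (auto simp: le_less)

text \<open>In terms of the conjugate partitions, the first differing part becomes the largest
  threshold \<open>c\<close> at which the counts differ.\<close>

lemma lex_greater_iff:
  assumes "sorted_wrt (\<ge>) lam" "sorted_wrt (\<ge>) nu"
  shows "nu \<succ>\<^sub>l lam \<longleftrightarrow>
    (\<exists>c\<ge>1. (\<forall>d>c. count_ge nu d = count_ge lam d) \<and> count_ge lam c < count_ge nu c)"
proof
  assume "nu \<succ>\<^sub>l lam"
  then obtain p where p: "\<forall>j<p. part nu j = part lam j" "part lam p < part nu p"
    by (auto simp: lex_greater_def)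
  \<comment> \<open>Before \<open>p\<close> the parts agree, and from \<open>p\<close> on those of
    both partitions are at most \<open>c\<close>; so all counts above \<open>c\<close>
    coincide.\<close>
  define c where "c = part nu p"
  have c: "1 \<le> c" using p by (simp add: c_def)
  have "count_ge nu d = count_ge lam d" if d: "c < d" for d
  proof -
    have "d \<le> part nu j \<longleftrightarrow> d \<le> part lam j" for j
    proof (cases "j < p")
      case False
      then have "part nu j \<le> c" "part lam j \<le> part lam p"
        using part_antimono assms by (auto simp: c_def)
      then show ?thesis using d p by (auto simp: c_def)
    qed (use p in simp)
    then have "j < count_ge nu d \<longleftrightarrow> j < count_ge lam d" for j
      using part_ge_iff[OF assms(1)] part_ge_iff[OF assms(2)] c d by auto
    then show ?thesis by (metis linorder_neqE_nat less_irrefl)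
  qed
  moreover have "p < count_ge nu c" "\<not> p < count_ge lam c"
    using part_ge_iff[OF assms(1) c] part_ge_iff[OF assms(2) c] p by (auto simp: c_def simp flip: not_le)
  ultimately show "\<exists>c\<ge>1. (\<forall>d>c. count_ge nu d = count_ge lam d) \<and> count_ge lam c < count_ge nu c"
    using c by (intro exI[of _ c]) auto
next
  assume "\<exists>c\<ge>1. (\<forall>d>c. count_ge nu d = count_ge lam d) \<and> count_ge lam c < count_ge nu c"
  then obtain c where c: "c \<ge> 1" "\<forall>d>c. count_ge nu d = count_ge lam d" "count_ge lam c < count_ge nu c"
    by blast
  \<comment> \<open>Counting from 0, this is the first position at which \<open>lam\<close> is below
    \<open>c\<close>; \<open>nu\<close> is still at least \<open>c\<close> there.\<close>
  define p where "p = count_ge lam c"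
  have "part nu j = part lam j" if "j < p" for j
  proof -
    have "d \<le> part nu j \<longleftrightarrow> d \<le> part lam j" if "d > c" for d
      using part_ge_iff[OF assms(1), of d j] part_ge_iff[OF assms(2), of d j] c that by auto
    moreover have "c \<le> part nu j" "c \<le> part lam j"
      using part_ge_iff[OF assms(1), of c j] part_ge_iff[OF assms(2), of c j] c \<open>j < p\<close> by (auto simp: p_def)
    ultimately show ?thesis by (metis le_antisym le_neq_implies_less le_refl)
  qed
  moreover have "part lam p < part nu p"
    using part_ge_iff[OF assms(1) c(1), of p] part_ge_iff[OF assms(2) c(1), of p] c by (simp add: p_def)
  ultimately show "nu \<succ>\<^sub>l lam" by (auto simp: lex_greater_def)
qed

text \<open>\<open>F3\<close> states its conditions for the leading variables; this permutation
  transports them to arbitrary positions. It matches two colourings by first block, second block and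
  rest.\<close>

lemma permutes_onto_initial:
  assumes "A1 \<subseteq> {1..n}" "A2 \<subseteq> {1..n}" "A1 \<inter> A2 = {}"
  shows "\<exists>\<sigma>. \<sigma> permutes {1..n} \<and> (\<forall>i\<in>{1..card A1}. \<sigma> i \<in> A1) \<and>
    (\<forall>i\<in>{card A1 + 1..card A1 + card A2}. \<sigma> i \<in> A2)"
proof -
  have fin: "finite A1" "finite A2" using assms finite_subset[of _ "{1..n}"] by auto
  define a b where "a = card A1" and "b = card A1 + card A2"
  have ab: "a \<le> b" "b \<le> n"
    using card_mono[of "{1..n}" "A1 \<union> A2"] card_Un_disjoint[OF fin assms(3)] assms
    by (auto simp: a_def b_def)
  define f g :: "nat \<Rightarrow> nat" where
    "f i = (if i \<le> a then 0 else if i \<le> b then 1 else 2)" and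
    "g i = (if i \<in> A1 then 0 else if i \<in> A2 then 1 else 2)" for i
  have "card {i \<in> {1..n}. f i = c} = card {i \<in> {1..n}. g i = c}" for c
  proof -
    consider "c = 0" | "c = 1" | "c = 2" | "c > 2" by linarith
    then show ?thesis
    proof cases
      case 1
      have "{i \<in> {1..n}. f i = c} = {1..a}" "{i \<in> {1..n}. g i = c} = A1"
        using 1 ab assms by (auto simp: f_def g_def split: if_splits)
      then show ?thesis by (simp add: a_def)
    next
      case 2
      have "{i \<in> {1..n}. f i = c} = {a+1..b}" "{i \<in> {1..n}. g i = c} = A2"
        using 2 ab assms by (auto simp: f_def g_def split: if_splits)
      then show ?thesis by (simp add: a_def b_def)
    next
      case 3
      have "{i \<in> {1..n}. f i = c} = {b+1..n}" "{i \<in> {1..n}. g i = c} = {1..n} - (A1 \<union> A2)"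
        using 3 ab assms by (auto simp: f_def g_def split: if_splits)
      moreover have "card ({1..n} - (A1 \<union> A2)) = n - b"
        using assms fin by (subst card_Diff_subset) (auto simp: b_def card_Un_disjoint)
      ultimately show ?thesis by simp
    next
      case 4
      then have "{i \<in> {1..n}. f i = c} = {}" "{i \<in> {1..n}. g i = c} = {}"
        by (auto simp: f_def g_def)
      then show ?thesis by (simp only:)
    qed
  qed
  then obtain \<sigma> where \<sigma>: "\<sigma> permutes {1..n}" "\<forall>i\<in>{1..n}. g (\<sigma> i) = f i"
    using permutes_of_equal_fibres[of "{1..n}" f g] by auto
  have "\<sigma> i \<in> A1" if "i \<in> {1..a}" for i
    using \<sigma>(2) that ab by (auto simp: f_def g_def split: if_splits dest!: bspec[of _ _ i])
  moreover have "\<sigma> i \<in> A2" if "i \<in> {a + 1..b}" for i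
    using \<sigma>(2) that ab by (auto simp: f_def g_def split: if_splits dest!: bspec[of _ _ i])
  ultimately show ?thesis using \<sigma>(1) by (auto simp: a_def b_def)
qed

section \<open>Vanishing at arbitrary positions, and its effect on derivatives\<close>

lemma F3_sym: "f \<in> F3 k n \<Longrightarrow> f \<in> sym_polys {1..n}"
  by (simp add: F3_def)

lemma F3_vanish_pm:
  assumes f: "f \<in> F3 k n" and A: "A \<subseteq> {1..n}" "card A = k + 1"
    and x: "\<And>i. i \<in> A \<Longrightarrow> x i = w \<or> x i = - w"
  shows "poly_at f x = 0"
proof -
  define A1 A2 where "A1 = {i \<in> A. x i = w}" and "A2 = A - A1"
  have fin: "finite A" using A finite_subset[of _ "{1..n}"] by auto
  have c: "card A1 + card A2 = k + 1"
    using card_Un_disjoint[of A1 A2] fin A(2) by (simp add: A2_def A1_def Un_absorb1)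
  have n: "k + 1 \<le> n" using card_mono[OF _ A(1)] A(2) by simp
  obtain \<sigma> where \<sigma>: "\<sigma> permutes {1..n}" "\<forall>i\<in>{1..card A1}. \<sigma> i \<in> A1"
    "\<forall>i\<in>{card A1 + 1..k + 1}. \<sigma> i \<in> A2"
    using permutes_onto_initial[of A1 n A2] A c by (auto simp: A1_def A2_def)
  have "poly_at f (\<lambda>i. x (\<sigma> i)) = 0"
  proof -
    have "\<forall>i\<in>{1..card A1}. x (\<sigma> i) = w" using \<sigma>(2) by (auto simp: A1_def)
    moreover have "\<forall>i\<in>{card A1 + 1..k + 1}. x (\<sigma> i) = - w" using \<sigma>(3) x by (auto simp: A1_def A2_def)
    moreover have "card A1 \<le> k + 1" using c by simp
    moreover have "\<forall>a\<le>k + 1. \<forall>z w. (\<forall>i\<in>{1..a}. z i = w) \<and> (\<forall>i\<in>{a + 1..k + 1}. z i = - w)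
        \<longrightarrow> poly_at f z = 0"
      using f n by (simp add: F3_def)
    ultimately show ?thesis by metis
  qed
  then show ?thesis using sym_poly_at_permute[OF F3_sym[OF f] \<sigma>(1), of "\<lambda>i. x (\<sigma> i)" x] by simp
qed

lemma F3_vanish_zero:
  assumes f: "f \<in> F3 k n" and A: "A \<subseteq> {1..n}" "card A = b0 k + 1"
    and x: "\<And>i. i \<in> A \<Longrightarrow> x i = 0"
  shows "poly_at f x = 0"
proof -
  have n: "b0 k + 1 \<le> n" using card_mono[OF _ A(1)] A(2) by simp
  obtain \<sigma> where \<sigma>: "\<sigma> permutes {1..n}" "\<forall>i\<in>{1..b0 k + 1}. \<sigma> i \<in> A"
    using permutes_onto_initial[of A n "{}"] A by auto
  have "poly_at f (\<lambda>i. x (\<sigma> i)) = 0"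
    using f n \<sigma>(2) x unfolding F3_def by auto
  then show ?thesis using sym_poly_at_permute[OF F3_sym[OF f] \<sigma>(1), of "\<lambda>i. x (\<sigma> i)" x] by simp
qed

text \<open>Where the coordinates in \<open>A\<close> agree, swapping two of them shows that their
  partial derivatives are equal. The sum of these is the derivative along the diagonal of
  \<open>A\<close>, hence zero, and \<open>card A\<close> is invertible.\<close>

lemma sym_derivative_vanish:
  assumes f: "f \<in> sym_polys V" and V: "finite V" "A \<subseteq> V" and i: "i \<in> A"
    and x: "\<And>j. j \<in> A \<Longrightarrow> x j = y"
    and zero: "\<And>t. poly_at f (\<lambda>j. if j \<in> A then y + t else x j) = 0"
  shows "((\<lambda>t. poly_at f (x(i := x i + t))) has_field_derivative 0) (at 0)"
proof -
  obtain d where d: "\<And>h. \<forall>v. v \<notin> V \<longrightarrow> h v = 0 \<Longrightarrow>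
      ((\<lambda>t. poly_at f (\<lambda>v. x v + t * h v)) has_field_derivative (\<Sum>v\<in>V. h v * d v)) (at 0)"
    using poly_at_directional_derivative[OF V(1), of f x] by blast
  have fin: "finite A" using V finite_subset[of _ V] by auto
  have one: "((\<lambda>t. poly_at f (x(j := x j + t))) has_field_derivative d j) (at 0)" if "j \<in> V" for j
  proof -
    have "(\<lambda>v. x v + t * (if v = j then 1 else 0)) = x(j := x j + t)" for t by auto
    moreover have "(\<Sum>v\<in>V. (if v = j then 1 else 0) * d v) = d j"
      using that V(1) by (simp add: if_distrib[of "\<lambda>c. c * _"] cong: if_cong)
    ultimately show ?thesis using d[of "\<lambda>v. if v = j then 1 else 0"] that by auto
  qed
  have eq: "d j = d i" if j: "j \<in> A" for j
  proof -
    have "poly_at f (x(j := x j + t)) = poly_at f (x(i := x i + t))" for t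
      using f j i V x
      by (intro sym_poly_at_permute[OF f permutes_swap_id[of i V j]]) (auto simp: transpose_def)
    then have "((\<lambda>t. poly_at f (x(i := x i + t))) has_field_derivative d j) (at 0)"
      using one[of j] j V by auto
    then show ?thesis using one[of i] i V by (auto intro: DERIV_unique)
  qed
  have "(\<lambda>v. x v + t * (if v \<in> A then 1 else 0)) = (\<lambda>j. if j \<in> A then y + t else x j)" for t
    using x by auto
  then have "((\<lambda>t. 0) has_field_derivative (\<Sum>v\<in>V. (if v \<in> A then 1 else 0) * d v)) (at 0)"
    using d[of "\<lambda>v. if v \<in> A then 1 else 0"] V(2) zero by (simp add: subset_iff)
  then have "(\<Sum>v\<in>V. (if v \<in> A then 1 else 0) * d v) = 0"
    by (auto intro: DERIV_unique)
  also have "(\<Sum>v\<in>V. (if v \<in> A then 1 else 0) * d v) = (\<Sum>v\<in>A. d v)"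
    using V by (intro sum.mono_neutral_cong_right) auto
  also have "\<dots> = of_nat (card A) * d i" using eq by simp
  finally have "d i = 0" using fin i by auto
  then show ?thesis using one[of i] i V by auto
qed

section \<open>Invariants of the target algebra\<close>

text \<open>The target algebra as invariants of the size-preserving permutations of the labels. In
  this form it is evident that a quotient of two invariants is invariant, which is not visible on
  sums of pure tensors.\<close>

definition inv_polys :: "nat list \<Rightarrow> (nat \<times> nat) cpoly set" where
  "inv_polys lam = {p. vars p \<subseteq> labels lam \<and>
     (\<forall>\<pi> z. \<pi> permutes labels lam \<and> (\<forall>u\<in>labels lam. fst (\<pi> u) = fst u) \<longrightarrow>
       poly_at p (\<lambda>u. z (\<pi> u)) = poly_at p z)}"

definition power_sum :: "nat list \<Rightarrow> nat \<Rightarrow> nat \<Rightarrow> (nat \<times> nat) cpoly" where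
  "power_sum lam a r = (\<Sum>u | u \<in> labels lam \<and> fst u = a. Var u ^ r)"

text \<open>\<open>PiE\<close> pins the value outside \<open>D\<close>, so that every injection is
  counted once.\<close>

definition injections :: "nat list \<Rightarrow> (nat \<times> nat) set \<Rightarrow> (nat \<times> nat \<Rightarrow> nat \<times> nat) set" where
  "injections lam D = {\<pi> \<in> PiE D (\<lambda>u. {x \<in> labels lam. fst x = fst u}). inj_on \<pi> D}"

text \<open>An augmented monomial symmetric function, with one alphabet for each group size; for
  \<open>D = labels lam\<close> it is the symmetrization of a monomial.\<close>

definition injection_sum :: "nat list \<Rightarrow> (nat \<times> nat) set \<Rightarrow> (nat \<times> nat \<Rightarrow> nat) \<Rightarrow> (nat \<times> nat) cpoly" where
  "injection_sum lam D e = (\<Sum>\<pi>\<in>injections lam D. \<Prod>u\<in>D. Var (\<pi> u) ^ e u)"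

lemma finite_injections: "finite D \<Longrightarrow> finite (injections lam D)"
  unfolding injections_def
  by (rule finite_subset[OF _ finite_PiE[of D "\<lambda>u. {x \<in> labels lam. fst x = fst u}"]]) auto

text \<open>Multiplying by a power sum either adds a new index or raises the exponent of an old one.\<close>

lemma power_sum_mult_injection_sum:
  assumes D: "finite D" and v: "v \<notin> D"
  shows "power_sum lam (fst v) (e v) * injection_sum lam D e =
    injection_sum lam (insert v D) e +
    (\<Sum>u | u \<in> D \<and> fst u = fst v. injection_sum lam D (e(u := e u + e v)))"
proof -
  let ?W = "{x \<in> labels lam. fst x = fst v}"
  define F :: "(nat \<times> nat \<Rightarrow> nat \<times> nat) \<Rightarrow> nat \<times> nat \<Rightarrow> (nat \<times> nat) cpoly" where
    "F \<pi> x = Var x ^ e v * (\<Prod>u\<in>D. Var (\<pi> u) ^ e u)" for \<pi> x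
  have fin: "finite (injections lam D)" using D by (rule finite_injections)
  have "power_sum lam (fst v) (e v) * injection_sum lam D e = (\<Sum>\<pi>\<in>injections lam D. \<Sum>x\<in>?W. F \<pi> x)"
    unfolding power_sum_def injection_sum_def F_def
    by (subst sum_product, subst sum.swap) simp
  also have "\<dots> = (\<Sum>\<pi>\<in>injections lam D. (\<Sum>x\<in>?W - \<pi> ` D. F \<pi> x) + (\<Sum>x\<in>?W \<inter> \<pi> ` D. F \<pi> x))"
    by (intro sum.cong refl, subst sum.Int_Diff[of _ _ "_ ` D"]) (auto simp: add.commute)
  also have "\<dots> = (\<Sum>\<pi>\<in>injections lam D. \<Sum>x\<in>?W - \<pi> ` D. F \<pi> x) +
      (\<Sum>\<pi>\<in>injections lam D. \<Sum>x\<in>?W \<inter> \<pi> ` D. F \<pi> x)"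
    by (rule sum.distrib)
  also have "(\<Sum>\<pi>\<in>injections lam D. \<Sum>x\<in>?W - \<pi> ` D. F \<pi> x) = injection_sum lam (insert v D) e"
  proof -
    have "(\<Sum>\<pi>\<in>injections lam D. \<Sum>x\<in>?W - \<pi> ` D. F \<pi> x) =
        (\<Sum>(\<pi>, x)\<in>(SIGMA \<pi>:injections lam D. ?W - \<pi> ` D). F \<pi> x)"
      using fin by (intro sum.Sigma) auto
    also have "\<dots> = (\<Sum>\<rho>\<in>injections lam (insert v D). \<Prod>u\<in>insert v D. Var (\<rho> u) ^ e u)"
    proof (rule sum.reindex_bij_witness[where i = "\<lambda>\<rho>. (restrict \<rho> D, \<rho> v)" and j = "\<lambda>(\<pi>, x). \<pi>(v := x)"])
      fix a assume a: "a \<in> (SIGMA \<pi>:injections lam D. ?W - \<pi> ` D)"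
      obtain \<pi> x where [simp]: "a = (\<pi>, x)" by (cases a)
      have \<pi>: "\<pi> \<in> PiE D (\<lambda>u. {x \<in> labels lam. fst x = fst u})" "inj_on \<pi> D"
        and x: "x \<in> ?W" "x \<notin> \<pi> ` D" using a by (auto simp: injections_def)
      show "(\<lambda>\<rho>. (restrict \<rho> D, \<rho> v)) (case a of (\<pi>, x) \<Rightarrow> \<pi>(v := x)) = a"
      proof -
        have "restrict (\<pi>(v := x)) D = \<pi>"
        proof
          fix u show "restrict (\<pi>(v := x)) D u = \<pi> u"
            using PiE_arb[OF \<pi>(1), of u] v by (cases "u \<in> D") auto
        qed
        then show ?thesis by simp
      qed
      have "inj_on (\<pi>(v := x)) (insert v D)"
        using \<pi>(2) x(2) v by (auto simp: inj_on_def)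
      moreover have "\<pi>(v := x) \<in> PiE (insert v D) (\<lambda>u. {x \<in> labels lam. fst x = fst u})"
        using x(1) PiE_mem[OF \<pi>(1)] PiE_arb[OF \<pi>(1)] by (intro PiE_I) auto
      ultimately show "(case a of (\<pi>, x) \<Rightarrow> \<pi>(v := x)) \<in> injections lam (insert v D)"
        by (simp add: injections_def)
      have "(\<Prod>u\<in>D. (Var ((\<pi>(v := x)) u) :: (nat \<times> nat) cpoly) ^ e u) = (\<Prod>u\<in>D. Var (\<pi> u) ^ e u)"
        using v by (intro prod.cong) auto
      then show "(\<Prod>u\<in>insert v D. Var ((case a of (\<pi>, x) \<Rightarrow> \<pi>(v := x)) u) ^ e u) = (case a of (\<pi>, x) \<Rightarrow> F \<pi> x)"
        using D v by (simp add: F_def)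
    next
      fix \<rho> assume \<rho>: "\<rho> \<in> injections lam (insert v D)"
      show "(case (restrict \<rho> D, \<rho> v) of (\<pi>, x) \<Rightarrow> \<pi>(v := x)) = \<rho>"
      proof -
        have "(restrict \<rho> D)(v := \<rho> v) = \<rho>"
        proof
          fix u show "((restrict \<rho> D)(v := \<rho> v)) u = \<rho> u"
            using \<rho> PiE_arb[of \<rho> "insert v D" _ u]
            by (cases "u \<in> insert v D") (auto simp: injections_def)
        qed
        then show ?thesis by simp
      qed
      show "(restrict \<rho> D, \<rho> v) \<in> (SIGMA \<pi>:injections lam D. ?W - \<pi> ` D)"
      proof -
        have "inj_on \<rho> (insert v D)" and \<rho>_in: "\<And>u. u \<in> insert v D \<Longrightarrow> \<rho> u \<in> labels lam \<and> fst (\<rho> u) = fst u"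
          using \<rho> by (auto simp: injections_def)
        then have "inj_on \<rho> D" "\<rho> v \<notin> \<rho> ` D"
          using v by (simp_all add: inj_on_insert)
        then have "restrict \<rho> D \<in> injections lam D"
          using \<rho>_in by (simp add: injections_def inj_on_def)
        then show ?thesis using \<rho>_in[of v] \<open>\<rho> v \<notin> \<rho> ` D\<close> by auto
      qed
    qed
    finally show ?thesis by (simp add: injection_sum_def)
  qed
  also have "(\<Sum>\<pi>\<in>injections lam D. \<Sum>x\<in>?W \<inter> \<pi> ` D. F \<pi> x) =
      (\<Sum>\<pi>\<in>injections lam D. \<Sum>u | u \<in> D \<and> fst u = fst v. \<Prod>w\<in>D. Var (\<pi> w) ^ (e(u := e u + e v)) w)"
  proof (rule sum.cong[OF refl])
    fix \<pi> assume \<pi>: "\<pi> \<in> injections lam D"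
    have "?W \<inter> \<pi> ` D = \<pi> ` {u. u \<in> D \<and> fst u = fst v}"
      using \<pi> by (auto simp: injections_def PiE_def Pi_def)
    moreover have "inj_on \<pi> {u. u \<in> D \<and> fst u = fst v}"
      using \<pi> by (auto simp: injections_def inj_on_def)
    ultimately have "(\<Sum>x\<in>?W \<inter> \<pi> ` D. F \<pi> x) = (\<Sum>u | u \<in> D \<and> fst u = fst v. F \<pi> (\<pi> u))"
      by (simp add: sum.reindex)
    also have "\<dots> = (\<Sum>u | u \<in> D \<and> fst u = fst v. \<Prod>w\<in>D. Var (\<pi> w) ^ (e(u := e u + e v)) w)"
    proof (intro sum.cong refl)
      fix u assume "u \<in> {u. u \<in> D \<and> fst u = fst v}"
      then have u: "u \<in> D" by simp
      have "(\<Prod>w\<in>D - {u}. (Var (\<pi> w) :: (nat \<times> nat) cpoly) ^ (e(u := e u + e v)) w) = (\<Prod>w\<in>D - {u}. Var (\<pi> w) ^ e w)"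
        by (intro prod.cong) auto
      then show "F \<pi> (\<pi> u) = (\<Prod>w\<in>D. Var (\<pi> w) ^ (e(u := e u + e v)) w)"
        unfolding F_def prod.remove[OF D u] by (simp add: power_add mult_ac)
    qed
    finally show "(\<Sum>x\<in>?W \<inter> \<pi> ` D. F \<pi> x) =
      (\<Sum>u | u \<in> D \<and> fst u = fst v. \<Prod>w\<in>D. Var (\<pi> w) ^ (e(u := e u + e v)) w)" .
  qed
  also have "\<dots> = (\<Sum>u | u \<in> D \<and> fst u = fst v. injection_sum lam D (e(u := e u + e v)))"
    unfolding injection_sum_def by (rule sum.swap)
  finally show ?thesis .
qed

text \<open>Averaging writes an invariant as a combination of injection sums, and the recursion for
  these strips off one index at a time until only power sums remain. \<open>B\<close> is arbitrary
  because two instances are needed: the target algebra, and an image under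
  \<open>phi\<close>.\<close>

lemma inv_polys_generated:
  assumes Const: "\<And>c. Const c \<in> B"
    and add: "\<And>p q. p \<in> B \<Longrightarrow> q \<in> B \<Longrightarrow> p + q \<in> B"
    and mult: "\<And>p q. p \<in> B \<Longrightarrow> q \<in> B \<Longrightarrow> p * q \<in> B"
    and power_sum: "\<And>a r. a \<in> fst ` labels lam \<Longrightarrow> power_sum lam a r \<in> B"
  shows "inv_polys lam \<subseteq> B"
proof
  have zero: "0 \<in> B" and one: "1 \<in> B"
    using Const[of 0] Const[of 1] by (simp_all add: Const_def)
  have sum: "sum f I \<in> B" if "\<And>i. i \<in> I \<Longrightarrow> f i \<in> B" for f and I :: "'i set"
    using that by (induction I rule: infinite_finite_induct) (simp_all add: zero add)
  have minus: "p - q \<in> B" if "p \<in> B" "q \<in> B" for p q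
  proof -
    have "p + Const (- 1) * q \<in> B" using that by (intro add mult Const)
    moreover have "p + Const (- 1) * q = p - q" by (rule poly_eqI) (simp add: poly_at_simps)
    ultimately show ?thesis by simp
  qed
  have M: "injection_sum lam D e \<in> B" if "finite D" "D \<subseteq> labels lam" for D e
    using that
  proof (induction D arbitrary: e rule: finite_induct)
    case empty
    then show ?case by (simp add: injection_sum_def injections_def one)
  next
    case (insert v D)
    let ?rest = "\<Sum>u | u \<in> D \<and> fst u = fst v. injection_sum lam D (e(u := e u + e v))"
    have "injection_sum lam (insert v D) e =
        power_sum lam (fst v) (e v) * injection_sum lam D e - ?rest"
      by (simp add: power_sum_mult_injection_sum[OF insert.hyps])
    moreover have "power_sum lam (fst v) (e v) * injection_sum lam D e - ?rest \<in> B"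
      using insert by (intro minus mult power_sum sum) auto
    ultimately show ?case by simp
  qed
  fix p assume p: "p \<in> inv_polys lam"
  let ?I = "injections lam (labels lam)"
  have fin: "finite ?I" by (simp add: finite_injections)
  have "restrict (\<lambda>u. u) (labels lam) \<in> ?I" by (auto simp: injections_def inj_on_def)
  then have card: "card ?I \<noteq> 0" using fin by auto
  have keys: "Poly_Mapping.keys m \<subseteq> labels lam" if "m \<in> Poly_Mapping.keys p" for m
    using p that by (auto simp: inv_polys_def vars_def)
  have "p = subst (\<lambda>u. Var (\<pi> u)) p" if \<pi>: "\<pi> \<in> ?I" for \<pi>
  proof (rule poly_eqI)
    fix z
    \<comment> \<open>An injection of the finite label set into itself, extended by the identity, is
      a permutation.\<close>
    define \<pi>' where "\<pi>' u = (if u \<in> labels lam then \<pi> u else u)" for u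
    have inj: "inj_on \<pi> (labels lam)" and im: "\<pi> ` labels lam \<subseteq> labels lam"
      and fst: "\<forall>u\<in>labels lam. fst (\<pi> u) = fst u"
      using \<pi> by (auto simp: injections_def PiE_def Pi_def)
    have "bij_betw \<pi>' (labels lam) (labels lam)"
      using endo_inj_surj[OF _ im inj] inj
      by (simp add: bij_betw_def \<pi>'_def inj_on_def cong: image_cong_simp)
    then have "\<pi>' permutes labels lam" by (rule bij_imp_permutes) (simp add: \<pi>'_def)
    moreover have "\<forall>u\<in>labels lam. fst (\<pi>' u) = fst u" using fst by (simp add: \<pi>'_def)
    ultimately have "poly_at p (\<lambda>u. z (\<pi>' u)) = poly_at p z"
      using p by (simp add: inv_polys_def)
    then have "poly_at p z = poly_at p (\<lambda>u. z (\<pi>' u))" by simp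
    also have "\<dots> = poly_at p (\<lambda>u. z (\<pi> u))"
      using p by (intro poly_at_cong) (auto simp: inv_polys_def \<pi>'_def)
    finally show "poly_at p z = poly_at (subst (\<lambda>u. Var (\<pi> u)) p) z" by (simp add: poly_at_simps)
  qed
  then have "(\<Sum>\<pi>\<in>?I. p) = (\<Sum>\<pi>\<in>?I. subst (\<lambda>u. Var (\<pi> u)) p)" by (intro sum.cong) auto
  also have "\<dots> = (\<Sum>\<pi>\<in>?I. \<Sum>m\<in>Poly_Mapping.keys p. Const (Poly_Mapping.lookup p m) *
      (\<Prod>u\<in>labels lam. Var (\<pi> u) ^ Poly_Mapping.lookup m u))"
    unfolding subst_def using keys
    by (intro sum.cong arg_cong2[of _ _ _ _ "(*)"] refl prod.mono_neutral_left) (auto simp: in_keys_iff)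
  also have "\<dots> = (\<Sum>m\<in>Poly_Mapping.keys p. Const (Poly_Mapping.lookup p m) *
      injection_sum lam (labels lam) (Poly_Mapping.lookup m))"
    unfolding injection_sum_def sum_distrib_left by (rule sum.swap)
  also have "\<dots> \<in> B" by (intro sum mult Const M) auto
  finally have "Const (1 / of_nat (card ?I)) * (\<Sum>\<pi>\<in>?I. p) \<in> B" by (intro mult Const)
  moreover have "Const (1 / of_nat (card ?I)) * (\<Sum>\<pi>\<in>?I. p) = p"
    using card by (intro poly_eqI) (simp only: poly_at_simps, simp)
  ultimately show "p \<in> B" by (simp only:)
qed

section \<open>The tensor product as a ring of invariants\<close>

lemma Const_in_sym_polys: "Const c \<in> sym_polys V"
  by (simp add: sym_polys_iff vars_subset_iff poly_at_simps)

lemma one_in_sym_polys: "1 \<in> sym_polys V"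
  by (simp add: sym_polys_iff vars_subset_iff poly_at_simps)

lemma mult_in_sym_polys: "p \<in> sym_polys V \<Longrightarrow> q \<in> sym_polys V \<Longrightarrow> p * q \<in> sym_polys V"
  unfolding sym_polys_iff vars_subset_iff poly_at_mult by metis

lemma power_sum_in_sym_polys: "finite V \<Longrightarrow> (\<Sum>v\<in>V. Var v ^ r) \<in> sym_polys V"
  unfolding sym_polys_iff vars_subset_iff
proof (intro conjI allI impI)
  fix \<sigma> and z :: "'a \<Rightarrow> complex" assume "\<sigma> permutes V"
  then show "poly_at (\<Sum>v\<in>V. Var v ^ r) (\<lambda>v. z (\<sigma> v)) = poly_at (\<Sum>v\<in>V. Var v ^ r) z"
    using sum.permute[of \<sigma> V "\<lambda>v. z v ^ r"] by (simp add: poly_at_simps o_def)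
qed (simp add: poly_at_simps)

lemma S_alg_add:
  assumes "p \<in> S_alg k lam" "q \<in> S_alg k lam"
  shows "p + q \<in> S_alg k lam"
proof -
  obtain N :: nat and f where f: "\<forall>t<N. \<forall>a\<in>{1..k}. f t a \<in> sym_polys ({a} \<times> {1..part_mult lam a})"
    "p = (\<Sum>t<N. \<Prod>a=1..k. f t a)" using assms(1) unfolding S_alg_def by blast
  obtain M :: nat and g where g: "\<forall>t<M. \<forall>a\<in>{1..k}. g t a \<in> sym_polys ({a} \<times> {1..part_mult lam a})"
    "q = (\<Sum>t<M. \<Prod>a=1..k. g t a)" using assms(2) unfolding S_alg_def by blast
  define h where "h t = (if t < N then f t else g (t - N))" for t
  have "(\<Sum>t<N + M'. \<Prod>a=1..k. h t a) = p + (\<Sum>t<M'. \<Prod>a=1..k. g t a)" for M'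
    by (induction M') (simp_all add: h_def f(2) add_ac)
  then have "p + q = (\<Sum>t<N + M. \<Prod>a=1..k. h t a)" by (simp add: g(2))
  moreover have "\<forall>t<N + M. \<forall>a\<in>{1..k}. h t a \<in> sym_polys ({a} \<times> {1..part_mult lam a})"
    using f(1) g(1) by (auto simp: h_def)
  ultimately show ?thesis unfolding S_alg_def by blast
qed

lemma S_alg_tensor:
  assumes "\<And>a. a \<in> {1..k} \<Longrightarrow> g a \<in> sym_polys ({a} \<times> {1..part_mult lam a})"
  shows "(\<Prod>a=1..k. g a) \<in> S_alg k lam"
  unfolding S_alg_def using assms by (auto intro!: exI[of _ "1::nat"] exI[of _ "\<lambda>_. g"])

lemma S_alg_zero: "0 \<in> S_alg k lam"
  unfolding S_alg_def by (auto intro!: exI[of _ "0::nat"])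

lemma S_alg_mult:
  assumes "p \<in> S_alg k lam" "q \<in> S_alg k lam"
  shows "p * q \<in> S_alg k lam"
proof -
  obtain N :: nat and f where f: "\<forall>t<N. \<forall>a\<in>{1..k}. f t a \<in> sym_polys ({a} \<times> {1..part_mult lam a})"
    "p = (\<Sum>t<N. \<Prod>a=1..k. f t a)" using assms(1) unfolding S_alg_def by blast
  obtain M :: nat and g where g: "\<forall>t<M. \<forall>a\<in>{1..k}. g t a \<in> sym_polys ({a} \<times> {1..part_mult lam a})"
    "q = (\<Sum>t<M. \<Prod>a=1..k. g t a)" using assms(2) unfolding S_alg_def by blast
  have sum: "(\<And>i. i \<in> I \<Longrightarrow> h i \<in> S_alg k lam) \<Longrightarrow> sum h I \<in> S_alg k lam" for h and I :: "nat set"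
    by (induction I rule: infinite_finite_induct) (simp_all add: S_alg_zero S_alg_add)
  have "(\<Sum>t<N. \<Sum>s<M. \<Prod>a=1..k. f t a * g s a) \<in> S_alg k lam"
    using f(1) g(1) by (intro sum S_alg_tensor mult_in_sym_polys) auto
  then show ?thesis by (simp add: f(2) g(2) sum_product prod.distrib)
qed

lemma S_alg_subset_inv_polys:
  assumes "restricted_partition k n lam"
  shows "S_alg k lam \<subseteq> inv_polys lam"
proof
  fix p assume "p \<in> S_alg k lam"
  then obtain N :: nat and f where f: "\<forall>t<N. \<forall>a\<in>{1..k}. f t a \<in> sym_polys ({a} \<times> {1..part_mult lam a})"
    "p = (\<Sum>t<N. \<Prod>a=1..k. f t a)" unfolding S_alg_def by blast
  have sub: "{a} \<times> {1..part_mult lam a} \<subseteq> labels lam" for a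
    by (auto simp: labels_def)
  have "vars p \<subseteq> labels lam"
    unfolding vars_subset_iff
  proof (intro allI impI)
    fix z z' :: "nat \<times> nat \<Rightarrow> complex" assume "\<forall>v\<in>labels lam. z v = z' v"
    moreover have "vars (f t a) \<subseteq> labels lam" if "t < N" "a \<in> {1..k}" for t a
    proof -
      have "f t a \<in> sym_polys ({a} \<times> {1..part_mult lam a})" using f(1) that by blast
      then show ?thesis using sub[of a] unfolding sym_polys_def by blast
    qed
    ultimately have "poly_at (f t a) z = poly_at (f t a) z'" if "t < N" "a \<in> {1..k}" for t a
      using that by (intro poly_at_cong) blast
    then show "poly_at p z = poly_at p z'" by (simp add: f(2) poly_at_simps)
  qed
  moreover have "poly_at p (\<lambda>u. z (\<pi> u)) = poly_at p z"
    if \<pi>: "\<pi> permutes labels lam" "\<forall>u\<in>labels lam. fst (\<pi> u) = fst u" for \<pi> z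
  proof -
    have "poly_at (f t a) (\<lambda>u. z (\<pi> u)) = poly_at (f t a) z" if t: "t < N" "a \<in> {1..k}" for t a
    proof -
      let ?V = "{a} \<times> {1..part_mult lam a}"
      define \<sigma> where "\<sigma> u = (if u \<in> ?V then \<pi> u else u)" for u
      have sym: "f t a \<in> sym_polys ?V" using f(1) t by blast
      have im: "\<pi> ` ?V \<subseteq> ?V"
      proof
        fix w assume "w \<in> \<pi> ` ?V"
        then obtain u where u: "u \<in> ?V" "w = \<pi> u" by blast
        then have "u \<in> labels lam" using sub by blast
        then have "w \<in> labels lam" "fst w = a" using \<pi> u by (auto simp: permutes_in_image)
        then show "w \<in> ?V" by (cases w) (simp add: labels_def)
      qed
      have inj: "inj_on \<pi> ?V" using permutes_inj_on[OF \<pi>(1)] .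
      have fin: "finite ?V" by simp
      have "bij_betw \<pi> ?V ?V"
        using endo_inj_surj[OF fin im inj] inj unfolding bij_betw_def by blast
      then have "bij_betw \<sigma> ?V ?V"
        by (rule bij_betw_cong[THEN iffD1, rotated]) (simp only: \<sigma>_def if_True)
      then have "\<sigma> permutes ?V" by (rule bij_imp_permutes) (auto simp: \<sigma>_def)
      with sym show ?thesis by (intro sym_poly_at_permute[of _ ?V \<sigma>]) (simp_all add: \<sigma>_def)
    qed
    then show ?thesis by (simp add: f(2) poly_at_simps)
  qed
  ultimately show "p \<in> inv_polys lam" by (simp add: inv_polys_def)
qed

lemma inv_polys_eq_S_alg:
  assumes k: "1 \<le> k" and lam: "restricted_partition k n lam"
  shows "inv_polys lam = S_alg k lam"
proof
  show "S_alg k lam \<subseteq> inv_polys lam" by (rule S_alg_subset_inv_polys[OF lam])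
  show "inv_polys lam \<subseteq> S_alg k lam"
  proof (rule inv_polys_generated)
    fix c
    \<comment> \<open>The scalar goes into the first tensor factor, hence \<open>1 \<le> k\<close>:
      an empty tensor product would yield only natural numbers as constants.\<close>
    have "(\<Prod>a=1..k. if a = 1 then Const c else 1) \<in> S_alg k lam"
      by (rule S_alg_tensor) (simp add: Const_in_sym_polys one_in_sym_polys)
    then show "Const c \<in> S_alg k lam" using k by simp
  next
    fix a r assume "a \<in> fst ` labels lam"
    then have a: "a \<in> {1..k}" using labels_size[OF lam] by auto
    have eq: "{u. u \<in> labels lam \<and> fst u = a} = {a} \<times> {1..part_mult lam a}"
      by (auto simp: labels_def)
    have "(\<Prod>b=1..k. if b = a then power_sum lam a r else 1) \<in> S_alg k lam"
      by (rule S_alg_tensor) (auto simp: power_sum_def eq one_in_sym_polys intro!: power_sum_in_sym_polys)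
    then show "power_sum lam a r \<in> S_alg k lam" using a by simp
  qed (simp_all add: S_alg_add S_alg_mult)
qed

section \<open>The product over pairs of groups\<close>

text \<open>The order on labels is lexicographic, so \<open>u < w\<close> entails
  \<open>fst u \<le> fst w\<close>; the smaller group comes first.\<close>

definition pairs :: "nat list \<Rightarrow> ((nat \<times> nat) \<times> (nat \<times> nat)) set" where
  "pairs lam = {(u, w). u \<in> labels lam \<and> w \<in> labels lam \<and> u < w}"

lemma finite_pairs [simp]: "finite (pairs lam)"
  by (rule finite_subset[of _ "labels lam \<times> labels lam"]) (auto simp: pairs_def)

lemma prod_labels:
  assumes "restricted_partition k n lam"
  shows "(\<Prod>u\<in>labels lam. h u) = (\<Prod>a=1..k. \<Prod>j=1..part_mult lam a. h (a, j))"
proof -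
  have "labels lam = (SIGMA a:{1..k}. {1..part_mult lam a})"
    using labels_size[OF assms] by (force simp: labels_def)
  then show ?thesis by (simp add: prod.Sigma)
qed

lemma prod_pairs:
  assumes "restricted_partition k n lam"
  shows "(\<Prod>(u, w)\<in>pairs lam. h u w) =
    (\<Prod>(a, b)\<in>{(a, b). 1 \<le> a \<and> a < b \<and> b \<le> k}.
        \<Prod>i=1..part_mult lam a. \<Prod>j=1..part_mult lam b. h (a, i) (b, j)) *
    (\<Prod>a=1..k. \<Prod>(i, j)\<in>{(i, j). 1 \<le> i \<and> i < j \<and> j \<le> part_mult lam a}. h (a, i) (a, j))"
proof -
  let ?I = "{(a, b). 1 \<le> a \<and> a < b \<and> b \<le> k}"
  let ?J = "\<lambda>m. {(i, j). 1 \<le> i \<and> i < j \<and> j \<le> (m::nat)}"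
  define P1 P2 where "P1 = {(u, w) \<in> pairs lam. fst u < fst w}" and "P2 = {(u, w) \<in> pairs lam. fst u = fst w}"
  have "pairs lam = P1 \<union> P2" by (auto simp: pairs_def P1_def P2_def)
  moreover have "finite P1" "finite P2" "P1 \<inter> P2 = {}"
    by (auto simp: P1_def P2_def intro: finite_subset[OF _ finite_pairs[of lam]])
  ultimately have "(\<Prod>(u, w)\<in>pairs lam. h u w) = (\<Prod>(u, w)\<in>P1. h u w) * (\<Prod>(u, w)\<in>P2. h u w)"
    by (simp add: prod.union_disjoint)
  moreover have "(\<Prod>(u, w)\<in>P1. h u w) = (\<Prod>(a, b)\<in>?I. \<Prod>i=1..part_mult lam a. \<Prod>j=1..part_mult lam b. h (a, i) (b, j))"
  proof -
    have "(\<Prod>(a, b)\<in>?I. \<Prod>i=1..part_mult lam a. \<Prod>j=1..part_mult lam b. h (a, i) (b, j)) =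
        (\<Prod>x\<in>?I. \<Prod>y\<in>{1..part_mult lam (fst x)} \<times> {1..part_mult lam (snd x)}. h (fst x, fst y) (snd x, snd y))"
      by (intro prod.cong refl) (auto simp: prod.cartesian_product case_prod_beta)
    also have "\<dots> = (\<Prod>(x, y)\<in>(SIGMA x:?I. {1..part_mult lam (fst x)} \<times> {1..part_mult lam (snd x)}).
        h (fst x, fst y) (snd x, snd y))"
      by (intro prod.Sigma finite_index_pairs) auto
    also have "\<dots> = (\<Prod>(u, w)\<in>P1. h u w)"
      by (rule prod.reindex_bij_witness[where j = "\<lambda>(x, y). ((fst x, fst y), (snd x, snd y))"
            and i = "\<lambda>(u, w). ((fst u, fst w), (snd u, snd w))"])
         (use labels_size[OF assms] in \<open>force simp: P1_def pairs_def labels_def\<close>)+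
    finally show ?thesis ..
  qed
  moreover have "(\<Prod>(u, w)\<in>P2. h u w) = (\<Prod>a=1..k. \<Prod>(i, j)\<in>?J (part_mult lam a). h (a, i) (a, j))"
  proof -
    have "(\<Prod>a=1..k. \<Prod>(i, j)\<in>?J (part_mult lam a). h (a, i) (a, j)) =
        (\<Prod>(a, i, j)\<in>(SIGMA a:{1..k}. ?J (part_mult lam a)). h (a, i) (a, j))"
      using finite_index_pairs by (subst prod.Sigma) (auto intro!: prod.cong)
    also have "\<dots> = (\<Prod>(u, w)\<in>P2. h u w)"
      by (rule prod.reindex_bij_witness[where j = "\<lambda>(a, i, j). ((a, i), (a, j))"
            and i = "\<lambda>(u, w). (fst u, snd u, snd w)"])
         (use labels_size[OF assms] in \<open>force simp: P2_def pairs_def labels_def\<close>)+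
    finally show ?thesis ..
  qed
  ultimately show ?thesis by simp
qed

text \<open>The cases \<open>a < b\<close> and \<open>a = b\<close> merge into one product over
  pairs of groups. The restrictions on \<open>a + b\<close> and \<open>a\<close> disappear because
  truncated subtraction makes the remaining exponents zero.\<close>

lemma G3_eq_prod:
  assumes "restricted_partition k n lam"
  shows "G3 k lam = (\<Prod>u\<in>labels lam. Var u ^ (fst u - b0 k)) *
    (\<Prod>(u, w)\<in>pairs lam. (Var u - Var w) ^ (2 * min (fst u) (fst w))) *
    (\<Prod>(u, w)\<in>pairs lam. (Var u + Var w) ^ (fst u + fst w - k))"
proof -
  have zero: "(\<Prod>i = Suc 0..part_mult lam a. \<Prod>j = Suc 0..part_mult lam b. (X a i + X b j) ^ (a + b - k)) = 1"
    if "\<not> k < a + b" for a b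
    using that by simp
  have zero': "(\<Prod>(i, j)\<in>{(i, j). Suc 0 \<le> i \<and> i < j \<and> j \<le> part_mult lam a}. (X a i + X a j) ^ (2 * a - k)) = 1"
    if "\<not> real k < real a * 2" for a
    using that by (auto intro!: prod.neutral)
  have 1: "(\<Prod>(a, b)\<in>{(a, b). 1 \<le> a \<and> a < b \<and> b \<le> k \<and> a + b > k}.
        \<Prod>i=1..part_mult lam a. \<Prod>j=1..part_mult lam b. (X a i + X b j) ^ (a + b - k)) =
      (\<Prod>(a, b)\<in>{(a, b). 1 \<le> a \<and> a < b \<and> b \<le> k}.
        \<Prod>i=1..part_mult lam a. \<Prod>j=1..part_mult lam b. (X a i + X b j) ^ (a + b - k))"
    by (rule prod.mono_neutral_left) (use finite_index_pairs in \<open>auto intro!: zero\<close>)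
  have 2: "(\<Prod>a\<in>{a. 1 \<le> a \<and> a \<le> k \<and> real a > real k / 2}.
        \<Prod>(i, j)\<in>{(i, j). 1 \<le> i \<and> i < j \<and> j \<le> part_mult lam a}. (X a i + X a j) ^ (2 * a - k)) =
      (\<Prod>a=1..k. \<Prod>(i, j)\<in>{(i, j). 1 \<le> i \<and> i < j \<and> j \<le> part_mult lam a}. (X a i + X a j) ^ (2 * a - k))"
    by (rule prod.mono_neutral_left) (auto intro!: zero')
  have 3: "(\<Prod>(a, b)\<in>{(a, b). 1 \<le> a \<and> a < b \<and> b \<le> k}.
        \<Prod>i=1..part_mult lam a. \<Prod>j=1..part_mult lam b. (X a i - X b j) ^ (2 * min a b)) =
      (\<Prod>(a, b)\<in>{(a, b). 1 \<le> a \<and> a < b \<and> b \<le> k}.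
        \<Prod>i=1..part_mult lam a. \<Prod>j=1..part_mult lam b. (X a i - X b j) ^ (2 * a))"
    by (intro prod.cong refl) auto
  show ?thesis
    unfolding G3_def G2_def G3_bar_def 1 2 prod_labels[OF assms] prod_pairs[OF assms] fst_conv 3
    by (simp only: min.idem mult_2[symmetric] mult_ac)
qed

text \<open>A choice of orientation for every unordered pair. Products of symmetric expressions do
  not depend on it, so they can be moved along bijections that are not monotone.\<close>

definition tournament :: "'a set \<Rightarrow> ('a \<Rightarrow> 'a \<Rightarrow> bool) \<Rightarrow> bool" where
  "tournament A R \<longleftrightarrow> (\<forall>i\<in>A. \<not> R i i) \<and> (\<forall>i\<in>A. \<forall>j\<in>A. i \<noteq> j \<longrightarrow> R i j = (\<not> R j i))"

lemma prod_tournament: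
  assumes "tournament A R" "tournament A R'" "\<And>i j. g i j = g j i"
  shows "(\<Prod>(i, j)\<in>{(i, j). i \<in> A \<and> j \<in> A \<and> R i j}. g i j) =
    (\<Prod>(i, j)\<in>{(i, j). i \<in> A \<and> j \<in> A \<and> R' i j}. g i j)"
  by (rule prod.reindex_bij_witness[where i = "\<lambda>(i, j). if R i j then (i, j) else (j, i)"
        and j = "\<lambda>(i, j). if R' i j then (i, j) else (j, i)"])
     (use assms(3) in \<open>auto split: if_splits\<close>, (metis assms(1,2) tournament_def)+)

lemma prod_tournament_bij:
  assumes "bij_betw \<beta> A B" "tournament A R" "tournament B R'" "\<And>i j. g i j = g j i"
  shows "(\<Prod>(i, j)\<in>{(i, j). i \<in> A \<and> j \<in> A \<and> R i j}. g (\<beta> i) (\<beta> j)) =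
    (\<Prod>(i, j)\<in>{(i, j). i \<in> B \<and> j \<in> B \<and> R' i j}. g i j)"
proof -
  let ?\<gamma> = "inv_into A \<beta>"
  have \<gamma>: "\<And>b. b \<in> B \<Longrightarrow> ?\<gamma> b \<in> A \<and> \<beta> (?\<gamma> b) = b"
    using assms(1) by (auto simp: bij_betw_def inv_into_into f_inv_into_f)
  have \<beta>: "\<And>a. a \<in> A \<Longrightarrow> \<beta> a \<in> B \<and> ?\<gamma> (\<beta> a) = a"
    using assms(1) by (auto simp: bij_betw_def inv_into_f_f)
  have "(\<Prod>(i, j)\<in>{(i, j). i \<in> A \<and> j \<in> A \<and> R i j}. g (\<beta> i) (\<beta> j)) =
      (\<Prod>(i, j)\<in>{(i, j). i \<in> B \<and> j \<in> B \<and> R (?\<gamma> i) (?\<gamma> j)}. g i j)"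
    by (rule prod.reindex_bij_witness[where i = "\<lambda>(i, j). (?\<gamma> i, ?\<gamma> j)" and j = "\<lambda>(i, j). (\<beta> i, \<beta> j)"])
       (use \<beta> \<gamma> in auto)
  also have "\<dots> = (\<Prod>(i, j)\<in>{(i, j). i \<in> B \<and> j \<in> B \<and> R' i j}. g i j)"
  proof (rule prod_tournament)
    show "tournament B (\<lambda>i j. R (?\<gamma> i) (?\<gamma> j))"
      using assms(2) \<gamma> unfolding tournament_def by metis
  qed (use assms in auto)
  finally show ?thesis .
qed

lemma tournament_less: "tournament A ((<) :: 'a::linorder \<Rightarrow> 'a \<Rightarrow> bool)"
  by (auto simp: tournament_def)

lemma poly_at_G3:
  assumes "restricted_partition k n lam"
  shows "poly_at (G3 k lam) z = (\<Prod>u\<in>labels lam. z u ^ (fst u - b0 k)) *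
    (\<Prod>(u, w)\<in>pairs lam. (z u - z w) ^ (2 * min (fst u) (fst w))) *
    (\<Prod>(u, w)\<in>pairs lam. (z u + z w) ^ (fst u + fst w - k))"
  unfolding G3_eq_prod[OF assms] by (simp add: poly_at_simps case_prod_beta)

lemma power_even_diff_commute: "((x::'a::comm_ring_1) - y) ^ (2 * e) = (y - x) ^ (2 * e)"
  by (simp add: power_mult power2_commute)

lemma G3_in_inv_polys:
  assumes "restricted_partition k n lam"
  shows "G3 k lam \<in> inv_polys lam"
  unfolding inv_polys_def
proof (intro CollectI conjI allI impI, goal_cases)
  case 1
  show ?case
    unfolding vars_subset_iff poly_at_G3[OF assms]
    by (auto simp: pairs_def intro!: arg_cong2[of _ _ _ _ "(*)"] prod.cong)
next
  case (2 \<pi> z)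
  then have bij: "bij_betw \<pi> (labels lam) (labels lam)" by (simp add: permutes_imp_bij)
  have fst: "fst (\<pi> u) = fst u" if "u \<in> labels lam" for u using 2 that by auto
  have "(\<Prod>u\<in>labels lam. z (\<pi> u) ^ (fst u - b0 k)) = (\<Prod>u\<in>labels lam. z u ^ (fst u - b0 k))"
    by (subst prod.reindex_bij_betw[OF bij, symmetric], intro prod.cong) (auto simp: fst)
  moreover have "(\<Prod>(u, w)\<in>pairs lam. (z (\<pi> u) - z (\<pi> w)) ^ (2 * min (fst u) (fst w))) =
      (\<Prod>(u, w)\<in>pairs lam. (z u - z w) ^ (2 * min (fst u) (fst w)))"
  proof -
    have "(\<Prod>(u, w)\<in>pairs lam. (z (\<pi> u) - z (\<pi> w)) ^ (2 * min (fst u) (fst w))) =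
      (\<Prod>(u, w)\<in>pairs lam. (z (\<pi> u) - z (\<pi> w)) ^ (2 * min (fst (\<pi> u)) (fst (\<pi> w))))"
      by (intro prod.cong) (auto simp: pairs_def fst)
    also have "\<dots> = (\<Prod>(u, w)\<in>pairs lam. (z u - z w) ^ (2 * min (fst u) (fst w)))"
      unfolding pairs_def
      by (intro prod_tournament_bij[OF bij, where g = "\<lambda>u w. (z u - z w) ^ (2 * min (fst u) (fst w))"] tournament_less)
         (subst power_even_diff_commute, simp add: min.commute)
    finally show ?thesis .
  qed
  moreover have "(\<Prod>(u, w)\<in>pairs lam. (z (\<pi> u) + z (\<pi> w)) ^ (fst u + fst w - k)) =
      (\<Prod>(u, w)\<in>pairs lam. (z u + z w) ^ (fst u + fst w - k))"
  proof -
    have "(\<Prod>(u, w)\<in>pairs lam. (z (\<pi> u) + z (\<pi> w)) ^ (fst u + fst w - k)) =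
      (\<Prod>(u, w)\<in>pairs lam. (z (\<pi> u) + z (\<pi> w)) ^ (fst (\<pi> u) + fst (\<pi> w) - k))"
      by (intro prod.cong) (auto simp: pairs_def fst)
    also have "\<dots> = (\<Prod>(u, w)\<in>pairs lam. (z u + z w) ^ (fst u + fst w - k))"
      unfolding pairs_def
      by (intro prod_tournament_bij[OF bij, where g = "\<lambda>u w. (z u + z w) ^ (fst u + fst w - k)"] tournament_less)
         (simp add: add.commute)
    finally show ?thesis .
  qed
  ultimately show ?case by (simp add: poly_at_G3[OF assms])
qed

section \<open>Divisibility of the image\<close>

definition fibre :: "nat list \<Rightarrow> nat \<Rightarrow> nat \<times> nat \<Rightarrow> nat set" where
  "fibre lam n u = {j \<in> {1..n}. grp lam j = u}"

lemma fibre_subset: "fibre lam n u \<subseteq> {1..n}" and finite_fibre [simp]: "finite (fibre lam n u)"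
  by (auto simp: fibre_def)

lemma card_fibre:
  assumes "restricted_partition k n lam" "u \<in> labels lam"
  shows "card (fibre lam n u) = fst u"
  using card_grp_fibre[of lam n u] assms by (simp add: fibre_def restricted_partition_def)

text \<open>The group \<open>u\<close> is opened up: its variables become \<open>Var (0, i) + e\<close>, the labels
  \<open>(0, i)\<close> being unused by the groups; the second substitution closes it again.\<close>

definition open_group :: "nat list \<Rightarrow> nat \<Rightarrow> nat \<times> nat \<Rightarrow> (nat \<times> nat) cpoly \<Rightarrow> nat cpoly \<Rightarrow> (nat \<times> nat) cpoly" where
  "open_group lam n u e f =
     subst (\<lambda>j. if j \<in> fibre lam n u then Var (0, j) + e else Var (grp lam j)) f"

definition close_group :: "nat \<times> nat \<Rightarrow> (nat \<times> nat) cpoly \<Rightarrow> nat \<times> nat \<Rightarrow> (nat \<times> nat) cpoly" where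
  "close_group u e v = (if fst v = 0 then Var u - e else Var v)"

lemma poly_at_open_group:
  "poly_at (open_group lam n u e f) z =
    poly_at f (\<lambda>j. if j \<in> fibre lam n u then z (0, j) + poly_at e z else z (grp lam j))"
  unfolding open_group_def poly_at_subst by (rule arg_cong[of _ _ "poly_at f"]) (auto simp: poly_at_simps)

lemma subst_close_open_group:
  assumes lam: "restricted_partition k n lam" and f: "vars f \<subseteq> {1..n}"
    and e: "vars e \<subseteq> labels lam"
  shows "subst (close_group u e) (open_group lam n u e f) = phi lam f"
proof -
  have "subst (close_group u e) e = subst Var e"
    using e labels_size[OF lam] by (intro subst_cong) (fastforce simp: close_group_def)
  then have e': "subst (close_group u e) e = e" by (simp add: subst_id)
  have "grp lam j \<in> labels lam" if "j \<in> vars f" for j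
    using lam f that by (intro grp_in_labels[of lam n]) (auto simp: restricted_partition_def)
  then have "fst (grp lam j) \<noteq> 0" if "j \<in> vars f" for j
    using labels_size[OF lam] that by fastforce
  then show ?thesis
    unfolding open_group_def subst_subst phi_def grp_def[symmetric]
    using f by (intro subst_cong) (fastforce simp: subst_simps e' close_group_def fibre_def)
qed

text \<open>The new variables \<open>(0, j)\<close> play the role of \<open>J\<close> in
  \<open>power_dvd_subst_of_vanishing\<close>; closing the group sends each of them to
  \<open>Var u - e\<close>.\<close>

lemma power_dvd_phi:
  assumes lam: "restricted_partition k n lam" and f: "vars f \<subseteq> {1..n}"
    and e: "vars e \<subseteq> labels lam" and u: "u \<in> labels lam"
    and van: "\<And>K z. K \<subseteq> fibre lam n u \<Longrightarrow> card K = Suc c \<Longrightarrow> \<forall>j\<in>K. z (0, j) = 0 \<Longrightarrow>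
      poly_at f (\<lambda>j. if j \<in> fibre lam n u then z (0, j) + poly_at e z else z (grp lam j)) = 0"
  shows "(Var u - e) ^ (fst u - c) dvd phi lam f"
proof -
  let ?J = "Pair (0::nat) ` fibre lam n u"
  have "card ?J = fst u" using card_fibre[OF lam u] by (simp add: card_image inj_on_def)
  moreover have "(Var u - e) ^ (card ?J - c) dvd subst (close_group u e) (open_group lam n u e f)"
  proof (rule power_dvd_subst_of_vanishing)
    fix K and z :: "nat \<times> nat \<Rightarrow> complex"
    assume K: "K \<subseteq> ?J" "card K = Suc c" "\<forall>v\<in>K. z v = 0"
    then obtain K' where K': "K = Pair 0 ` K'" "K' \<subseteq> fibre lam n u" by (auto simp: subset_image_iff)
    then have "card K' = Suc c" using K(2) by (simp add: card_image inj_on_def)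
    then show "poly_at (open_group lam n u e f) z = 0"
      using van[of K' z] K(3) K' by (simp add: poly_at_open_group)
  qed (auto simp: close_group_def)
  ultimately show ?thesis by (simp add: subst_close_open_group[OF lam f e])
qed

lemma zero_factor_dvd_phi:
  assumes lam: "restricted_partition k n lam" and f: "f \<in> F3 k n" and u: "u \<in> labels lam"
  shows "Var u ^ (fst u - b0 k) dvd phi lam f"
proof -
  have "(Var u - 0) ^ (fst u - b0 k) dvd phi lam f"
  proof (rule power_dvd_phi[OF lam _ _ u])
    fix K and z :: "nat \<times> nat \<Rightarrow> complex"
    assume K: "K \<subseteq> fibre lam n u" "card K = Suc (b0 k)" "\<forall>j\<in>K. z (0, j) = 0"
    show "poly_at f (\<lambda>j. if j \<in> fibre lam n u then z (0, j) + poly_at 0 z else z (grp lam j)) = 0"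
      using K fibre_subset[of lam n u] by (intro F3_vanish_zero[OF f, of K]) (auto simp: poly_at_0)
  qed (use F3_sym[OF f] in \<open>auto simp: sym_polys_def vars_subset_iff poly_at_0\<close>)
  then show ?thesis by simp
qed

lemma vars_Var: "vars (Var v) = {v}"
  by (simp add: vars_def Var_def)

lemma plus_factor_dvd_phi:
  assumes lam: "restricted_partition k n lam" and f: "f \<in> F3 k n"
    and u: "u \<in> labels lam" and w: "w \<in> labels lam" and uw: "u \<noteq> w"
  shows "(Var u + Var w) ^ (fst u + fst w - k) dvd phi lam f"
proof -
  have wk: "fst w \<le> k" using labels_size[OF lam w] by simp
  \<comment> \<open>Opened variables that vanish take the value opposite to that of
    \<open>w\<close>. One more than \<open>k - fst w\<close> of them, together with the
    \<open>fst w\<close> variables of \<open>w\<close>, are \<open>k + 1\<close> variables equal up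
    to sign.\<close>
  have "(Var u - (- Var w)) ^ (fst u - (k - fst w)) dvd phi lam f"
  proof (rule power_dvd_phi[OF lam _ _ u])
    fix K and z :: "nat \<times> nat \<Rightarrow> complex"
    assume K: "K \<subseteq> fibre lam n u" "card K = Suc (k - fst w)" "\<forall>j\<in>K. z (0, j) = 0"
    have disj: "K \<inter> fibre lam n w = {}" using K(1) uw by (auto simp: fibre_def)
    have "finite K" using K(1) by (rule finite_subset) simp
    then have "card (K \<union> fibre lam n w) = k + 1"
      using disj K(2) wk by (simp add: card_Un_disjoint card_fibre[OF lam w])
    moreover have "K \<union> fibre lam n w \<subseteq> {1..n}" using K(1) fibre_subset by blast
    ultimately show "poly_at f (\<lambda>j. if j \<in> fibre lam n u then z (0, j) + poly_at (- Var w) z else z (grp lam j)) = 0"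
      using K uw by (intro F3_vanish_pm[OF f, of "K \<union> fibre lam n w" _ "z w"])
        (auto simp: poly_at_simps fibre_def)
  qed (use F3_sym[OF f] w in \<open>auto simp: sym_polys_def vars_subset_iff poly_at_simps\<close>)
  moreover have "fst u - (k - fst w) = fst u + fst w - k" using wk by simp
  ultimately show ?thesis by simp
qed

text \<open>A variable \<open>i\<close> of \<open>u\<close> joins the group \<open>w\<close>, while
  the other variables of \<open>u\<close> take arbitrary values. Treating these as singletons gives
  a partition above \<open>lam\<close>, whose \<open>phi\<close> kills \<open>f\<close>.\<close>

lemma Gamma_vanish:
  assumes lam: "restricted_partition k n lam" and f: "f \<in> Gamma k n lam"
    and u: "u \<in> labels lam" and w: "w \<in> labels lam" and uw: "u \<noteq> w" "fst u \<le> fst w"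
    and i: "i \<in> fibre lam n u"
    and xA: "\<And>j. j \<in> insert i (fibre lam n w) \<Longrightarrow> x j = y"
    and xo: "\<And>j. j \<in> {1..n} - fibre lam n u - fibre lam n w \<Longrightarrow> x j = z (grp lam j)"
  shows "poly_at f x = 0"
proof -
  have f3: "f \<in> F3 k n" using f by (simp add: Gamma_def)
  let ?A = "insert i (fibre lam n w)"
  have iw: "i \<notin> fibre lam n w" using i uw by (auto simp: fibre_def)
  have A: "?A \<subseteq> {1..n}" "card ?A = fst w + 1"
    using i iw fibre_subset[of lam n u] fibre_subset[of lam n w] by (auto simp: card_fibre[OF lam w])
  have wk: "1 \<le> fst w" "fst w \<le> k" using labels_size[OF lam w] by auto
  show ?thesis
  \<comment> \<open>A group of size \<open>k\<close> cannot grow within restricted partitions, but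
    then \<open>k + 1\<close> variables are equal and \<open>F3\<close> itself applies.\<close>
  proof (cases "fst w = k")
    case True
    then show ?thesis using A xA by (intro F3_vanish_pm[OF f3, of ?A _ y]) auto
  next
    case False
    \<comment> \<open>Labels rather than values define the classes: \<open>(0, j)\<close> labels no
      group, so the rest of \<open>u\<close> splits into ones even if some values coincide.\<close>
    define c where "c j = (if j \<in> ?A then w else if j \<in> fibre lam n u then (0, j) else grp lam j)" for j
    define z' where "z' v = (if v = w then y else if fst v = 0 then x (snd v) else z v)" for v
    let ?O = "labels lam - {u, w}"
    let ?V = "c ` {1..n}"
    define s where "s v = card {j \<in> {1..n}. c j = v}" for v
    have sum: "sum_list lam = n" using lam by (simp add: restricted_partition_def)
    have grp: "grp lam j \<in> labels lam" if "j \<in> {1..n}" for j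
      using grp_in_labels[OF sum that] .
    have pos: "fst v \<noteq> 0" if "v \<in> labels lam" for v
      using labels_size[OF lam that] by auto
    have Fw: "{j \<in> {1..n}. c j = w} = ?A"
      using A(1) pos[OF w] by (auto simp: c_def fibre_def)
    have Fo: "{j \<in> {1..n}. c j = v} = fibre lam n v" if "v \<in> ?O" for v
      using that pos[of v] i by (auto simp: c_def fibre_def split: if_splits)
    have F1: "{j \<in> {1..n}. c j = (0, l)} = {l}" if "l \<in> fibre lam n u - {i}" for l
    proof -
      have "c j = (0, l) \<Longrightarrow> j = l" if "j \<in> {1..n}" for j
        using grp[OF that] pos[of "grp lam j"] pos[OF w] by (auto simp: c_def split: if_splits)
      moreover have "c l = (0, l)" "l \<in> {1..n}"
        using that uw fibre_subset[of lam n u] by (auto simp: c_def fibre_def)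
      ultimately show ?thesis by blast
    qed
    have sw: "s w = fst w + 1" by (simp only: s_def Fw A(2))
    have so: "s v = fst v" if "v \<in> ?O" for v
      using that by (simp only: s_def Fo card_fibre[OF lam]) (simp add: card_fibre[OF lam])
    have s1: "s (0, l) = 1" if "l \<in> fibre lam n u - {i}" for l
      by (simp only: s_def F1[OF that]) simp
    have V_cases: "v = w \<or> v \<in> ?O \<or> (\<exists>l\<in>fibre lam n u - {i}. v = (0, l))" if "v \<in> ?V" for v
      using that grp by (auto simp: c_def fibre_def)
    have V: "w \<in> ?V" "?O \<subseteq> ?V"
    proof -
      show "w \<in> ?V" using A(1) by (force simp: c_def)
      show "?O \<subseteq> ?V"
      proof
        fix v assume v: "v \<in> ?O"
        then have "card {j \<in> {1..n}. c j = v} \<noteq> 0" using so[OF v] pos[of v] by (simp add: s_def)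
        then have "{j \<in> {1..n}. c j = v} \<noteq> {}" by (metis card.empty)
        then show "v \<in> ?V" by blast
      qed
    qed
    have small: "card {j \<in> {1..n}. c j = c i} \<le> k" if "i \<in> {1..n}" for i
    proof -
      have "c i \<in> ?V" using that by simp
      from V_cases[OF this] have "s (c i) \<le> k"
      proof (elim disjE bexE)
        assume "c i \<in> ?O"
        then show ?thesis using so labels_size[OF lam, of "c i"] by simp
      qed (use sw s1 wk False in auto)
      then show ?thesis by (simp add: s_def)
    qed
    obtain nu \<beta> where nu: "restricted_partition k n nu"
      and \<beta>: "bij_betw \<beta> ?V (labels nu)"
      and size: "\<And>v. v \<in> ?V \<Longrightarrow> fst (\<beta> v) = s v"
      by (rule partition_of_labelling[of n c k], erule small, rule that) (simp_all only: s_def)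
    have ge: "count_ge nu d = card {v \<in> ?V. d \<le> s v}" for d
    proof -
      have "bij_betw \<beta> {v \<in> ?V. d \<le> s v} {u \<in> labels nu. d \<le> fst u}"
        by (rule bij_betw_Collect[OF \<beta>]) (simp only: size)
      then show ?thesis by (simp add: count_ge_def bij_betw_same_card)
    qed
    let ?O' = "\<lambda>d. {v \<in> labels lam. d \<le> fst v}"
    have O': "w \<notin> ?O' d" "?O' d = {v \<in> ?O. d \<le> fst v}" if "fst w < d" for d
      using that uw by auto
    \<comment> \<open>For \<open>1 < d\<close> the singletons are invisible; only the enlarged
      \<open>w\<close> and the untouched groups count.\<close>
    have ge_iff: "v \<in> ?V \<and> d \<le> s v \<longleftrightarrow> v = w \<and> d \<le> fst w + 1 \<or> v \<in> ?O \<and> d \<le> fst v"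
      if d: "1 < d" for v d
    proof
      assume v: "v \<in> ?V \<and> d \<le> s v"
      then have "v = w \<or> v \<in> ?O \<or> (\<exists>l\<in>fibre lam n u - {i}. v = (0, l))" by (intro V_cases) simp
      then show "v = w \<and> d \<le> fst w + 1 \<or> v \<in> ?O \<and> d \<le> fst v"
      proof (elim disjE bexE)
        assume "v = w" then show ?thesis using v sw by simp
      next
        assume "v \<in> ?O" then show ?thesis using v so[of v] by simp
      next
        fix l assume "l \<in> fibre lam n u - {i}" "v = (0, l)"
        then show ?thesis using v s1[of l] d by simp
      qed
    next
      assume "v = w \<and> d \<le> fst w + 1 \<or> v \<in> ?O \<and> d \<le> fst v"
      then show "v \<in> ?V \<and> d \<le> s v"
      proof (elim disjE conjE)
        assume "v = w" "d \<le> fst w + 1" then show ?thesis using V(1) sw by simp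
      next
        assume v: "v \<in> ?O" "d \<le> fst v"
        then show ?thesis using subsetD[OF V(2) v(1)] so[OF v(1)] by simp
      qed
    qed
    have gt: "{v \<in> ?V. d \<le> s v} = ?O' d" if "fst w + 1 < d" for d
    proof -
      have "{v \<in> ?V. d \<le> s v} = {v \<in> ?O. d \<le> fst v}"
        using that by (intro Collect_cong) (subst ge_iff, auto)
      then show ?thesis using O'(2)[of d] that by simp
    qed
    have eq: "{v \<in> ?V. fst w + 1 \<le> s v} = insert w (?O' (fst w + 1))"
    proof -
      have "{v \<in> ?V. fst w + 1 \<le> s v} = insert w {v \<in> ?O. fst w + 1 \<le> fst v}"
        using wk ge_iff[of "fst w + 1"] by (auto simp del: image_iff)
      then show ?thesis using O'(2)[of "fst w + 1"] by simp
    qed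
    \<comment> \<open>The threshold is \<open>fst w + 1\<close>: there \<open>nu\<close> gains
      \<open>w\<close>, and nothing is lost there or above because
      \<open>fst u \<le> fst w\<close>.\<close>
    have "nu \<succ>\<^sub>l lam"
    proof (subst lex_greater_iff)
      have "count_ge lam (fst w + 1) < count_ge nu (fst w + 1)"
        unfolding ge eq using O'(1)[of "fst w + 1"] by (simp add: count_ge_def)
      moreover have "count_ge nu d = count_ge lam d" if "fst w + 1 < d" for d
        unfolding ge gt[OF that] by (simp add: count_ge_def)
      ultimately show "\<exists>c\<ge>1. (\<forall>d>c. count_ge nu d = count_ge lam d) \<and> count_ge lam c < count_ge nu c"
        by (intro exI[of _ "fst w + 1"]) auto
    qed (use lam nu in \<open>auto simp: restricted_partition_def\<close>)
    then have phi: "phi nu f = 0" using f nu by (simp add: Gamma_def)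
    have "x j = z' (c j)" if j: "j \<in> {1..n}" for j
    proof -
      consider "j \<in> ?A" | "j \<in> fibre lam n u" "j \<notin> ?A" | "j \<notin> ?A" "j \<notin> fibre lam n u" by blast
      then show ?thesis
      proof cases
        case 1
        then show ?thesis using xA by (simp add: c_def z'_def)
      next
        case 2
        then show ?thesis using pos[OF w] by (auto simp: c_def z'_def)
      next
        case 3
        then have "grp lam j \<noteq> w" using j by (auto simp: fibre_def)
        moreover have "fst (grp lam j) \<noteq> 0" using pos[OF grp[OF j]] .
        ultimately show ?thesis using 3 xo[of j] j by (simp add: c_def z'_def)
      qed
    qed
    then have "poly_at f x = poly_at f (\<lambda>j. z' (c j))"
      using F3_sym[OF f3] by (intro poly_at_cong) (auto simp: sym_polys_def)
    also have "\<dots> = 0"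
      using grouping_of_labelling[OF F3_sym[OF f3] _ \<beta>, of z'] size nu
      by (simp add: s_def phi poly_at_0 restricted_partition_def)
    finally show ?thesis .
  qed
qed

text \<open>Write \<open>q = Var v * q1\<close>; on \<open>v = 0\<close> the derivative of
  \<open>q\<close> in \<open>v\<close> is the value of \<open>q1\<close>, so \<open>q1\<close> is
  divisible as well.\<close>

lemma square_dvd_of_vanishing:
  assumes zero: "\<And>z. z v = 0 \<Longrightarrow> poly_at q z = 0"
    and deriv: "\<And>z. z v = 0 \<Longrightarrow> ((\<lambda>t. poly_at q (z(v := t))) has_field_derivative 0) (at 0)"
  shows "Var v ^ 2 dvd q"
proof -
  obtain q1 where q1: "q = Var v * q1" using Var_dvd_of_vanishing[of v q] zero by (auto elim: dvdE)
  have "poly_at q1 z = 0" if z: "z v = 0" for z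
  proof -
    obtain d where "\<forall>h. (\<forall>w. w \<notin> {v} \<longrightarrow> h w = 0) \<longrightarrow>
        ((\<lambda>t. poly_at q1 (\<lambda>w. z w + t * h w)) has_field_derivative (\<Sum>w\<in>{v}. h w * d w)) (at 0)"
      using poly_at_directional_derivative[of "{v}" q1 z] by auto
    from this[rule_format, of "\<lambda>w. if w = v then 1 else 0"]
    have "((\<lambda>t. poly_at q1 (\<lambda>w. z w + t * (if w = v then 1 else 0))) has_field_derivative d v) (at 0)"
      by simp
    moreover have "(\<lambda>w. z w + t * (if w = v then 1 else 0)) = z(v := t)" for t using z by auto
    ultimately have "((\<lambda>t. poly_at q1 (z(v := t))) has_field_derivative d v) (at 0)" by simp
    from DERIV_mult[OF DERIV_ident this]
    have "((\<lambda>t. poly_at q (z(v := t))) has_field_derivative poly_at q1 (z(v := 0))) (at 0)"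
      by (simp add: q1 poly_at_mult poly_at_Var)
    then have "poly_at q1 (z(v := 0)) = 0" using deriv[of z, OF z] by (rule DERIV_unique)
    moreover have "z(v := 0) = z" using z by auto
    ultimately show ?thesis by simp
  qed
  then have "Var v dvd q1" by (rule Var_dvd_of_vanishing)
  then show ?thesis by (simp add: q1 power2_eq_square mult_dvd_mono)
qed

section \<open>Primality of the linear forms and the factors x - y\<close>

lemma dvd_poly_at: "d dvd p \<Longrightarrow> poly_at d z = 0 \<Longrightarrow> poly_at p z = 0"
  by (auto elim!: dvdE simp: poly_at_mult)

lemma prime_form_linear_form:
  assumes "u \<noteq> w"
  shows "prime_form (Var u - Const c * Var w)" "\<not> Var u - Const c * Var w dvd 1"
proof -
  have "Var u \<noteq> Const c * Var w"
  proof
    assume "Var u = Const c * Var w"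
    then have "poly_at (Var u) (\<lambda>v. if v = u then 1 else 0) = poly_at (Const c * Var w) (\<lambda>v. if v = u then 1 else 0)"
      by simp
    then show False using assms by (simp add: poly_at_simps)
  qed
  then show "prime_form (Var u - Const c * Var w)"
    using assms by (intro prime_form_linear) (simp_all add: subst_simps)
  show "\<not> Var u - Const c * Var w dvd 1"
    using dvd_poly_at[of "Var u - Const c * Var w" 1 "\<lambda>_. 0"] by (auto simp: poly_at_simps)
qed

lemma Var_neq_0: "(Var u :: 'v cpoly) \<noteq> 0"
proof
  assume "(Var u :: 'v cpoly) = 0"
  then have "poly_at (Var u :: 'v cpoly) (\<lambda>_. 1) = poly_at 0 (\<lambda>_ :: 'v. 1)" by (simp only:)
  then show False by (simp add: poly_at_simps)
qed

lemma prime_form_Var: "prime_form (Var u)" "\<not> Var u dvd 1"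
proof -
  show "prime_form (Var u)"
    using prime_form_linear[of u 0] by (simp add: subst_simps Var_neq_0)
  show "\<not> Var u dvd 1"
    using dvd_poly_at[of "Var u" 1 "\<lambda>_. 0"] by (auto simp: poly_at_simps)
qed

lemma Var_not_dvd_Var: "u \<noteq> v \<Longrightarrow> \<not> Var u dvd Var v"
  using dvd_poly_at[of "Var u" "Var v" "\<lambda>w. if w = u then 0 else 1"] by (auto simp: poly_at_simps)

text \<open>Opening the smaller group around \<open>Var w\<close> makes each of its
  \<open>fst u\<close> new variables divide twice; closing it turns each into
  \<open>Var u - Var w\<close>.\<close>

lemma minus_factor_dvd_phi:
  assumes lam: "restricted_partition k n lam" and f: "f \<in> Gamma k n lam"
    and u: "u \<in> labels lam" and w: "w \<in> labels lam" and uw: "u \<noteq> w" "fst u \<le> fst w"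
  shows "(Var u - Var w) ^ (2 * fst u) dvd phi lam f"
proof -
  let ?J = "fibre lam n u" and ?B = "fibre lam n w"
  let ?q = "open_group lam n u (Var w) f"
  have f3: "f \<in> F3 k n" using f by (simp add: Gamma_def)
  have vars: "vars f \<subseteq> {1..n}" using F3_sym[OF f3] by (simp add: sym_polys_def)
  have w0: "w \<noteq> (0, i)" for i using labels_size[OF lam w] by auto
  have disj: "?J \<inter> ?B = {}" using uw by (auto simp: fibre_def)
  have grp0: "grp lam j \<noteq> (0, i)" if "j \<in> {1..n}" for i j
    using labels_size[OF lam grp_in_labels[of lam n j]] that lam by (auto simp: restricted_partition_def)
  have sq: "Var (0, i) ^ 2 dvd ?q" if i: "i \<in> ?J" for i
  proof (rule square_dvd_of_vanishing)
    fix z :: "nat \<times> nat \<Rightarrow> complex" assume z: "z (0, i) = 0"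
    define x where "x j = (if j \<in> ?J then z (0, j) + z w else z (grp lam j))" for j
    have q: "poly_at ?q z = poly_at f x"
      unfolding poly_at_open_group by (rule arg_cong[of _ _ "poly_at f"]) (auto simp: x_def poly_at_Var)
    have xA: "x j = z w" if "j \<in> insert i ?B" for j
      using that z i disj by (auto simp: x_def fibre_def)
    show "poly_at ?q z = 0"
      unfolding q using xA by (intro Gamma_vanish[OF lam f u w uw i, of x "z w" z]) (auto simp: x_def)
    \<comment> \<open>At \<open>z (0, i) = 0\<close> the variable \<open>i\<close> agrees with all
      of \<open>w\<close>, and \<open>f\<close> stays zero while these move together; symmetry
      passes this on to the motion of \<open>i\<close> alone.\<close>
    have "((\<lambda>t. poly_at f (x(i := x i + t))) has_field_derivative 0) (at 0)"
    proof (rule sym_derivative_vanish[OF F3_sym[OF f3], of "insert i ?B" i x "z w"])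
      fix t
      show "poly_at f (\<lambda>j. if j \<in> insert i ?B then z w + t else x j) = 0"
        by (intro Gamma_vanish[OF lam f u w uw i, of _ "z w + t" z]) (use i in \<open>auto simp: x_def\<close>)
    qed (use i xA in \<open>auto simp: fibre_def\<close>)
    moreover have "poly_at f (x(i := x i + t)) = poly_at ?q (z((0, i) := t))" for t
      unfolding poly_at_open_group
    proof (rule poly_at_cong)
      fix j assume "j \<in> vars f"
      then have j: "j \<in> {1..n}" using vars by auto
      then show "(x(i := x i + t)) j = (if j \<in> ?J then (z((0, i) := t)) (0, j) + poly_at (Var w) (z((0, i) := t))
          else (z((0, i) := t)) (grp lam j))"
        using i z w0 grp0[OF j] by (auto simp: x_def poly_at_Var)
    qed
    ultimately show "((\<lambda>t. poly_at ?q (z((0, i) := t))) has_field_derivative 0) (at 0)"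
      by simp
  qed
  have "(\<Prod>i\<in>?J. Var (0, i) ^ 2) dvd ?q"
    by (rule prod_prime_forms_dvd) (simp_all add: prime_form_Var Var_not_dvd_Var sq)
  then have "subst (close_group u (Var w)) (\<Prod>i\<in>?J. Var (0, i) ^ 2) dvd subst (close_group u (Var w)) ?q"
    by (auto elim!: dvdE simp: subst_mult)
  moreover have "subst (close_group u (Var w)) (\<Prod>i\<in>?J. Var (0, i) ^ 2) = (Var u - Var w) ^ (2 * fst u)"
    by (simp add: subst_simps close_group_def card_fibre[OF lam u] power_mult)
  moreover have "subst (close_group u (Var w)) ?q = phi lam f"
    using w by (intro subst_close_open_group[OF lam vars]) (simp add: vars_Var)
  ultimately show ?thesis by simp
qed

text \<open>One indexed family for all linear factors of \<open>G3\<close>, so that pairwise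
  non-divisibility is a single statement; \<open>c = 1\<close> gives differences and
  \<open>c = - 1\<close> sums.\<close>

fun factor :: "(nat \<times> nat) + complex \<times> (nat \<times> nat) \<times> (nat \<times> nat) \<Rightarrow> (nat \<times> nat) cpoly" where
  "factor (Inl u) = Var u"
| "factor (Inr (c, u, w)) = Var u - Const c * Var w"

fun factor_exp :: "nat \<Rightarrow> (nat \<times> nat) + complex \<times> (nat \<times> nat) \<times> (nat \<times> nat) \<Rightarrow> nat" where
  "factor_exp k (Inl u) = fst u - b0 k"
| "factor_exp k (Inr (c, u, w)) = (if c = 1 then 2 * min (fst u) (fst w) else fst u + fst w - k)"

definition factors :: "nat list \<Rightarrow> ((nat \<times> nat) + complex \<times> (nat \<times> nat) \<times> (nat \<times> nat)) set" where
  "factors lam = Inl ` labels lam \<union> Inr ` ({1, - 1} \<times> pairs lam)"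

lemma finite_factors: "finite (factors lam)"
  by (simp add: factors_def)

lemma G3_eq_prod_factors:
  assumes "restricted_partition k n lam"
  shows "G3 k lam = (\<Prod>i\<in>factors lam. factor i ^ factor_exp k i)"
proof -
  have 1: "Const 1 = (1 :: (nat \<times> nat) cpoly)" "Const (- 1) = (- 1 :: (nat \<times> nat) cpoly)"
    by (rule poly_eqI, simp add: poly_at_simps)+
  have "(\<Prod>i\<in>factors lam. factor i ^ factor_exp k i) =
      (\<Prod>i\<in>Inl ` labels lam. factor i ^ factor_exp k i) *
      (\<Prod>i\<in>Inr ` ({1, - 1} \<times> pairs lam). factor i ^ factor_exp k i)"
    unfolding factors_def by (rule prod.union_disjoint) auto
  also have "(\<Prod>i\<in>Inl ` labels lam. factor i ^ factor_exp k i) = (\<Prod>u\<in>labels lam. Var u ^ (fst u - b0 k))"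
    by (simp add: prod.reindex)
  also have "(\<Prod>i\<in>Inr ` ({1, - 1} \<times> pairs lam). factor i ^ factor_exp k i) =
      (\<Prod>c\<in>{1, - 1}. \<Prod>p\<in>pairs lam. factor (Inr (c, p)) ^ factor_exp k (Inr (c, p)))"
    by (simp add: prod.reindex prod.cartesian_product case_prod_beta o_def)
  also have "\<dots> = (\<Prod>(u, w)\<in>pairs lam. (Var u - Var w) ^ (2 * min (fst u) (fst w))) *
    (\<Prod>(u, w)\<in>pairs lam. (Var u + Var w) ^ (fst u + fst w - k))"
    by (simp add: case_prod_beta' 1 flip: prod.distrib) (auto intro!: prod.cong simp: 1)
  finally show ?thesis by (simp add: G3_eq_prod[OF assms] mult.assoc)
qed

lemma factor_prime:
  assumes "i \<in> factors lam"
  shows "prime_form (factor i)" "\<not> factor i dvd 1"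
  using assms by (auto simp: factors_def pairs_def prime_form_Var prime_form_linear_form)

text \<open>A divisor vanishes only where its multiples do, so a point at which the first form
  vanishes and the second does not suffices.\<close>

lemma factor_not_dvd:
  assumes "i \<in> factors lam" "j \<in> factors lam" "i \<noteq> j"
  shows "\<not> factor i dvd factor j"
proof -
  have "\<exists>z. poly_at (factor i) z = 0 \<and> poly_at (factor j) z \<noteq> 0"
  proof (cases i)
    case (Inl u)
    show ?thesis
    proof (cases j)
      case (Inl u')
      then show ?thesis using \<open>i = Inl u\<close> assms(3)
        by (intro exI[of _ "\<lambda>v. if v = u then 0 else 1"]) (auto simp: poly_at_simps)
    next
      case (Inr t)
      then obtain c u' w' where j: "j = Inr (c, u', w')" "c = 1 \<or> c = - 1" "u' < w'"
        using assms(2) by (auto simp: factors_def pairs_def)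
      show ?thesis
      proof (cases "u' = u")
        case True
        then show ?thesis using Inl j
          by (intro exI[of _ "\<lambda>v. if v = w' then 1 else 0"]) (auto simp: poly_at_simps)
      next
        case False
        then show ?thesis using Inl j
          by (intro exI[of _ "\<lambda>v. if v = u' then 1 else 0"]) (auto simp: poly_at_simps)
      qed
    qed
  next
    case (Inr t)
    then obtain c u w where i: "i = Inr (c, u, w)" "c = 1 \<or> c = - 1" "u < w"
      using assms(1) by (auto simp: factors_def pairs_def)
    show ?thesis
    proof (cases j)
      case (Inl u')
      then show ?thesis using i
        by (intro exI[of _ "\<lambda>v. if v = u then c else 1"]) (auto simp: poly_at_simps)
    next
      case (Inr t')
      then obtain c' u' w' where j: "j = Inr (c', u', w')" "c' = 1 \<or> c' = - 1" "u' < w'"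
        using assms(2) by (auto simp: factors_def pairs_def)
      \<comment> \<open>Both pairs are increasing, so if the second lies inside the first they are
        equal and only the sign can differ.\<close>
      consider "u' \<notin> {u, w}" | "w' \<notin> {u, w}" | "u' = u" "w' = w"
        using i(3) j(3) by force
      then show ?thesis
      proof cases
        case 1
        then show ?thesis using i j
          by (intro exI[of _ "\<lambda>v. if v = u' then 1 else 0"]) (auto simp: poly_at_simps)
      next
        case 2
        then show ?thesis using i j
          by (intro exI[of _ "\<lambda>v. if v = w' then 1 else 0"]) (auto simp: poly_at_simps)
      next
        case 3
        then have "c \<noteq> c'" using i j assms(3) by auto
        then show ?thesis using i j 3
          by (intro exI[of _ "\<lambda>v. if v = u then c else 1"]) (auto simp: poly_at_simps)
      qed
    qed
  qed
  then show ?thesis using dvd_poly_at by blast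
qed

lemma G3_dvd_phi:
  assumes lam: "restricted_partition k n lam" and f: "f \<in> Gamma k n lam"
  shows "G3 k lam dvd phi lam f"
  unfolding G3_eq_prod_factors[OF lam]
proof (rule prod_prime_forms_dvd[OF finite_factors])
  fix i assume i: "i \<in> factors lam"
  have f3: "f \<in> F3 k n" using f by (simp add: Gamma_def)
  have 1: "Const 1 = (1 :: (nat \<times> nat) cpoly)" "Const (- 1) = (- 1 :: (nat \<times> nat) cpoly)"
    by (rule poly_eqI, simp add: poly_at_simps)+
  from i consider u where "i = Inl u" "u \<in> labels lam"
    | u w where "i = Inr (1, u, w)" "u \<in> labels lam" "w \<in> labels lam" "u < w"
    | u w where "i = Inr (- 1, u, w)" "u \<in> labels lam" "w \<in> labels lam" "u < w"
    by (auto simp: factors_def pairs_def)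
  then show "factor i ^ factor_exp k i dvd phi lam f"
  proof cases
    case 1
    then show ?thesis using zero_factor_dvd_phi[OF lam f3] by simp
  next
    case 2
    then have le: "fst u \<le> fst w" by (auto simp: less_prod_def)
    then have "(Var u - Var w) ^ (2 * fst u) dvd phi lam f"
      using 2 by (intro minus_factor_dvd_phi[OF lam f]) auto
    then show ?thesis using 2 le by (simp add: 1 min_absorb1)
  next
    case 3
    then have "(Var u + Var w) ^ (fst u + fst w - k) dvd phi lam f"
      using 3 by (intro plus_factor_dvd_phi[OF lam f3]) auto
    then show ?thesis using 3 by (simp add: 1)
  qed
qed (use factor_prime factor_not_dvd in auto)

lemma G3_neq_0:
  assumes "restricted_partition k n lam"
  shows "G3 k lam \<noteq> 0"
  using factor_prime(1) finite_factors[of lam]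
  by (auto simp: G3_eq_prod_factors[OF assms] prime_form_def)

text \<open>Each defining property of invariants says that some substitution fixes the polynomial.
  It fixes \<open>p\<close> and \<open>g\<close>, hence \<open>s\<close> by cancellation; the
  condition on variables is the substitution of zero for foreign ones.\<close>

lemma inv_polys_cancel:
  assumes p: "p \<in> inv_polys lam" and g: "g \<in> inv_polys lam" "g \<noteq> 0" and eq: "p = g * s"
  shows "s \<in> inv_polys lam"
proof -
  have cancel: "subst t s = s" if "subst t p = p" "subst t g = g" for t
  proof -
    have "g * subst t s = g * s" using that eq by (metis subst_mult)
    then show ?thesis using g(2) by simp
  qed
  let ?t = "\<lambda>v. if v \<in> labels lam then Var v else 0"
  have "subst ?t q = q" if "q \<in> inv_polys lam" for q
  proof -
    have "subst ?t q = subst Var q"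
      using that by (intro subst_cong) (auto simp: inv_polys_def)
    then show ?thesis by (simp add: subst_id)
  qed
  then have s: "subst ?t s = s" using p g cancel by blast
  have "vars s \<subseteq> labels lam"
    unfolding vars_subset_iff
  proof (intro allI impI)
    fix z z' :: "nat \<times> nat \<Rightarrow> complex" assume "\<forall>v\<in>labels lam. z v = z' v"
    then have "(\<lambda>v. poly_at (?t v) z) = (\<lambda>v. poly_at (?t v) z')" by (auto simp: poly_at_simps)
    then have "poly_at (subst ?t s) z = poly_at (subst ?t s) z'" by (simp add: poly_at_subst)
    then show "poly_at s z = poly_at s z'" by (simp add: s)
  qed
  moreover have "poly_at s (\<lambda>u. z (\<pi> u)) = poly_at s z"
    if \<pi>: "\<pi> permutes labels lam \<and> (\<forall>u\<in>labels lam. fst (\<pi> u) = fst u)" for \<pi> z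
  proof -
    have "subst (\<lambda>u. Var (\<pi> u)) q = q" if "q \<in> inv_polys lam" for q
      using that \<pi> by (intro poly_eqI) (auto simp: inv_polys_def poly_at_simps)
    then have "subst (\<lambda>u. Var (\<pi> u)) s = s" using p g cancel by blast
    then have "poly_at (subst (\<lambda>u. Var (\<pi> u)) s) z = poly_at s z" by simp
    then show ?thesis by (simp add: poly_at_simps)
  qed
  ultimately show ?thesis by (simp add: inv_polys_def)
qed

lemma phi_in_inv_polys:
  assumes lam: "sum_list lam = n" and f: "f \<in> sym_polys {1..n}"
  shows "phi lam f \<in> inv_polys lam"
  unfolding inv_polys_def
proof (intro CollectI conjI allI impI, goal_cases)
  case 1
  show ?case using vars_phi[OF lam] f by (simp add: sym_polys_def)
next
  case (2 \<pi> z)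
  then have \<pi>: "\<pi> permutes labels lam" "\<forall>u\<in>labels lam. fst (\<pi> u) = fst u" by auto
  have "poly_at f (\<lambda>j. z (\<pi> (grp lam j))) = poly_at f (\<lambda>j. z (grp lam j))"
  proof (rule sym_poly_at_equal_fibres[OF f, where c = "\<lambda>j. \<pi> (grp lam j)" and c' = "grp lam" and z = z])
    fix v
    let ?v = "inv \<pi> v"
    have "\<pi> x = v \<longleftrightarrow> x = ?v" for x
      using permutes_inv_eq[OF \<pi>(1), of v x] by metis
    then have "{j \<in> {1..n}. \<pi> (grp lam j) = v} = {j \<in> {1..n}. grp lam j = ?v}"
      by (simp only:)
    moreover have "?v \<in> labels lam \<longleftrightarrow> v \<in> labels lam"
      using permutes_in_image[OF permutes_inv[OF \<pi>(1)]] .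
    moreover have "fst ?v = fst v" if "v \<in> labels lam"
    proof -
      have "?v \<in> labels lam" using that permutes_in_image[OF permutes_inv[OF \<pi>(1)]] by blast
      then have "fst (\<pi> ?v) = fst ?v" using \<pi>(2) by blast
      then show ?thesis using permutes_inverses(1)[OF \<pi>(1)] by simp
    qed
    ultimately show "card {j \<in> {1..n}. \<pi> (grp lam j) = v} = card {j \<in> {1..n}. grp lam j = v}"
      using card_grp_fibre[OF lam] by auto
  qed simp
  then show ?case by (simp add: poly_at_phi)
qed

lemma phi_Gamma_subset:
  assumes k: "1 \<le> k" and lam: "restricted_partition k n lam"
  shows "phi lam ` Gamma k n lam \<subseteq> (\<lambda>s. G3 k lam * s) ` S_alg k lam"
proof
  fix p assume "p \<in> phi lam ` Gamma k n lam"
  then obtain f where f: "f \<in> Gamma k n lam" "p = phi lam f" by auto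
  obtain s where s: "p = G3 k lam * s" using G3_dvd_phi[OF lam f(1)] f(2) by (auto elim: dvdE)
  have "f \<in> F3 k n" using f(1) by (simp add: Gamma_def)
  then have "f \<in> sym_polys {1..n}" by (rule F3_sym)
  then have "p \<in> inv_polys lam"
    using lam f(2) by (simp add: phi_in_inv_polys restricted_partition_def)
  then have "s \<in> inv_polys lam"
    using inv_polys_cancel[OF _ G3_in_inv_polys[OF lam] G3_neq_0[OF lam] s] by simp
  then show "p \<in> (\<lambda>s. G3 k lam * s) ` S_alg k lam"
    using s by (auto simp: inv_polys_eq_S_alg[OF k lam])
qed

section \<open>Construction of preimages\<close>

lemma prod_if_eq_const:
  fixes x :: "'a::comm_monoid_mult"
  shows "(\<Prod>l\<in>{1..a}. \<Prod>m\<in>{1..b}. if l = m then x else 1) = x ^ min a (b::nat)"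
proof -
  have "(\<Prod>m\<in>{1..b}. if l = m then x else 1) = (if l \<in> {1..b} then x else 1)" for l
    by (simp add: prod.delta)
  then have "(\<Prod>l\<in>{1..a}. \<Prod>m\<in>{1..b}. if l = m then x else 1) = (\<Prod>l\<in>{1..a}. if l \<in> {1..b} then x else 1)"
    by simp
  also have "\<dots> = (\<Prod>l\<in>{1..a} \<inter> {1..b}. x)"
    by (simp only: prod.inter_restrict[OF finite_atLeastAtMost])
  also have "{1..a} \<inter> {1..b} = {1..min a b}" by auto
  finally show ?thesis by simp
qed

text \<open>The solutions of \<open>l + m = k + 1\<close> have \<open>l\<close> from
  \<open>k + 1 - b\<close> to \<open>a\<close>, which is an empty range if
  \<open>a + b \<le> k\<close>.\<close>

lemma prod_if_antidiag_const:
  fixes x :: "'a::comm_monoid_mult"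
  assumes "a \<le> k" "b \<le> (k::nat)"
  shows "(\<Prod>l\<in>{1..a}. \<Prod>m\<in>{1..b}. if l + m = k + 1 then x else 1) = x ^ (a + b - k)"
proof -
  have "(\<Prod>m\<in>{1..b}. if l + m = k + 1 then x else 1) = (if l \<in> {k + 1 - b..k} then x else 1)"
    if "l \<in> {1..a}" for l
  proof -
    have "(\<Prod>m\<in>{1..b}. if l + m = k + 1 then x else 1) = (\<Prod>m\<in>{1..b}. if m = k + 1 - l then x else 1)"
      using that assms by (intro prod.cong if_cong refl) auto
    also have "\<dots> = (if k + 1 - l \<in> {1..b} then x else 1)" by simp
    also have "k + 1 - l \<in> {1..b} \<longleftrightarrow> l \<in> {k + 1 - b..k}" using that assms by auto
    finally show ?thesis .
  qed
  then have "(\<Prod>l\<in>{1..a}. \<Prod>m\<in>{1..b}. if l + m = k + 1 then x else 1) =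
      (\<Prod>l\<in>{1..a}. if l \<in> {k + 1 - b..k} then x else 1)"
    by (intro prod.cong) auto
  also have "\<dots> = (\<Prod>l\<in>{1..a} \<inter> {k + 1 - b..k}. x)"
    by (simp only: prod.inter_restrict[OF finite_atLeastAtMost])
  also have "{1..a} \<inter> {k + 1 - b..k} = {k + 1 - b..a}" using assms by auto
  also have "(\<Prod>l\<in>{k + 1 - b..a}. x) = x ^ (a + b - k)" using assms by simp
  finally show ?thesis .
qed

text \<open>The larger index satisfies \<open>2 * m > k + 1\<close>, that is
  \<open>m \<ge> b0 k + 1\<close>, and determines the smaller one, which is positive since
  \<open>a \<le> k\<close>.\<close>

lemma prod_if_antidiag_less_const:
  fixes x :: "'a::comm_monoid_mult"
  assumes "a \<le> k"
  shows "(\<Prod>(l, m)\<in>{(l, m). l \<in> {1..a} \<and> m \<in> {1..a} \<and> l < m}. if l + m = k + 1 then x else 1) = x ^ (a - b0 k)"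
proof -
  let ?D = "{(l, m). l \<in> {1..a} \<and> m \<in> {1..a} \<and> l < m}"
  have fin: "finite ?D" by (rule finite_subset[of _ "{1..a} \<times> {1..a}"]) auto
  have "(\<Prod>(l, m)\<in>?D. if l + m = k + 1 then x else 1) = (\<Prod>p\<in>?D. if p \<in> {(l, m). l + m = k + 1} then x else 1)"
    by (intro prod.cong) auto
  also have "\<dots> = (\<Prod>p\<in>?D \<inter> {(l, m). l + m = k + 1}. x)"
    using fin by (simp only: prod.inter_restrict)
  also have "\<dots> = (\<Prod>m\<in>{b0 k + 1..a}. x)"
    by (rule prod.reindex_bij_witness[where i = "\<lambda>m. (k + 1 - m, m)" and j = snd])
       (use assms in \<open>auto simp: b0_def\<close>)
  finally show ?thesis by simp
qed

lemma card_bij_fibre: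
  assumes "bij_betw f A S"
  shows "card {a \<in> A. f a = s} = (if s \<in> S then 1 else 0)"
proof (cases "s \<in> S")
  case True
  then obtain a where "a \<in> A" "f a = s" using assms by (auto simp: bij_betw_def)
  then have "{a \<in> A. f a = s} = {a}" using assms by (auto simp: bij_betw_def inj_on_def)
  then show ?thesis using True by simp
next
  case False
  then have "{a \<in> A. f a = s} = {}" using assms by (auto simp: bij_betw_def)
  then show ?thesis using False by (simp only: card.empty if_False)
qed

text \<open>The cells of the Young diagram of \<open>lam\<close>: a group is a row, and the second
  component is the column.\<close>

definition slots :: "nat list \<Rightarrow> ((nat \<times> nat) \<times> nat) set" where
  "slots lam = (SIGMA u:labels lam. {1..fst u})"

lemma finite_slots [simp]: "finite (slots lam)"
  by (simp add: slots_def)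

text \<open>A filling of the Young diagram by the variables, each in the row of its group;
  \<open>lev\<close> is the column. Any such filling serves.\<close>

locale levels =
  fixes k n :: nat and lam :: "nat list" and lev :: "nat \<Rightarrow> nat"
  assumes lam: "restricted_partition k n lam"
    and slots: "bij_betw (\<lambda>j. (grp lam j, lev j)) {1..n} (slots lam)"
begin

lemma sum_lam: "sum_list lam = n"
  using lam by (simp add: restricted_partition_def)

lemma slot: "j \<in> {1..n} \<Longrightarrow> grp lam j \<in> labels lam \<and> 1 \<le> lev j \<and> lev j \<le> fst (grp lam j)"
  using bij_betwE[OF slots] by (auto simp: slots_def)

lemma lev_range: "j \<in> {1..n} \<Longrightarrow> 1 \<le> lev j \<and> lev j \<le> k"
  using slot[of j] labels_size[OF lam, of "grp lam j"] by auto

lemma bij_level: "1 \<le> l \<Longrightarrow> bij_betw (grp lam) {j \<in> {1..n}. lev j = l} {u \<in> labels lam. l \<le> fst u}"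
proof -
  assume l: "1 \<le> l"
  have "inj_on (grp lam) {j \<in> {1..n}. lev j = l}"
  proof (rule inj_onI)
    fix i j assume ij: "i \<in> {j \<in> {1..n}. lev j = l}" "j \<in> {j \<in> {1..n}. lev j = l}" "grp lam i = grp lam j"
    then have "(grp lam i, lev i) = (grp lam j, lev j)" by simp
    then show "i = j" using ij(1,2) by (intro inj_onD[OF bij_betw_imp_inj_on[OF slots]]) auto
  qed
  moreover have "grp lam ` {j \<in> {1..n}. lev j = l} = {u \<in> labels lam. l \<le> fst u}"
  proof
    show "grp lam ` {j \<in> {1..n}. lev j = l} \<subseteq> {u \<in> labels lam. l \<le> fst u}"
      using slot by auto
    show "{u \<in> labels lam. l \<le> fst u} \<subseteq> grp lam ` {j \<in> {1..n}. lev j = l}"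
    proof
      fix u assume "u \<in> {u \<in> labels lam. l \<le> fst u}"
      then have "(u, l) \<in> slots lam" using l by (auto simp: slots_def)
      then have "(u, l) \<in> (\<lambda>j. (grp lam j, lev j)) ` {1..n}" using slots by (simp add: bij_betw_def)
      then show "u \<in> grp lam ` {j \<in> {1..n}. lev j = l}" by auto
    qed
  qed
  ultimately show ?thesis by (simp add: bij_betw_def)
qed

lemma card_level: "1 \<le> l \<Longrightarrow> card {j \<in> {1..n}. lev j = l} = count_ge lam l"
  using bij_betw_same_card[OF bij_level] by (simp add: count_ge_def)

definition position_pairs :: "(nat \<times> nat) set" where
  "position_pairs = {(i, j). i \<in> {1..n} \<and> j \<in> {1..n} \<and> i < j}"

lemma finite_position_pairs [simp]: "finite position_pairs"
  by (rule finite_subset[of _ "{1..n} \<times> {1..n}"]) (auto simp: position_pairs_def)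

text \<open>Level \<open>l\<close> is paired with level \<open>k + 1 - l\<close>: two groups of sizes \<open>a\<close> and \<open>b\<close> share
  \<open>min a b\<close> levels and have \<open>a + b - k\<close> paired ones, which are the exponents in \<open>G3\<close>.\<close>

definition level_poly :: "nat cpoly" where
  "level_poly = (\<Prod>(i, j)\<in>position_pairs.
     (if lev i = lev j then (Var i - Var j)\<^sup>2 else 1) *
     (if lev i + lev j = k + 1 then Var i + Var j else 1))"

text \<open>For odd \<open>k\<close> the middle level is paired with itself, and both factors occur
  for two variables in it.\<close>

definition pair_factor :: "(nat \<Rightarrow> complex) \<Rightarrow> nat \<Rightarrow> nat \<Rightarrow> complex" where
  "pair_factor z i j =
     (if lev i = lev j then (z i - z j)\<^sup>2 else 1) * (if lev i + lev j = k + 1 then z i + z j else 1)"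

lemma pair_factor_commute: "pair_factor z i j = pair_factor z j i"
  by (auto simp: pair_factor_def power2_commute add.commute)

lemma poly_at_level_poly: "poly_at level_poly z = (\<Prod>(i, j)\<in>position_pairs. pair_factor z i j)"
  unfolding level_poly_def pair_factor_def
  by (auto simp: poly_at_simps intro!: prod.cong)

lemma level_poly_nonzero:
  assumes nz: "poly_at level_poly z \<noteq> 0" and ij: "i \<in> {1..n}" "j \<in> {1..n}" "i \<noteq> j"
  shows "lev i = lev j \<Longrightarrow> z i \<noteq> z j" and "lev i + lev j = k + 1 \<Longrightarrow> z i + z j \<noteq> 0"
proof -
  have all: "pair_factor z i j \<noteq> 0" if "(i, j) \<in> position_pairs" for i j
    using nz that by (force simp: poly_at_level_poly)
  have "pair_factor z i j \<noteq> 0"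
  proof (cases "i < j")
    case True
    then show ?thesis using all ij by (auto simp: position_pairs_def)
  next
    case False
    then have "pair_factor z j i \<noteq> 0"
      using all ij by (auto simp: position_pairs_def)
    then show ?thesis using pair_factor_commute by simp
  qed
  then show "lev i = lev j \<Longrightarrow> z i \<noteq> z j" and "lev i + lev j = k + 1 \<Longrightarrow> z i + z j \<noteq> 0"
    by (auto simp: pair_factor_def split: if_splits)
qed

text \<open>Invariants of the column stabilizer of the filling, in contrast to
  \<open>inv_polys\<close>, where whole rows of equal length are exchanged.\<close>

definition level_invariants :: "nat cpoly set" where
  "level_invariants = {h. vars h \<subseteq> {1..n} \<and>
     (\<forall>\<tau> z. \<tau> permutes {1..n} \<and> (\<forall>i\<in>{1..n}. lev (\<tau> i) = lev i) \<longrightarrow>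
        poly_at h (\<lambda>i. z (\<tau> i)) = poly_at h z)}"

lemma level_invariantsI:
  assumes "\<And>z z'. (\<And>v. v \<in> {1..n} \<Longrightarrow> z v = z' v) \<Longrightarrow> poly_at p z = poly_at p z'"
    and "\<And>\<tau> z. \<tau> permutes {1..n} \<Longrightarrow> (\<And>i. i \<in> {1..n} \<Longrightarrow> lev (\<tau> i) = lev i) \<Longrightarrow>
      poly_at p (\<lambda>i. z (\<tau> i)) = poly_at p z"
  shows "p \<in> level_invariants"
  using assms unfolding level_invariants_def vars_subset_iff by blast

lemma level_invariants_local:
  assumes "p \<in> level_invariants" "\<And>v. v \<in> {1..n} \<Longrightarrow> z v = z' v"
  shows "poly_at p z = poly_at p z'"
  using assms unfolding level_invariants_def by (intro poly_at_cong) blast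

lemma level_invariants_permute:
  assumes "p \<in> level_invariants" "\<tau> permutes {1..n}" "\<And>i. i \<in> {1..n} \<Longrightarrow> lev (\<tau> i) = lev i"
  shows "poly_at p (\<lambda>i. z (\<tau> i)) = poly_at p z"
  using assms unfolding level_invariants_def by blast

lemma level_invariants_combine:
  assumes p: "p \<in> level_invariants" and q: "q \<in> level_invariants"
    and r: "\<And>z. poly_at r z = F (poly_at p z) (poly_at q z)"
  shows "r \<in> level_invariants"
proof (rule level_invariantsI)
  fix z z' :: "nat \<Rightarrow> complex" assume z: "\<And>v. v \<in> {1..n} \<Longrightarrow> z v = z' v"
  have "poly_at p z = poly_at p z'" "poly_at q z = poly_at q z'"
    by (rule level_invariants_local[OF p z], assumption, rule level_invariants_local[OF q z])
  then show "poly_at r z = poly_at r z'" by (simp only: r)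
next
  fix \<tau> and z :: "nat \<Rightarrow> complex"
  assume \<tau>: "\<tau> permutes {1..n}" "\<And>i. i \<in> {1..n} \<Longrightarrow> lev (\<tau> i) = lev i"
  show "poly_at r (\<lambda>i. z (\<tau> i)) = poly_at r z"
    by (simp only: r level_invariants_permute[OF p \<tau>] level_invariants_permute[OF q \<tau>])
qed

lemma level_invariants_add: "p \<in> level_invariants \<Longrightarrow> q \<in> level_invariants \<Longrightarrow> p + q \<in> level_invariants"
  and level_invariants_diff: "p \<in> level_invariants \<Longrightarrow> q \<in> level_invariants \<Longrightarrow> p - q \<in> level_invariants"
  and level_invariants_mult: "p \<in> level_invariants \<Longrightarrow> q \<in> level_invariants \<Longrightarrow> p * q \<in> level_invariants"
  by (erule (1) level_invariants_combine, rule poly_at_add poly_at_diff poly_at_mult)+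

lemma level_invariants_Const: "Const c \<in> level_invariants"
  by (simp add: level_invariants_def vars_subset_iff poly_at_Const)

lemma level_poly_invariant: "level_poly \<in> level_invariants"
  unfolding level_invariants_def
proof (intro CollectI conjI allI impI, goal_cases)
  case 1
  show ?case
    unfolding vars_subset_iff poly_at_level_poly
    by (auto simp: position_pairs_def pair_factor_def intro!: prod.cong)
next
  case (2 \<tau> z)
  then have "bij_betw \<tau> {1..n} {1..n}" by (simp add: permutes_imp_bij)
  have "poly_at level_poly (\<lambda>i. z (\<tau> i)) = (\<Prod>(i, j)\<in>position_pairs. pair_factor z (\<tau> i) (\<tau> j))"
    unfolding poly_at_level_poly using 2
    by (intro prod.cong refl) (auto simp: position_pairs_def pair_factor_def)
  also have "\<dots> = (\<Prod>(i, j)\<in>position_pairs. pair_factor z i j)"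
    unfolding position_pairs_def
    by (rule prod_tournament_bij[OF \<open>bij_betw \<tau> {1..n} {1..n}\<close> tournament_less tournament_less pair_factor_commute])
  finally show ?case by (simp add: poly_at_level_poly)
qed

lemma level_sum_invariant: "(\<Sum>i | i \<in> {1..n} \<and> lev i = l. Var i ^ r) \<in> level_invariants"
  unfolding level_invariants_def
proof (intro CollectI conjI allI impI, goal_cases)
  case 1
  show ?case unfolding vars_subset_iff by (simp add: poly_at_simps)
next
  case (2 \<tau> z)
  let ?L = "{i \<in> {1..n}. lev i = l}"
  have "bij_betw \<tau> ?L ?L"
    using 2 by (intro bij_betw_Collect[OF permutes_imp_bij]) auto
  from sum.reindex_bij_betw[OF this, of "\<lambda>i. z i ^ r"]
  show ?case by (simp add: poly_at_simps)
qed

lemma level_invariants_onto: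
  assumes "s \<in> inv_polys lam"
  shows "\<exists>h\<in>level_invariants. phi lam h = s"
proof -
  have "inv_polys lam \<subseteq> phi lam ` level_invariants"
  proof (rule inv_polys_generated)
    show "Const c \<in> phi lam ` level_invariants" for c
      using phi_simps(3) level_invariants_Const by (metis image_eqI)
    fix p q assume "p \<in> phi lam ` level_invariants" "q \<in> phi lam ` level_invariants"
    then obtain h h' where h: "h \<in> level_invariants" "h' \<in> level_invariants" "p = phi lam h" "q = phi lam h'"
      by blast
    show "p + q \<in> phi lam ` level_invariants"
      unfolding h(3,4) phi_simps(1)[symmetric] using h(1,2) by (intro imageI level_invariants_add)
    show "p * q \<in> phi lam ` level_invariants"
      unfolding h(3,4) phi_simps(2)[symmetric] using h(1,2) by (intro imageI level_invariants_mult)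
  next
    fix a r assume "a \<in> fst ` labels lam"
    then have a: "1 \<le> a" using labels_size[OF lam] by auto
    define h where "h l = (\<Sum>i | i \<in> {1..n} \<and> lev i = l. Var i ^ r :: nat cpoly)" for l
    have phi_h: "phi lam (h l) = (\<Sum>u | u \<in> labels lam \<and> l \<le> fst u. Var u ^ r)" if "1 \<le> l" for l
      using sum.reindex_bij_betw[OF bij_level[OF that], of "\<lambda>u. Var u ^ r"]
      by (simp add: h_def phi_simps)
    \<comment> \<open>Level \<open>a\<close> meets the rows of length at least \<open>a\<close>, so
      the difference isolates length exactly \<open>a\<close>. For \<open>a = k\<close> the next
      level is empty and its sum is zero.\<close>
    have "h a - h (a + 1) \<in> level_invariants"
      unfolding h_def by (intro level_invariants_diff level_sum_invariant)
    moreover have "phi lam (h a - h (a + 1)) = power_sum lam a r"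
    proof -
      have "{u. u \<in> labels lam \<and> a \<le> fst u} = {u. u \<in> labels lam \<and> a + 1 \<le> fst u} \<union> {u. u \<in> labels lam \<and> fst u = a}"
        by auto
      moreover have "(\<Sum>u\<in>{u. u \<in> labels lam \<and> a + 1 \<le> fst u} \<union> {u. u \<in> labels lam \<and> fst u = a}. Var u ^ r) =
          (\<Sum>u | u \<in> labels lam \<and> a + 1 \<le> fst u. Var u ^ r) + power_sum lam a r"
        unfolding power_sum_def by (rule sum.union_disjoint) auto
      ultimately have "phi lam (h a) = phi lam (h (a + 1)) + power_sum lam a r"
        using a by (simp only: phi_h[of a] phi_h[of "a + 1"])
      moreover have "phi lam (h a) = phi lam (h a - h (a + 1)) + phi lam (h (a + 1))"
        by (simp flip: phi_simps(1))
      ultimately show ?thesis by simp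
    qed
    ultimately show "power_sum lam a r \<in> phi lam ` level_invariants" by (metis image_eqI)
  qed
  then show ?thesis using assms by auto
qed

section \<open>The symmetrized polynomials and their vanishing\<close>

definition symmetrization :: "nat cpoly \<Rightarrow> nat cpoly" where
  "symmetrization h = (\<Sum>\<sigma> | \<sigma> permutes {1..n}. subst (\<lambda>i. Var (\<sigma> i)) (level_poly * h))"

lemma poly_at_symmetrization:
  "poly_at (symmetrization h) z =
    (\<Sum>\<sigma> | \<sigma> permutes {1..n}. poly_at level_poly (\<lambda>i. z (\<sigma> i)) * poly_at h (\<lambda>i. z (\<sigma> i)))"
  by (simp add: symmetrization_def poly_at_simps)

lemma poly_at_symmetrization_eq_0:
  assumes "\<And>\<sigma>. \<sigma> permutes {1..n} \<Longrightarrow> poly_at level_poly (\<lambda>i. z (\<sigma> i)) = 0"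
  shows "poly_at (symmetrization h) z = 0"
  using assms by (simp add: poly_at_symmetrization)

lemma symmetrization_sym:
  assumes h: "h \<in> level_invariants"
  shows "symmetrization h \<in> sym_polys {1..n}"
  unfolding sym_polys_iff
proof (intro conjI allI impI)
  have vars: "vars h \<subseteq> {1..n}" "vars level_poly \<subseteq> {1..n}"
    using h level_poly_invariant by (auto simp: level_invariants_def)
  show "vars (symmetrization h) \<subseteq> {1..n}"
    unfolding vars_subset_iff
  proof (intro allI impI)
    fix z z' :: "nat \<Rightarrow> complex" assume z: "\<forall>v\<in>{1..n}. z v = z' v"
    have "poly_at p (\<lambda>i. z (\<sigma> i)) = poly_at p (\<lambda>i. z' (\<sigma> i))"
      if "\<sigma> permutes {1..n}" "vars p \<subseteq> {1..n}" for \<sigma> and p :: "nat cpoly"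
      using that z permutes_in_image[OF that(1)] by (intro poly_at_cong) blast
    then show "poly_at (symmetrization h) z = poly_at (symmetrization h) z'"
      unfolding poly_at_symmetrization using vars by (intro sum.cong refl) simp
  qed
  fix \<rho> and z :: "nat \<Rightarrow> complex" assume "\<rho> permutes {1..n}"
  from setum_permutations_compose_left[OF this,
      of "\<lambda>\<sigma>. poly_at level_poly (\<lambda>i. z (\<sigma> i)) * poly_at h (\<lambda>i. z (\<sigma> i))"]
  show "poly_at (symmetrization h) (\<lambda>i. z (\<rho> i)) = poly_at (symmetrization h) z"
    by (simp add: poly_at_symmetrization)
qed

lemma card_permutes_preimage:
  assumes "\<sigma> permutes {1..n}" "B \<subseteq> {1..n}"
  shows "card {i \<in> {1..n}. \<sigma> i \<in> B} = card B"
proof -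
  have "bij_betw \<sigma> {i \<in> {1..n}. \<sigma> i \<in> B} {i \<in> {1..n}. i \<in> B}"
    by (rule bij_betw_Collect[OF permutes_imp_bij[OF assms(1)]]) simp
  moreover have "{i \<in> {1..n}. i \<in> B} = B" using assms(2) by auto
  ultimately show ?thesis using bij_betw_same_card by metis
qed

lemma symmetrization_F3:
  assumes h: "h \<in> level_invariants"
  shows "symmetrization h \<in> F3 k n"
proof -
  have pm: "poly_at (symmetrization h) z = 0"
    if kn: "k + 1 \<le> n" and z: "\<And>i. i \<in> {1..k + 1} \<Longrightarrow> z i = w \<or> z i = - w" for z w
  proof (rule poly_at_symmetrization_eq_0, rule ccontr)
    fix \<sigma> assume \<sigma>: "\<sigma> permutes {1..n}" and nz: "poly_at level_poly (\<lambda>i. z (\<sigma> i)) \<noteq> 0"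
    let ?A = "{i \<in> {1..n}. \<sigma> i \<in> {1..k + 1}}"
    \<comment> \<open>There are \<open>k\<close> values for \<open>k + 1\<close> variables. A
      collision means equal values on one level, or opposite values on paired levels, and either
      kills a factor.\<close>
    let ?h = "\<lambda>i. if z (\<sigma> i) = w then lev i else k + 1 - lev i"
    have "?h ` ?A \<subseteq> {1..k}" using lev_range by force
    then have "card (?h ` ?A) \<le> k" using card_mono[of "{1..k}"] by fastforce
    moreover have "card ?A = k + 1" using card_permutes_preimage[OF \<sigma>, of "{1..k + 1}"] kn by simp
    ultimately have "\<not> inj_on ?h ?A" by (intro pigeonhole) simp
    then obtain i j where ij: "i \<in> ?A" "j \<in> ?A" "i \<noteq> j" "?h i = ?h j" by (auto simp: inj_on_def)
    have r: "lev i \<le> k" "lev j \<le> k" using ij lev_range by auto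
    have w: "z (\<sigma> i) = w \<or> z (\<sigma> i) = - w" "z (\<sigma> j) = w \<or> z (\<sigma> j) = - w" using ij z by auto
    have ne: "lev i = lev j \<Longrightarrow> z (\<sigma> i) \<noteq> z (\<sigma> j)" "lev i + lev j = k + 1 \<Longrightarrow> z (\<sigma> i) + z (\<sigma> j) \<noteq> 0"
      using level_poly_nonzero[OF nz, of i j] ij by auto
    show False
    proof (cases "z (\<sigma> i) = w \<longleftrightarrow> z (\<sigma> j) = w")
      case True
      then have "lev i = lev j" using ij(4) r by (auto split: if_splits)
      then show False using ne(1) w True by auto
    next
      case False
      then have "lev i + lev j = k + 1" using ij(4) r by (auto split: if_splits)
      then show False using ne(2) w False by auto
    qed
  qed
  have zero: "poly_at (symmetrization h) z = 0"
    if bn: "b0 k + 1 \<le> n" and z: "\<And>i. i \<in> {1..b0 k + 1} \<Longrightarrow> z i = 0" for z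
  proof (rule poly_at_symmetrization_eq_0, rule ccontr)
    fix \<sigma> assume \<sigma>: "\<sigma> permutes {1..n}" and nz: "poly_at level_poly (\<lambda>i. z (\<sigma> i)) \<noteq> 0"
    let ?A = "{i \<in> {1..n}. \<sigma> i \<in> {1..b0 k + 1}}"
    \<comment> \<open>The classes of levels under \<open>l\<close> and \<open>k + 1 - l\<close>
      number \<open>b0 k\<close>; two vanishing variables in one class kill a factor.\<close>
    let ?h = "\<lambda>i. min (lev i) (k + 1 - lev i)"
    have "?h i \<in> {1..b0 k}" if "i \<in> ?A" for i
      using lev_range[of i] that by (auto simp: b0_def min_def)
    then have "?h ` ?A \<subseteq> {1..b0 k}" by blast
    then have "card (?h ` ?A) \<le> b0 k" using card_mono[of "{1..b0 k}"] by fastforce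
    moreover have "card ?A = b0 k + 1" using card_permutes_preimage[OF \<sigma>, of "{1..b0 k + 1}"] bn by simp
    ultimately have "\<not> inj_on ?h ?A" by (intro pigeonhole) simp
    then obtain i j where ij: "i \<in> ?A" "j \<in> ?A" "i \<noteq> j" "?h i = ?h j" by (auto simp: inj_on_def)
    have r: "lev i \<le> k" "lev j \<le> k" using ij lev_range by auto
    have "z (\<sigma> i) = 0" "z (\<sigma> j) = 0" using ij z by auto
    moreover have "lev i = lev j \<or> lev i + lev j = k + 1" using ij(4) r by (auto simp: min_def split: if_splits)
    ultimately show False using level_poly_nonzero[OF nz, of i j] ij by auto
  qed
  show ?thesis
    unfolding F3_def
  proof (intro CollectI conjI impI allI)
    fix a and z :: "nat \<Rightarrow> complex" and w
    assume "k + 1 \<le> n" "(\<forall>i\<in>{1..a}. z i = w) \<and> (\<forall>i\<in>{a + 1..k + 1}. z i = - w)"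
    then show "poly_at (symmetrization h) z = 0" by (intro pm[of z w]) (auto simp: not_less_eq_eq[symmetric])
  qed (use symmetrization_sym[OF h] zero in auto)
qed

text \<open>The cells in the rows \<open>U\<close> are counted column by column.\<close>

lemma sum_sizes_eq:
  assumes "restricted_partition k n' nu" "U \<subseteq> labels nu"
  shows "(\<Sum>u\<in>U. fst u) = (\<Sum>l=1..k. card {u \<in> U. l \<le> fst u})"
proof -
  have fin: "finite U" using assms(2) finite_labels finite_subset by blast
  have "fst u = (\<Sum>l=1..k. if l \<le> fst u then 1 else 0)" if "u \<in> U" for u
  proof -
    have "(\<Sum>l=1..k. if l \<le> fst u then 1 else 0) = (\<Sum>l\<in>{1..k} \<inter> {..fst u}. 1::nat)"
      by (simp only: sum.inter_restrict[OF finite_atLeastAtMost] atMost_iff)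
    also have "{1..k} \<inter> {..fst u} = {1..fst u}" using labels_size[OF assms(1)] that assms(2) by fastforce
    finally show ?thesis by simp
  qed
  then have "(\<Sum>u\<in>U. fst u) = (\<Sum>u\<in>U. \<Sum>l=1..k. if l \<le> fst u then 1 else 0)" by simp
  also have "\<dots> = (\<Sum>l=1..k. \<Sum>u\<in>U. if l \<le> fst u then 1 else 0)" by (rule sum.swap)
  also have "\<dots> = (\<Sum>l=1..k. card {u \<in> U. l \<le> fst u})"
    using fin by (intro sum.cong refl) (simp add: sum.If_cases Int_def)
  finally show ?thesis .
qed

lemma sum_fibres_eq:
  assumes "finite U"
  shows "(\<Sum>u\<in>U. card {i \<in> {1..n}. c i = u}) = (\<Sum>l=1..k. card {i \<in> {1..n}. lev i = l \<and> c i \<in> U})"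
proof -
  have "(\<Sum>u\<in>U. card {i \<in> {1..n}. c i = u}) = (\<Sum>u\<in>U. \<Sum>i | i \<in> {i \<in> {1..n}. c i \<in> U} \<and> c i = u. 1)"
    by (intro sum.cong refl) (auto intro!: arg_cong[of _ _ card])
  also have "\<dots> = card {i \<in> {1..n}. c i \<in> U}"
    using assms by (subst sum.group) auto
  also have "\<dots> = (\<Sum>l=1..k. \<Sum>i | i \<in> {i \<in> {1..n}. c i \<in> U} \<and> lev i = l. 1)"
    using lev_range by (subst sum.group) auto
  also have "\<dots> = (\<Sum>l=1..k. card {i \<in> {1..n}. lev i = l \<and> c i \<in> U})"
    by (intro sum.cong refl) (auto intro!: arg_cong[of _ _ card])
  finally show ?thesis .
qed

text \<open>No label repeats within a level, which bounds the count by the number of labels; the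
  second bound is the capacity of the level.\<close>

lemma card_level_fibres_le:
  assumes fin: "finite U" and l: "1 \<le> l"
    and inj: "\<And>i j. i \<in> {1..n} \<Longrightarrow> j \<in> {1..n} \<Longrightarrow> i \<noteq> j \<Longrightarrow> lev i = lev j \<Longrightarrow> c i \<noteq> c j"
  shows "card {i \<in> {1..n}. lev i = l \<and> c i \<in> U} \<le> card U"
    and "card {i \<in> {1..n}. lev i = l \<and> c i \<in> U} \<le> count_ge lam l"
proof -
  have "inj_on c {i \<in> {1..n}. lev i = l \<and> c i \<in> U}"
  proof (rule inj_onI, rule ccontr)
    fix i j assume "i \<in> {i \<in> {1..n}. lev i = l \<and> c i \<in> U}" "j \<in> {i \<in> {1..n}. lev i = l \<and> c i \<in> U}"
      "c i = c j" "i \<noteq> j"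
    then show False using inj[of i j] by auto
  qed
  then show "card {i \<in> {1..n}. lev i = l \<and> c i \<in> U} \<le> card U"
    using fin by (intro card_inj_on_le) auto
  have "card {i \<in> {1..n}. lev i = l \<and> c i \<in> U} \<le> card {i \<in> {1..n}. lev i = l}"
    by (intro card_mono) auto
  then show "card {i \<in> {1..n}. lev i = l \<and> c i \<in> U} \<le> count_ge lam l"
    by (simp only: card_level[OF l])
qed

lemma card_permuted_fibre:
  assumes "\<sigma> permutes {1..n}" "sum_list nu = n" "u \<in> labels nu"
  shows "card {i \<in> {1..n}. grp nu (\<sigma> i) = u} = fst u"
proof -
  have "{i \<in> {1..n}. grp nu (\<sigma> i) = u} = {i \<in> {1..n}. \<sigma> i \<in> {j \<in> {1..n}. grp nu j = u}}"
    using permutes_in_image[OF assms(1)] by auto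
  also have "card \<dots> = card {j \<in> {1..n}. grp nu j = u}"
    by (rule card_permutes_preimage[OF assms(1)]) auto
  finally show ?thesis using card_grp_fibre[OF assms(2)] assms(3) by simp
qed

text \<open>A nonzero term places the groups of \<open>nu\<close> into the levels of \<open>lam\<close> without repetition;
  counting the groups of size at least \<open>c\<close> shows that \<open>nu\<close> does not exceed \<open>lam\<close>.\<close>

lemma phi_symmetrization_eq_0:
  assumes nu: "restricted_partition k n nu" and gt: "nu \<succ>\<^sub>l lam"
  shows "phi nu (symmetrization h) = 0"
proof (rule poly_eqI)
  fix z
  have "poly_at (symmetrization h) (\<lambda>j. z (grp nu j)) = 0"
  proof (rule poly_at_symmetrization_eq_0, rule ccontr)
    fix \<sigma> assume \<sigma>: "\<sigma> permutes {1..n}" and nz: "poly_at level_poly (\<lambda>i. z (grp nu (\<sigma> i))) \<noteq> 0"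
    obtain c where c: "1 \<le> c" "\<forall>d>c. count_ge nu d = count_ge lam d" "count_ge lam c < count_ge nu c"
      using gt lex_greater_iff lam nu by (auto simp: restricted_partition_def)
    define U where "U = {u \<in> labels nu. c \<le> fst u}"
    have U: "finite U" "U \<subseteq> labels nu" "card U = count_ge nu c" by (auto simp: U_def count_ge_def)
    define R where "R l = card {i \<in> {1..n}. lev i = l \<and> grp nu (\<sigma> i) \<in> U}" for l
    have ck: "c \<le> k"
    proof -
      have "U \<noteq> {}" using U(3) c(3) by auto
      then show ?thesis using labels_size[OF nu] by (fastforce simp: U_def)
    qed
    have inj: "i \<in> {1..n} \<Longrightarrow> j \<in> {1..n} \<Longrightarrow> i \<noteq> j \<Longrightarrow> lev i = lev j \<Longrightarrow> grp nu (\<sigma> i) \<noteq> grp nu (\<sigma> j)" for i j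
      using level_poly_nonzero(1)[OF nz] by metis
    have R_le: "R l \<le> card U" "R l \<le> count_ge lam l" if "1 \<le> l" for l
      unfolding R_def by (rule card_level_fibres_le[OF U(1) that], rule inj; assumption)+
    have ge: "{u \<in> U. l \<le> fst u} = {u \<in> labels nu. max c l \<le> fst u}" for l
      by (auto simp: U_def)
    then have ge': "card {u \<in> U. l \<le> fst u} = count_ge nu (max c l)" for l
      by (simp add: count_ge_def)
    \<comment> \<open>For \<open>l \<le> c\<close> the bound is \<open>card U\<close>, the count for
      \<open>nu\<close> at \<open>c\<close>; for \<open>l > c\<close> the counts for
      \<open>nu\<close> and \<open>lam\<close> agree. At \<open>l = c\<close> the capacity of
      \<open>lam\<close> is strictly smaller.\<close>
    have "(\<Sum>l=1..k. R l) < (\<Sum>l=1..k. card {u \<in> U. l \<le> fst u})"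
    proof (rule sum_strict_mono_ex1)
      show "\<forall>l\<in>{1..k}. R l \<le> card {u \<in> U. l \<le> fst u}"
      proof
        fix l assume l: "l \<in> {1..k}"
        then show "R l \<le> card {u \<in> U. l \<le> fst u}"
          using R_le[of l] U(3) c(2) by (cases "l \<le> c") (auto simp: ge' max_def)
      qed
      show "\<exists>l\<in>{1..k}. R l < card {u \<in> U. l \<le> fst u}"
        using R_le(2)[of c] c ck by (intro bexI[of _ c]) (auto simp: ge')
    qed simp
    also have "\<dots> = (\<Sum>u\<in>U. fst u)" by (rule sum_sizes_eq[OF nu U(2), symmetric])
    also have "\<dots> = (\<Sum>u\<in>U. card {i \<in> {1..n}. grp nu (\<sigma> i) = u})"
      using U(2) nu card_permuted_fibre[OF \<sigma>, of nu]
      by (intro sum.cong refl) (auto simp: restricted_partition_def)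
    also have "\<dots> = (\<Sum>l=1..k. R l)"
      unfolding R_def by (rule sum_fibres_eq[OF U(1)])
    finally show False by simp
  qed
  then show "poly_at (phi nu (symmetrization h)) z = poly_at 0 z"
    by (simp add: poly_at_phi poly_at_0)
qed

lemma symmetrization_Gamma:
  assumes "h \<in> level_invariants"
  shows "symmetrization h \<in> Gamma k n lam"
  using symmetrization_F3[OF assms] phi_symmetrization_eq_0 by (simp add: Gamma_def)

text \<open>The permutations that put variables of pairwise different groups on each level; for all
  others a squared difference vanishes under \<open>phi lam\<close>.\<close>

definition good_perms :: "(nat \<Rightarrow> nat) set" where
  "good_perms = {\<sigma>. \<sigma> permutes {1..n} \<and>
     (\<forall>i\<in>{1..n}. \<forall>j\<in>{1..n}. i \<noteq> j \<and> lev i = lev j \<longrightarrow> grp lam (\<sigma> i) \<noteq> grp lam (\<sigma> j))}"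

text \<open>The equality case of the same count: with \<open>lam\<close> in place of
  \<open>nu\<close> both totals agree, so every level attains its bound, and all variables of level
  \<open>t\<close> fall into groups of size at least \<open>t\<close>.\<close>

lemma good_perm_level:
  assumes "\<sigma> \<in> good_perms" "j \<in> {1..n}"
  shows "lev j \<le> fst (grp lam (\<sigma> j))"
proof -
  have \<sigma>: "\<sigma> permutes {1..n}"
    and inj: "\<And>i j. i \<in> {1..n} \<Longrightarrow> j \<in> {1..n} \<Longrightarrow> i \<noteq> j \<Longrightarrow> lev i = lev j \<Longrightarrow> grp lam (\<sigma> i) \<noteq> grp lam (\<sigma> j)"
    using assms(1) by (auto simp: good_perms_def)
  define t where "t = lev j"
  have t: "1 \<le> t" "t \<le> k" using lev_range[OF assms(2)] by (auto simp: t_def)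
  define U where "U = {u \<in> labels lam. t \<le> fst u}"
  have U: "finite U" "U \<subseteq> labels lam" "card U = count_ge lam t" by (auto simp: U_def count_ge_def)
  define R where "R l = card {i \<in> {1..n}. lev i = l \<and> grp lam (\<sigma> i) \<in> U}" for l
  have R_le: "R l \<le> card U" "R l \<le> count_ge lam l" if "1 \<le> l" for l
      unfolding R_def by (rule card_level_fibres_le[OF U(1) that], rule inj; assumption)+
  have "{u \<in> U. l \<le> fst u} = {u \<in> labels lam. max t l \<le> fst u}" for l
    by (auto simp: U_def)
  then have ge: "card {u \<in> U. l \<le> fst u} = count_ge lam (max t l)" for l
    by (simp add: count_ge_def)
  have "(\<Sum>l=1..k. R l) = (\<Sum>u\<in>U. card {i \<in> {1..n}. grp lam (\<sigma> i) = u})"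
    unfolding R_def by (rule sum_fibres_eq[OF U(1), symmetric])
  also have "\<dots> = (\<Sum>u\<in>U. fst u)"
    using U(2) card_permuted_fibre[OF \<sigma> sum_lam] by (intro sum.cong refl) auto
  also have "\<dots> = (\<Sum>l=1..k. card {u \<in> U. l \<le> fst u})" by (rule sum_sizes_eq[OF lam U(2)])
  finally have "R t = card {u \<in> U. t \<le> fst u}"
  proof (rule sum_mono_inv)
    fix l assume l: "l \<in> {1..k}"
    then show "R l \<le> card {u \<in> U. l \<le> fst u}"
      using R_le[of l] U(3) by (cases "l \<le> t") (auto simp: ge max_def)
  qed (use t in auto)
  then have "card {i \<in> {1..n}. lev i = t \<and> grp lam (\<sigma> i) \<in> U} = card {i \<in> {1..n}. lev i = t}"
    using card_level[OF t(1)] by (simp add: R_def ge)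
  then have "{i \<in> {1..n}. lev i = t \<and> grp lam (\<sigma> i) \<in> U} = {i \<in> {1..n}. lev i = t}"
    by (intro card_subset_eq) auto
  then have "grp lam (\<sigma> j) \<in> U" using assms(2) by (auto simp: t_def)
  then show ?thesis by (simp add: U_def t_def)
qed

text \<open>Group after \<open>\<sigma>\<close> and level together again fill every cell once. Hence
  some level-preserving \<open>\<tau>\<close> leads to the same groups, and level invariants cannot
  distinguish the two.\<close>

lemma good_perm_rearrange:
  assumes \<sigma>: "\<sigma> \<in> good_perms"
  shows "\<exists>\<tau>. \<tau> permutes {1..n} \<and> (\<forall>i\<in>{1..n}. lev (\<tau> i) = lev i \<and> grp lam (\<tau> i) = grp lam (\<sigma> i))"
proof -
  let ?f = "\<lambda>i. (grp lam (\<sigma> i), lev i)"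
  have inj: "inj_on ?f {1..n}" using \<sigma> by (auto simp: good_perms_def inj_on_def)
  have "?f ` {1..n} \<subseteq> slots lam"
  proof
    fix s assume "s \<in> ?f ` {1..n}"
    then obtain i where i: "i \<in> {1..n}" "s = ?f i" by auto
    have "\<sigma> i \<in> {1..n}" using i \<sigma> by (simp add: good_perms_def permutes_in_image del: atLeastAtMost_iff)
    then show "s \<in> slots lam"
      using i slot[of i] slot[of "\<sigma> i"] good_perm_level[OF \<sigma> i(1)] by (auto simp: slots_def)
  qed
  moreover have "card (?f ` {1..n}) = card (slots lam)"
    using card_image[OF inj] bij_betw_same_card[OF slots] by simp
  ultimately have "?f ` {1..n} = slots lam" by (intro card_subset_eq) auto
  then have f: "bij_betw ?f {1..n} (slots lam)" using inj by (simp add: bij_betw_def)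
  have "card {a \<in> {1..n}. ?f a = s} = card {a \<in> {1..n}. (grp lam a, lev a) = s}" for s
    by (simp only: card_bij_fibre[OF slots] card_bij_fibre[OF f])
  from permutes_of_equal_fibres[OF _ this] show ?thesis by auto
qed

lemma phi_symmetrization:
  assumes h: "h \<in> level_invariants"
  shows "phi lam (symmetrization h) = Const (of_nat (card good_perms)) * (phi lam level_poly * phi lam h)"
proof (rule poly_eqI)
  fix z :: "nat \<times> nat \<Rightarrow> complex"
  let ?y = "\<lambda>j. z (grp lam j)"
  let ?T = "\<lambda>\<sigma>. poly_at level_poly (\<lambda>i. ?y (\<sigma> i)) * poly_at h (\<lambda>i. ?y (\<sigma> i))"
  have fin: "finite {\<sigma>. \<sigma> permutes {1..n}}" by (rule finite_permutations) simp
  have "(\<Sum>\<sigma> | \<sigma> permutes {1..n}. ?T \<sigma>) = (\<Sum>\<sigma>\<in>good_perms. ?T \<sigma>)"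
  proof (rule sum.mono_neutral_right[OF fin], safe)
    fix \<sigma> assume \<sigma>: "\<sigma> permutes {1..n}" "\<sigma> \<notin> good_perms"
    then obtain i j where "i \<in> {1..n}" "j \<in> {1..n}" "i \<noteq> j" "lev i = lev j" "grp lam (\<sigma> i) = grp lam (\<sigma> j)"
      by (auto simp: good_perms_def)
    then have "poly_at level_poly (\<lambda>i. ?y (\<sigma> i)) = 0"
      using level_poly_nonzero(1)[of "\<lambda>i. ?y (\<sigma> i)" i j] by auto
    then show "?T \<sigma> = 0" by simp
  qed (auto simp: good_perms_def)
  also have "\<dots> = (\<Sum>\<sigma>\<in>good_perms. poly_at level_poly ?y * poly_at h ?y)"
  proof (rule sum.cong[OF refl])
    fix \<sigma> assume "\<sigma> \<in> good_perms"
    then obtain \<tau> where \<tau>: "\<tau> permutes {1..n}"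
      "\<forall>i\<in>{1..n}. lev (\<tau> i) = lev i \<and> grp lam (\<tau> i) = grp lam (\<sigma> i)"
      using good_perm_rearrange by blast
    have "poly_at p (\<lambda>i. ?y (\<sigma> i)) = poly_at p ?y" if p: "p \<in> level_invariants" for p
    proof -
      have "poly_at p (\<lambda>i. ?y (\<sigma> i)) = poly_at p (\<lambda>i. ?y (\<tau> i))"
        using p \<tau>(2) by (intro poly_at_cong) (auto simp: level_invariants_def)
      also have "\<dots> = poly_at p ?y" using \<tau>(2) by (intro level_invariants_permute[OF p \<tau>(1)]) blast
      finally show ?thesis .
    qed
    then show "?T \<sigma> = poly_at level_poly ?y * poly_at h ?y"
      using h level_poly_invariant by simp
  qed
  finally show "poly_at (phi lam (symmetrization h)) z =
      poly_at (Const (of_nat (card good_perms)) * (phi lam level_poly * phi lam h)) z"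
    by (simp add: poly_at_phi poly_at_symmetrization poly_at_mult poly_at_Const)
qed

lemma card_good_perms: "card good_perms \<noteq> 0"
proof -
  have "finite good_perms"
    by (rule finite_subset[OF _ finite_permutations[of "{1..n}"]]) (auto simp: good_perms_def)
  moreover have "id \<in> good_perms"
    unfolding good_perms_def
  proof (intro CollectI conjI ballI impI notI permutes_id)
    fix i j assume ij: "i \<in> {1..n}" "j \<in> {1..n}" "i \<noteq> j \<and> lev i = lev j" "grp lam (id i) = grp lam (id j)"
    then have "(grp lam i, lev i) = (grp lam j, lev j)" by simp
    then have "i = j" using ij(1,2) by (rule inj_onD[OF bij_betw_imp_inj_on[OF slots]])
    then show False using ij(3) by simp
  qed
  ultimately show ?thesis by auto
qed

text \<open>Pairs of variables become pairs of cells. Different rows yield the powers of sums and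
  differences; within one row no two cells share a column, and cells in paired columns contribute
  \<open>2 * z u\<close>, whence the power of 2.\<close>

lemma phi_level_poly:
  "phi lam level_poly = Const (2 ^ (\<Sum>u\<in>labels lam. fst u - b0 k)) * G3 k lam"
proof (rule poly_eqI)
  fix z
  define g :: "(nat \<times> nat) \<times> nat \<Rightarrow> (nat \<times> nat) \<times> nat \<Rightarrow> complex" where
    "g s t = (if snd s = snd t then (z (fst s) - z (fst t))\<^sup>2 else 1) *
       (if snd s + snd t = k + 1 then z (fst s) + z (fst t) else 1)" for s t
  have g_commute: "g s t = g t s" for s t
    by (auto simp: g_def power2_commute add.commute)
  let ?P = "{(s, t). s \<in> slots lam \<and> t \<in> slots lam \<and> s < t}"
  let ?P1 = "{(s, t). s \<in> slots lam \<and> t \<in> slots lam \<and> fst s < fst t}"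
  let ?P2 = "{(s, t). s \<in> slots lam \<and> t \<in> slots lam \<and> fst s = fst t \<and> snd s < snd t}"
  let ?D = "\<lambda>a. {(l, m). l \<in> {1..a} \<and> m \<in> {1..a} \<and> l < (m::nat)}"
  have fin: "finite ?P1" "finite ?P2"
    by (rule finite_subset[of _ "slots lam \<times> slots lam"]; auto)+
  have finD: "finite (?D a)" for a
    by (rule finite_subset[of _ "{1..a} \<times> {1..a}"]) auto
  have size: "fst u \<le> k" if "u \<in> labels lam" for u using labels_size[OF lam that] by simp
  have "poly_at (phi lam level_poly) z = (\<Prod>(i, j)\<in>position_pairs. g (grp lam i, lev i) (grp lam j, lev j))"
    unfolding poly_at_phi poly_at_level_poly pair_factor_def g_def fst_conv snd_conv ..
  also have "\<dots> = (\<Prod>(s, t)\<in>?P. g s t)"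
    unfolding position_pairs_def
    by (rule prod_tournament_bij[OF slots tournament_less tournament_less g_commute])
  also have "?P = ?P1 \<union> ?P2" by (auto simp: less_prod_def)
  also have "(\<Prod>(s, t)\<in>?P1 \<union> ?P2. g s t) = (\<Prod>(s, t)\<in>?P1. g s t) * (\<Prod>(s, t)\<in>?P2. g s t)"
    using fin by (intro prod.union_disjoint) auto
  also have "(\<Prod>(s, t)\<in>?P1. g s t) = (\<Prod>(u, w)\<in>pairs lam.
      (z u - z w) ^ (2 * min (fst u) (fst w)) * (z u + z w) ^ (fst u + fst w - k))"
  proof -
    have "(\<Prod>(s, t)\<in>?P1. g s t) =
        (\<Prod>(p, q)\<in>(SIGMA p:pairs lam. {1..fst (fst p)} \<times> {1..fst (snd p)}). g (fst p, fst q) (snd p, snd q))"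
      by (rule prod.reindex_bij_witness[where i = "\<lambda>(p, q). ((fst p, fst q), (snd p, snd q))"
            and j = "\<lambda>(s, t). ((fst s, fst t), (snd s, snd t))"])
         (auto simp: slots_def pairs_def)
    also have "\<dots> = (\<Prod>p\<in>pairs lam. \<Prod>q\<in>{1..fst (fst p)} \<times> {1..fst (snd p)}. g (fst p, fst q) (snd p, snd q))"
      by (intro prod.Sigma[symmetric]) auto
    also have "\<dots> = (\<Prod>p\<in>pairs lam. \<Prod>l\<in>{1..fst (fst p)}. \<Prod>m\<in>{1..fst (snd p)}. g (fst p, l) (snd p, m))"
      by (simp add: prod.cartesian_product case_prod_beta)
    also have "\<dots> = (\<Prod>(u, w)\<in>pairs lam.
      (z u - z w) ^ (2 * min (fst u) (fst w)) * (z u + z w) ^ (fst u + fst w - k))"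
    proof (rule prod.cong[OF refl])
      fix p assume p: "p \<in> pairs lam"
      obtain u w where uw: "p = (u, w)" by (cases p)
      have "u \<in> labels lam" "w \<in> labels lam" using p uw by (auto simp: pairs_def)
      then show "(\<Prod>l\<in>{1..fst (fst p)}. \<Prod>m\<in>{1..fst (snd p)}. g (fst p, l) (snd p, m)) =
        (case p of (u, w) \<Rightarrow> (z u - z w) ^ (2 * min (fst u) (fst w)) * (z u + z w) ^ (fst u + fst w - k))"
        unfolding uw g_def fst_conv snd_conv prod.case
        by (simp only: prod.distrib prod_if_eq_const prod_if_antidiag_const size power_mult)
    qed
    finally show ?thesis .
  qed
  also have "(\<Prod>(s, t)\<in>?P2. g s t) = (\<Prod>u\<in>labels lam. (2 * z u) ^ (fst u - b0 k))"
  proof -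
    have "(\<Prod>(s, t)\<in>?P2. g s t) = (\<Prod>(u, q)\<in>(SIGMA u:labels lam. ?D (fst u)). g (u, fst q) (u, snd q))"
      by (rule prod.reindex_bij_witness[where i = "\<lambda>(u, q). ((u, fst q), (u, snd q))"
            and j = "\<lambda>(s, t). (fst s, (snd s, snd t))"])
         (auto simp: slots_def)
    also have "\<dots> = (\<Prod>u\<in>labels lam. \<Prod>q\<in>?D (fst u). g (u, fst q) (u, snd q))"
      using finD by (intro prod.Sigma[symmetric]) auto
    also have "\<dots> = (\<Prod>u\<in>labels lam. (2 * z u) ^ (fst u - b0 k))"
    proof (rule prod.cong[OF refl])
      fix u assume u: "u \<in> labels lam"
      have "(\<Prod>q\<in>?D (fst u). g (u, fst q) (u, snd q)) = (\<Prod>(l, m)\<in>?D (fst u). if l + m = k + 1 then 2 * z u else 1)"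
        by (intro prod.cong refl) (auto simp: g_def)
      then show "(\<Prod>q\<in>?D (fst u). g (u, fst q) (u, snd q)) = (2 * z u) ^ (fst u - b0 k)"
        by (simp only: prod_if_antidiag_less_const[OF size[OF u]])
    qed
    finally show ?thesis .
  qed
  finally show "poly_at (phi lam level_poly) z =
      poly_at (Const (2 ^ (\<Sum>u\<in>labels lam. fst u - b0 k)) * G3 k lam) z"
    by (simp add: poly_at_mult poly_at_Const poly_at_G3[OF lam] case_prod_beta prod.distrib
        power_mult_distrib power_sum mult_ac)
qed

lemma G3_S_alg_subset:
  assumes k: "1 \<le> k"
  shows "(\<lambda>s. G3 k lam * s) ` S_alg k lam \<subseteq> phi lam ` Gamma k n lam"
proof
  fix p assume "p \<in> (\<lambda>s. G3 k lam * s) ` S_alg k lam"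
  then obtain s where s: "s \<in> inv_polys lam" "p = G3 k lam * s"
    by (auto simp: inv_polys_eq_S_alg[OF k lam])
  obtain h where h: "h \<in> level_invariants" "phi lam h = s"
    using level_invariants_onto[OF s(1)] by auto
  \<comment> \<open>\<open>N\<close> collects the constants of \<open>phi_symmetrization\<close> and
    \<open>phi_level_poly\<close>; \<open>h'\<close> compensates for it in advance.\<close>
  define N :: complex where "N = of_nat (card good_perms) * 2 ^ (\<Sum>u\<in>labels lam. fst u - b0 k)"
  have N: "N \<noteq> 0" using card_good_perms by (simp add: N_def)
  define h' where "h' = Const (1 / N) * h"
  have h': "h' \<in> level_invariants"
    unfolding h'_def by (intro level_invariants_mult level_invariants_Const h)
  have "phi lam (symmetrization h') =
      Const (of_nat (card good_perms)) * (Const (2 ^ (\<Sum>u\<in>labels lam. fst u - b0 k)) * G3 k lam * (Const (1 / N) * s))"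
    unfolding phi_symmetrization[OF h'] phi_level_poly by (simp add: h'_def phi_simps h(2))
  also have "\<dots> = p"
    using N by (intro poly_eqI) (simp add: s(2) poly_at_mult poly_at_Const N_def)
  finally show "p \<in> phi lam ` Gamma k n lam"
    using symmetrization_Gamma[OF h'] by blast
qed

end

text \<open>A group has as many variables as its row has cells, so its variables can be distributed
  over that row bijectively.\<close>

lemma exists_levels:
  assumes "restricted_partition k n lam"
  shows "\<exists>lev. levels k n lam lev"
proof -
  have sum: "sum_list lam = n" using assms by (simp add: restricted_partition_def)
  have "card {s \<in> slots lam. fst s = u} = card {j \<in> {1..n}. grp lam j = u}" for u
  proof -
    have "{s \<in> slots lam. fst s = u} = (if u \<in> labels lam then {u} \<times> {1..fst u} else {})"
      by (auto simp: slots_def)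
    then show ?thesis
      by (simp only: card_grp_fibre[OF sum]) (simp add: card_cartesian_product)
  qed
  then obtain \<beta> where \<beta>: "bij_betw \<beta> {1..n} (slots lam)" "\<forall>j\<in>{1..n}. fst (\<beta> j) = grp lam j"
    using bij_of_equal_fibres[of "{1..n}" "slots lam" "grp lam" fst] by auto
  have "bij_betw (\<lambda>j. (grp lam j, snd (\<beta> j))) {1..n} (slots lam)"
    using \<beta>(1) by (rule bij_betw_cong[THEN iffD1, rotated]) (simp add: \<beta>(2)[rule_format, symmetric])
  then have "levels k n lam (\<lambda>j. snd (\<beta> j))" using assms by (simp add: levels_def)
  then show ?thesis by (intro exI)
qed

theorem corollary9p8:
  fixes k n :: nat and lam :: "nat list"
  assumes "k \<ge> 1"
    and "restricted_partition k n lam"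
  shows "phi lam ` Gamma k n lam = (\<lambda>s. G3 k lam * s) ` S_alg k lam"
proof
  obtain lev where "levels k n lam lev" using exists_levels[OF assms(2)] ..
  then show "(\<lambda>s. G3 k lam * s) ` S_alg k lam \<subseteq> phi lam ` Gamma k n lam"
    using assms(1) by (rule levels.G3_S_alg_subset)
qed (rule phi_Gamma_subset[OF assms])

end
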